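(* Assume that $k_2\neq k_3$. Let $N,\ell\in\mathbb{N}^*$ be such that $\ell\le N$, let $U_0\in H^N(\mathbb{R})\cap L^1(\mathbb{R})$ (componentwise), and let $U=(v,u,z,y,\phi,\theta,\eta,q)^T$ be the solution of the Cauchy problem $$\begin{cases} v_t-u_x-y-\theta=0,\\ u_t-k_1v_x+\gamma\eta_x=0,\\ z_t-y_x=0,\\ y_t-k_2z_x+k_1v=0,\\ \phi_t-\theta_x=0,\\ \theta_t-k_3\phi_x+k_1v=0,\\ \eta_t+k_4q_x+\gamma u_x=0,\\ q_t+k_5q+k_4\eta_x=0,\end{cases}\qquad x\in\mathbb{R},\ t>0,\qquad U(\cdot,0)=U_0 .$$ Then, for any $j\in\{0,\dots,N-\ell\}$, there exists $c_0>0$ such that $$\|\partial_x^jU(\cdot,t)\|_{L^2(\mathbb{R})}\le c_0(1+t)^{-1/12-j/6}\|U_0\|_{L^1(\mathbb{R})}+c_0(1+t)^{-\ell/2}\|\partial_x^{j+\ell}U_0\|_{L^2(\mathbb{R})},\qquad\forall t\in\mathbb{R}_+ .$$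
   Context: $k_1,k_2,k_3,k_4,k_5,\gamma>0$ are constants; $\mathbb{N}^*$ is the set of positive integers and $\mathbb{R}_+=[0,\infty)$. The system is the first-order form (with $u=\varphi_t$, $y=\psi_t$, $\theta=w_t$, $v=\varphi_x+\psi+w$, $z=\psi_x$, $\phi=w_x$) of the laminated Timoshenko system with interfacial slip coupled to Cattaneo heat conduction acting through the first (transversal displacement) equation. The solution $U$ is the one whose Fourier transform in $x$, $\widehat U(\xi,t)$, solves for each $\xi\in\mathbb{R}$ the linear ODE system obtained by replacing $\partial_x$ by $i\xi$, with initial value $\widehat U_0(\xi)$. Norms of vector-valued functions are the usual ones. *)

theory Defs
  imports "HOL-Analysis.Analysis"
begin

section \<open>Sobolev spaces on the real line\<close>

definition L2 :: "(real \<Rightarrow> 'a::euclidean_space) set" where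
  "L2 = {f. f \<in> borel_measurable lborel \<and> integrable lborel (\<lambda>x. (norm (f x))\<^sup>2)}"

definition L2_norm :: "(real \<Rightarrow> 'a::euclidean_space) \<Rightarrow> real" where
  "L2_norm f = sqrt (\<integral>x. (norm (f x))\<^sup>2 \<partial>lborel)"

definition L1_norm :: "(real \<Rightarrow> 'a::euclidean_space) \<Rightarrow> real" where
  "L1_norm f = (\<integral>x. norm (f x) \<partial>lborel)"

definition test_function :: "(real \<Rightarrow> real) \<Rightarrow> bool" where
  "test_function \<rho> \<longleftrightarrow>
     (\<forall>k x. (deriv ^^ k) \<rho> differentiable (at x)) \<and> compact (closure {x. \<rho> x \<noteq> 0})"

definition has_L2_weak_deriv ::
    "nat \<Rightarrow> (real \<Rightarrow> 'a::euclidean_space) \<Rightarrow> (real \<Rightarrow> 'a) \<Rightarrow> bool" where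
  "has_L2_weak_deriv k f g \<longleftrightarrow> f \<in> L2 \<and> g \<in> L2 \<and>
     (\<forall>\<rho>. test_function \<rho> \<longrightarrow>
        (\<integral>x. (deriv ^^ k) \<rho> x *\<^sub>R f x \<partial>lborel) = (-1) ^ k *\<^sub>R (\<integral>x. \<rho> x *\<^sub>R g x \<partial>lborel))"

definition sobolev :: "nat \<Rightarrow> (real \<Rightarrow> 'a::euclidean_space) set" where
  "sobolev N = {f. \<forall>k\<le>N. \<exists>g. has_L2_weak_deriv k f g}"

text \<open>Weak derivatives are unique up to null sets, so norms of the chosen representative do not
  depend on the choice. The value is meaningful for \<open>f \<in> sobolev N\<close> and \<open>k \<le> N\<close> only.\<close>

definition weak_deriv :: "nat \<Rightarrow> (real \<Rightarrow> 'a::euclidean_space) \<Rightarrow> real \<Rightarrow> 'a" where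
  "weak_deriv k f = (SOME g. has_L2_weak_deriv k f g)"


section \<open>Fourier transform\<close>

definition fourier :: "(real \<Rightarrow> complex) \<Rightarrow> real \<Rightarrow> complex" where
  "fourier f \<xi> = (\<integral>x. exp (- \<i> * of_real \<xi> * of_real x) * f x \<partial>lborel)"

text \<open>The Fourier--Plancherel transform as a relation: \<open>g\<close> is the \<open>L\<^sup>2\<close>-limit of the transforms of
  the truncations of \<open>f\<close> to \<open>[-R, R]\<close>. It determines \<open>g\<close> from \<open>f\<close>, and \<open>f\<close> from \<open>g\<close>, up to
  null sets.\<close>

definition has_L2_fourier :: "(real \<Rightarrow> complex) \<Rightarrow> (real \<Rightarrow> complex) \<Rightarrow> bool" where
  "has_L2_fourier f g \<longleftrightarrow> f \<in> L2 \<and> g \<in> L2 \<and>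
     ((\<lambda>R. \<integral>\<^sup>+\<xi>. ennreal ((cmod (g \<xi> - fourier (\<lambda>x. indicator {-R..R} x *\<^sub>R f x) \<xi>))\<^sup>2) \<partial>lborel)
        \<longlongrightarrow> 0) at_top"


section \<open>The laminated Timoshenko--Cattaneo system\<close>

text \<open>The components \<open>1, \<dots>, 8\<close> of the unknown are \<open>v, u, z, y, \<phi>, \<theta>, \<eta>, q\<close>, in this order
  (in the index type \<open>8\<close> the numeral \<open>8\<close> denotes \<open>0\<close>, so these are eight distinct indices).
  The predicate below is the system with \<open>\<partial>\<^sub>x\<close> replaced by \<open>\<i>\<xi>\<close>; the derivative at \<open>t = 0\<close> is
  one-sided.\<close>

definition solves_transformed_system ::
    "real \<Rightarrow> real \<Rightarrow> real \<Rightarrow> real \<Rightarrow> real \<Rightarrow> real \<Rightarrow> real \<Rightarrow> (real \<Rightarrow> complex ^ 8) \<Rightarrow> bool" where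
  "solves_transformed_system k1 k2 k3 k4 k5 \<gamma> \<xi> W \<longleftrightarrow>
     (\<forall>t\<ge>0.
        let D = (\<lambda>i d. ((\<lambda>s. W s $ i) has_vector_derivative d) (at t within {0..}));
            dx = (\<lambda>i. \<i> * of_real \<xi> * W t $ i);
            v = W t $ 1; y = W t $ 4; \<theta> = W t $ 6; q = W t $ 8
        in D 1 (dx 2 + y + \<theta>)
         \<and> D 2 (of_real k1 * dx 1 - of_real \<gamma> * dx 7)
         \<and> D 3 (dx 4)
         \<and> D 4 (of_real k2 * dx 3 - of_real k1 * v)
         \<and> D 5 (dx 6)
         \<and> D 6 (of_real k3 * dx 5 - of_real k1 * v)
         \<and> D 7 (- of_real k4 * dx 8 - of_real \<gamma> * dx 2)
         \<and> D 8 (- of_real k5 * q - of_real k4 * dx 7))"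

definition timoshenko_solution ::
    "real \<Rightarrow> real \<Rightarrow> real \<Rightarrow> real \<Rightarrow> real \<Rightarrow> real \<Rightarrow>
     (real \<Rightarrow> real ^ 8) \<Rightarrow> (real \<Rightarrow> real \<Rightarrow> real ^ 8) \<Rightarrow> bool" where
  "timoshenko_solution k1 k2 k3 k4 k5 \<gamma> U0 U \<longleftrightarrow>
     (\<exists>Uhat :: real \<Rightarrow> real \<Rightarrow> complex ^ 8.
        (\<forall>\<xi>. solves_transformed_system k1 k2 k3 k4 k5 \<gamma> \<xi> (Uhat \<xi>)) \<and>
        (\<forall>\<xi> i. Uhat \<xi> 0 $ i = fourier (\<lambda>x. of_real (U0 x $ i)) \<xi>) \<and>
        (\<forall>t\<ge>0. \<forall>i. has_L2_fourier (\<lambda>x. of_real (U t x $ i)) (\<lambda>\<xi>. Uhat \<xi> t $ i)))"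

end

theory Submission
  imports Defs "HOL-Probability.Probability" "HOL-Computational_Algebra.Polynomial"
begin

text \<open>At each frequency \<open>\<xi>\<close> the transformed system is, in suitable orthonormal coordinates, a real
  skew-symmetric tridiagonal system of eight unknowns that is damped only in the first one. All
  couplings are proportional to \<open>\<xi>\<close>, except the one between \<open>v\<close> and \<open>y + \<theta>\<close>, and the sixth one is
  proportional to \<open>k2 - k3\<close>. Correcting the energy by small multiples of the products of neighbouring
  unknowns, with weights depending on \<open>\<xi>\<close>, gives a Lyapunov function decaying at the rate
  \<open>\<xi>^6 / (1 + \<xi>^2)^4\<close>. Low frequencies then decay like the \<open>L\<^sup>2\<close> norm of \<open>\<xi>^j exp (- c \<xi>^6 t)\<close>, and
  at high frequencies the factor \<open>exp (- c t / \<xi>^2)\<close> trades \<open>l\<close> derivatives for \<open>(1 + t)^(-l/2)\<close>.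

  No full Plancherel theorem is needed to pass between derivatives and frequencies: the Bessel
  inequality \<open>\<parallel>f^\<parallel>\<^sup>2 \<le> 2 \<pi> \<parallel>f\<parallel>\<^sup>2\<close> on \<open>L\<^sup>1 \<inter> L\<^sup>2\<close> (from a Gaussian regularisation), the Parseval relation
  against test functions, and the completeness of \<open>L\<^sup>2\<close> suffice.\<close>

section \<open>Decay along a damped chain\<close>

text \<open>The coupling of \<open>v\<close> with \<open>y + \<theta>\<close> stays of order one as
  \<xi> tends to 0, so \<open>x 3\<close> and \<open>x 4\<close> exchange energy at a fixed speed
  while all other exchanges slow down; this is the obstacle at low frequencies. The hypothesis
  \<open>k2 \<noteq> k3\<close> keeps the last two unknowns linked to the damping: if the sixth
  coupling vanished, they would form an undamped oscillator. The exponents of the theorem come from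
  the scaling of the integral of \<open>\<xi>^(2 j) exp (- c \<xi>^6 t)\<close>, which is of order
  \<open>t^(-(2 j + 1) / 6)\<close>; its square root gives 1/12 and j/6. The two weak derivatives in
  the estimate play different roles. That of \<open>U0\<close> is given, and its transform has to be
  bounded although the derivative need not be integrable; this is done by mollification. That of
  \<open>U t\<close> has to be constructed, as an \<open>L\<^sup>2\<close> limit of inverse
  transforms of truncations. Since \<open>weak_deriv\<close> picks some representative, uniqueness
  almost everywhere is part of the argument.\<close>

text \<open>With \<open>\<epsilon> n = \<eta>^(2 e n)\<close> for a strictly concave increasing \<open>e\<close>, each error product is dominated by the
  negative squares on both sides of it once \<open>\<eta>\<close> is small.\<close>

lemma hierarchical_form_negative:
  fixes \<kappa> \<alpha> M \<delta> :: real and N :: nat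
  assumes "\<kappa> > 0" "\<alpha> > 0" "M \<ge> 0" "\<delta> > 0"
  shows "\<exists>(\<epsilon> :: nat \<Rightarrow> real) c. c > 0 \<and> (\<forall>n. 0 < \<epsilon> n) \<and> (\<forall>n\<in>{1..N}. \<epsilon> n \<le> \<delta>) \<and>
    (\<forall>y :: nat \<Rightarrow> real. (\<forall>i. y i \<ge> 0) \<longrightarrow>
       - \<kappa> * (y 0)\<^sup>2 + (\<Sum>n=1..N. \<epsilon> n * (- \<alpha> * (y n)\<^sup>2 + M * ((\<Sum>i<n. y i) * (\<Sum>j\<le>min N (n+1). y j))))
       \<le> - c * (\<Sum>i\<le>N. (y i)\<^sup>2))"
proof -
  define \<mu> where "\<mu> = min \<kappa> \<alpha>"
  have \<mu>: "\<mu> > 0" "\<mu> \<le> \<kappa>" "\<mu> \<le> \<alpha>" using assms by (auto simp: \<mu>_def)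
  \<comment> \<open>There are \<open>N\<close> error terms, each at most
    \<open>M * \<eta>^2 * (N+1) * S\<close> after rescaling, so \<open>B\<close> is the total
    constant, and \<eta> is taken so small that \<open>\<eta>^2 * B\<close> uses up at most half of
    \<mu>.\<close>
  define B where "B = real N * (M * real (N+1))"
  have B: "B \<ge> 0" using assms by (simp add: B_def)
  define \<eta> where "\<eta> = min (min 1 \<delta>) (\<mu> / (2 * (B + 1)))"
  have \<eta>: "\<eta> > 0" "\<eta> \<le> 1" "\<eta> \<le> \<delta>" "\<eta> \<le> \<mu> / (2 * (B + 1))"
    using \<mu> B assms by (auto simp: \<eta>_def)
  have \<eta>2: "\<eta>\<^sup>2 \<le> \<eta>" using \<eta> by (simp add: power2_eq_square mult_left_le)
  have \<eta>B: "\<eta>\<^sup>2 * B \<le> \<mu> / 2"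
  proof -
    have "\<eta>\<^sup>2 * B \<le> \<eta> * (B + 1)" using \<eta>2 B \<eta> by (intro mult_mono) auto
    also have "\<dots> \<le> \<mu> / (2 * (B + 1)) * (B + 1)" using \<eta> B by (intro mult_right_mono) auto
    also have "\<dots> = \<mu> / 2" using B by (simp add: field_simps)
    finally show ?thesis .
  qed
  \<comment> \<open>A parabola with second difference -2, so that \<open>2 * e n\<close> exceeds
    \<open>e (n-1) + e (n+1)\<close> by exactly 2, which leaves a spare factor
    \<open>\<eta>^2\<close> in each error. Its vertex is at \<open>N + 1\<close>, hence it increases
    on the range in use, and \<open>e 0 = 0\<close> leaves \<open>y 0\<close> unscaled.\<close>
  define e where "e i = i * (2 * N + 2 - i)" for i :: nat
  have e_int: "int (e i) = int i * (2 * int N + 2 - int i)" if "i \<le> 2 * N + 2" for i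
    using that by (simp add: e_def of_nat_diff)
  have e_mono: "e i \<le> e j" if "i \<le> j" "j \<le> N + 1" for i j
  proof -
    have "int (e j) - int (e i) = (int j - int i) * (2 * int N + 2 - int i - int j)"
      using that by (simp add: e_int algebra_simps)
    also have "\<dots> \<ge> 0" using that by (intro mult_nonneg_nonneg) auto
    finally show ?thesis by simp
  qed
  have e_conc: "e i + e j + 2 \<le> 2 * e n" if "i < n" "j \<le> min N (n+1)" "n \<le> N" for i j n
  proof -
    have "e i \<le> e (n - 1)" "e j \<le> e (n + 1)" using that by (auto intro: e_mono)
    moreover have "int (e (n - 1)) + int (e (n + 1)) + 2 = 2 * int (e n)"
      using that by (simp add: e_int of_nat_diff algebra_simps)
    ultimately show ?thesis by linarith
  qed
  define \<epsilon> where "\<epsilon> n = \<eta> ^ (2 * e n)" for n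
  define c where "c = \<mu> / 2 * \<eta> ^ (2 * e N)"
  have "c > 0" using \<eta> \<mu> by (simp add: c_def)
  moreover have "0 < \<epsilon> n" for n using \<eta> by (simp add: \<epsilon>_def)
  moreover have "\<epsilon> n \<le> \<delta>" if "n \<in> {1..N}" for n
  proof -
    have "2 * e n \<ge> 1" using that by (auto simp: e_def)
    then have "\<epsilon> n \<le> \<eta> ^ 1" unfolding \<epsilon>_def using \<eta> by (intro power_decreasing) auto
    then show ?thesis using \<eta> by simp
  qed
  moreover have "- \<kappa> * (y 0)\<^sup>2 + (\<Sum>n=1..N. \<epsilon> n * (- \<alpha> * (y n)\<^sup>2 + M * ((\<Sum>i<n. y i) * (\<Sum>j\<le>min N (n+1). y j))))
       \<le> - c * (\<Sum>i\<le>N. (y i)\<^sup>2)" if y: "\<And>i. y i \<ge> 0" for y :: "nat \<Rightarrow> real"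
  proof -
    \<comment> \<open>In these variables all negative squares carry the same weight, and an error
      product is \<open>\<eta>^2\<close> times an unweighted one.\<close>
    define s where "s i = \<eta> ^ e i * y i" for i
    have s: "s i \<ge> 0" for i using y \<eta> by (simp add: s_def)
    define S where "S = (\<Sum>i\<le>N. (s i)\<^sup>2)"
    have sq: "\<epsilon> n * (y n)\<^sup>2 = (s n)\<^sup>2" for n
      by (simp add: \<epsilon>_def s_def power_mult_distrib power_mult mult.commute)
    have prod: "\<epsilon> n * ((\<Sum>i<n. y i) * (\<Sum>j\<le>min N (n+1). y j)) \<le> \<eta>\<^sup>2 * (real (N+1) * S)" if n: "n \<in> {1..N}" for n
    proof -
      have "\<epsilon> n * ((\<Sum>i<n. y i) * (\<Sum>j\<le>min N (n+1). y j)) = (\<Sum>i<n. \<Sum>j\<le>min N (n+1). \<epsilon> n * (y i * y j))"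
        by (subst sum_product) (simp only: sum_distrib_left)
      also have "\<dots> \<le> (\<Sum>i<n. \<Sum>j\<le>min N (n+1). \<eta>\<^sup>2 * (s i * s j))"
      proof (intro sum_mono)
        fix i j assume ij: "i \<in> {..<n}" "j \<in> {..min N (n+1)}"
        have "\<epsilon> n \<le> \<eta> ^ (e i + e j + 2)" unfolding \<epsilon>_def
          using \<eta> e_conc[of i n j] ij n by (intro power_decreasing) auto
        then have "\<epsilon> n * (y i * y j) \<le> \<eta> ^ (e i + e j + 2) * (y i * y j)"
          using y by (intro mult_right_mono) auto
        also have "\<dots> = \<eta>\<^sup>2 * (s i * s j)" by (simp add: s_def power_add power2_eq_square algebra_simps)
        finally show "\<epsilon> n * (y i * y j) \<le> \<eta>\<^sup>2 * (s i * s j)" .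
      qed
      also have "\<dots> = \<eta>\<^sup>2 * ((\<Sum>i<n. s i) * (\<Sum>j\<le>min N (n+1). s j))"
        by (subst sum_product) (simp only: sum_distrib_left)
      also have "\<dots> \<le> \<eta>\<^sup>2 * ((\<Sum>i\<le>N. s i) * (\<Sum>j\<le>N. s j))"
        using s n by (intro mult_left_mono mult_mono sum_mono2 sum_nonneg) auto
      also have "(\<Sum>i\<le>N. s i) * (\<Sum>j\<le>N. s j) \<le> real (N+1) * S"
        using sum_squared_le_sum_of_squares[of s "{..N}"] by (simp add: S_def power2_eq_square mult.commute)
      finally show ?thesis by (simp add: mult_left_mono)
    qed
    have "(\<Sum>n=1..N. \<epsilon> n * (- \<alpha> * (y n)\<^sup>2 + M * ((\<Sum>i<n. y i) * (\<Sum>j\<le>min N (n+1). y j))))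
        \<le> (\<Sum>n=1..N. - \<mu> * (s n)\<^sup>2 + M * (\<eta>\<^sup>2 * (real (N+1) * S)))"
    proof (intro sum_mono)
      fix n assume n: "n \<in> {1..N}"
      have "\<mu> * (s n)\<^sup>2 \<le> \<alpha> * (s n)\<^sup>2" using \<mu> by (intro mult_right_mono) auto
      moreover have "M * (\<epsilon> n * ((\<Sum>i<n. y i) * (\<Sum>j\<le>min N (n+1). y j))) \<le> M * (\<eta>\<^sup>2 * (real (N+1) * S))"
        using prod[OF n] assms by (intro mult_left_mono) auto
      ultimately show "\<epsilon> n * (- \<alpha> * (y n)\<^sup>2 + M * ((\<Sum>i<n. y i) * (\<Sum>j\<le>min N (n+1). y j))) \<le> - \<mu> * (s n)\<^sup>2 + M * (\<eta>\<^sup>2 * (real (N+1) * S))"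
        using sq[of n] by (simp add: algebra_simps)
    qed
    also have "\<dots> = - \<mu> * (\<Sum>n=1..N. (s n)\<^sup>2) + \<eta>\<^sup>2 * B * S"
      unfolding sum.distrib sum_distrib_left[symmetric] by (simp add: B_def)
    finally have 1: "(\<Sum>n=1..N. \<epsilon> n * (- \<alpha> * (y n)\<^sup>2 + M * ((\<Sum>i<n. y i) * (\<Sum>j\<le>min N (n+1). y j)))) \<le> \<dots>" .
    have S_split: "S = (y 0)\<^sup>2 + (\<Sum>n=1..N. (s n)\<^sup>2)"
    proof -
      have "{..N} = insert 0 {1..N}" by auto
      then show ?thesis by (simp add: S_def s_def e_def)
    qed
    have "\<mu> * (y 0)\<^sup>2 \<le> \<kappa> * (y 0)\<^sup>2" using \<mu> by (intro mult_right_mono) auto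
    moreover have S0: "S \<ge> 0" by (simp add: S_def sum_nonneg)
    moreover have "\<eta>\<^sup>2 * B * S \<le> \<mu> / 2 * S" using \<eta>B S0 by (intro mult_right_mono) auto
    ultimately have 2: "- \<kappa> * (y 0)\<^sup>2 + (\<Sum>n=1..N. \<epsilon> n * (- \<alpha> * (y n)\<^sup>2 + M * ((\<Sum>i<n. y i) * (\<Sum>j\<le>min N (n+1). y j))))
       \<le> - (\<mu> / 2) * S"
      using 1 S_split by (simp add: algebra_simps)
    have "\<eta> ^ (2 * e N) * (\<Sum>i\<le>N. (y i)\<^sup>2) \<le> S"
      unfolding S_def sum_distrib_left
    proof (intro sum_mono)
      fix i assume "i \<in> {..N}"
      then have "\<eta> ^ (2 * e N) \<le> \<eta> ^ (2 * e i)" using \<eta> e_mono[of i N] by (intro power_decreasing) auto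
      then show "\<eta> ^ (2 * e N) * (y i)\<^sup>2 \<le> (s i)\<^sup>2"
        using sq[of i] by (simp add: \<epsilon>_def mult_right_mono flip: sq)
    qed
    then have "\<mu> / 2 * (\<eta> ^ (2 * e N) * (\<Sum>i\<le>N. (y i)\<^sup>2)) \<le> \<mu> / 2 * S" using \<mu> by (intro mult_left_mono) auto
    then show ?thesis using 2 by (simp add: c_def mult.assoc)
  qed
  ultimately show ?thesis by (intro exI[of _ \<epsilon>] exI[of _ c] conjI allI ballI impI) auto
qed

text \<open>The common shape of all error terms below: chain coefficients, padded with 1 to four
  factors since the fifth correction produces four, times a bounded monomial in \<open>r\<close> and
  \<open>g\<close>, times two unknowns.\<close>

lemma monomial_bound:
  fixes m :: real
  assumes "\<bar>p1\<bar> \<le> m" "\<bar>p2\<bar> \<le> m" "\<bar>p3\<bar> \<le> m" "\<bar>p4\<bar> \<le> m" "\<bar>p\<bar> \<le> 1" "\<bar>u\<bar> \<le> S" "\<bar>v\<bar> \<le> T"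
  shows "\<bar>p1 * p2 * p3 * p4 * p * (u * v)\<bar> \<le> m ^ 4 * (S * T)"
proof -
  have m0: "0 \<le> m" "0 \<le> S" "0 \<le> T" using assms by linarith+
  have "\<bar>p1 * p2 * p3 * p4 * p\<bar> \<le> m * m * m * m * 1"
    unfolding abs_mult using assms m0 by (intro mult_mono) auto
  moreover have "\<bar>u * v\<bar> \<le> S * T" unfolding abs_mult using assms m0 by (intro mult_mono) auto
  ultimately have "\<bar>p1 * p2 * p3 * p4 * p\<bar> * \<bar>u * v\<bar> \<le> (m * m * m * m * 1) * (S * T)"
    using m0 by (intro mult_mono) auto
  then show ?thesis by (simp add: abs_mult eval_nat_numeral mult.assoc)
qed

text \<open>Gronwall's argument: the integrating factor \<open>exp (b * s)\<close> makes the product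
  nonincreasing. The derivative at 0 is one-sided, so monotonicity is derived from interior points
  and continuity.\<close>

lemma exponential_decay_of_dissipation:
  fixes L L' :: "real \<Rightarrow> real"
  assumes L: "\<And>t. t \<ge> 0 \<Longrightarrow> (L has_real_derivative L' t) (at t within {0..})"
    and le: "\<And>t. t \<ge> 0 \<Longrightarrow> L' t \<le> - b * L t" and t: "t \<ge> 0"
  shows "L t \<le> exp (- b * t) * L 0"
proof -
  define h where "h s = exp (b * s) * L s" for s
  have h: "(h has_real_derivative exp (b * s) * (b * L s + L' s)) (at s within {0..})" if "s \<ge> 0" for s
    unfolding h_def by (rule derivative_eq_intros L that refl | simp add: algebra_simps)+
  have "h t \<le> h 0"
  proof (cases "t = 0")
    case False
    show ?thesis
    proof (rule DERIV_nonpos_imp_decreasing_open[of 0 t h])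
      show "0 \<le> t" by fact
      show "\<exists>y. (h has_real_derivative y) (at x) \<and> y \<le> 0" if x: "0 < x" "x < t" for x
      proof (intro exI conjI)
        have "at x within {0..} = at x" using x by (intro at_within_interior) (auto simp: interior_real_atLeast)
        then show "(h has_real_derivative exp (b * x) * (b * L x + L' x)) (at x)" using h[of x] x by simp
        show "exp (b * x) * (b * L x + L' x) \<le> 0" using le[of x] x by (intro mult_nonneg_nonpos) auto
      qed
      show "continuous_on {0..t} h"
        by (rule DERIV_continuous_on[where D="\<lambda>s. exp (b * s) * (b * L s + L' s)"], rule DERIV_subset[OF h]) auto
    qed
  qed simp
  then show ?thesis by (simp add: h_def exp_minus field_simps)
qed

text \<open>The corrections of the energy, with \<open>r = \<xi> g\<close> and \<open>g = (1 + \<xi>\<^sup>2)^(-1/2)\<close>. The fifth one pairs \<open>x 5\<close> with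
  the combination \<open>a 3 * x 2 + a 2 * \<xi> * x 4\<close>, from whose derivative the rapidly oscillating \<open>x 3\<close> cancels;
  the plain product \<open>x 4 * x 5\<close> would only give the rate \<open>\<xi>^8\<close> at low frequencies.\<close>

definition interaction :: "(nat \<Rightarrow> real) \<Rightarrow> real \<Rightarrow> real \<Rightarrow> (nat \<Rightarrow> nat \<Rightarrow> real) \<Rightarrow> nat \<Rightarrow> real" where
  "interaction a r g p n =
    (if n = 1 then a 0 * (r * g) * p 0 1
    else if n = 2 then a 1 * (r^3 * g) * p 1 2
    else if n = 3 then a 2 * (r^5 * g) * p 2 3
    else if n = 4 then a 3 * (r^6 * g^2) * p 3 4
    else if n = 5 then a 2 * a 4 * (a 3 * (r^4 * g^4) * p 2 5 + a 2 * (r^5 * g^3) * p 4 5)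
    else if n = 6 then a 5 * (r^5 * g^3) * p 5 6
    else a 6 * (r^5 * g^3) * p 6 7)"

lemma interaction_simps:
  "interaction a r g p 1 = a 0 * (r * g) * p 0 1"
  "interaction a r g p 2 = a 1 * (r^3 * g) * p 1 2"
  "interaction a r g p 3 = a 2 * (r^5 * g) * p 2 3"
  "interaction a r g p 4 = a 3 * (r^6 * g^2) * p 3 4"
  "interaction a r g p 5 = a 2 * a 4 * (a 3 * (r^4 * g^4) * p 2 5 + a 2 * (r^5 * g^3) * p 4 5)"
  "interaction a r g p 6 = a 5 * (r^5 * g^3) * p 5 6"
  "interaction a r g p 7 = a 6 * (r^5 * g^3) * p 6 7"
  by (simp_all add: interaction_def)

lemma atLeastAtMost_1_7: "{1..7::nat} = {1,2,3,4,5,6,7}"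
  by auto

lemma atMost_7: "{..7::nat} = {0,1,2,3,4,5,6,7}"
  by auto

text \<open>The derivative of the n-th correction contains the square of \<open>b n * y n\<close>,
  where \<open>y\<close> are weighted unknowns; every other term is a product of some
  \<open>y i\<close> with \<open>i < n\<close> and some \<open>y j\<close> with
  \<open>j \<le> n + 1\<close>, with coefficients bounded uniformly in \<xi>. This is the structure
  that \<open>hierarchical_form_negative\<close> absorbs.\<close>

lemma damped_chain_dissipation:
  fixes a :: "nat \<Rightarrow> real" and \<kappa> \<delta> :: real
  assumes \<kappa>: "\<kappa> > 0" and a: "\<And>i. i < 7 \<Longrightarrow> a i \<noteq> 0" and \<delta>: "\<delta> > 0"
  obtains \<epsilon> :: "nat \<Rightarrow> real" and c :: real where "c > 0" "\<And>n. \<epsilon> n > 0" "\<And>n. n \<in> {1..7} \<Longrightarrow> \<epsilon> n \<le> \<delta>"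
    "\<And>\<xi> r g x d. g \<ge> 0 \<Longrightarrow> g \<le> 1 \<Longrightarrow> \<bar>r\<bar> \<le> 1 \<Longrightarrow> r = \<xi> * g \<Longrightarrow>
       d 0 = - \<kappa> * x 0 + a 0 * \<xi> * x 1 \<Longrightarrow>
       d 1 = a 1 * \<xi> * x 2 - a 0 * \<xi> * x 0 \<Longrightarrow>
       d 2 = a 2 * \<xi> * x 3 - a 1 * \<xi> * x 1 \<Longrightarrow>
       d 3 = a 3 * x 4 - a 2 * \<xi> * x 2 \<Longrightarrow>
       d 4 = a 4 * \<xi> * x 5 - a 3 * x 3 \<Longrightarrow>
       d 5 = a 5 * \<xi> * x 6 - a 4 * \<xi> * x 4 \<Longrightarrow>
       d 6 = a 6 * \<xi> * x 7 - a 5 * \<xi> * x 5 \<Longrightarrow>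
       d 7 = - a 6 * \<xi> * x 6 \<Longrightarrow>
       2 * (\<Sum>i\<le>7. x i * d i) - (\<Sum>n=1..7. \<epsilon> n * interaction a r g (\<lambda>i j. d i * x j + x i * d j) n)
       \<le> - c * (r^6 * g^2) * (\<Sum>i\<le>7. (x i)\<^sup>2)"
proof -
  \<comment> \<open>The coefficients of the good squares. The fifth is \<open>a 2 * a 4\<close>
    because the combination paired with \<open>x 5\<close> contains \<open>x 4\<close> with the
    factor \<open>a 2\<close>.\<close>
  define b where "b n = (if n = 1 then a 0 else if n = 2 then a 1 else if n = 3 then a 2 else if n = 4 then a 3
    else if n = 5 then a 2 * a 4 else if n = 6 then a 5 else a 6)" for n :: nat
  have b_simps: "b 1 = a 0" "b 2 = a 1" "b 3 = a 2" "b 4 = a 3" "b 5 = a 2 * a 4" "b 6 = a 5" "b 7 = a 6"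
    by (simp_all add: b_def)
  have b: "b n \<noteq> 0" for n using a by (auto simp: b_def)
  define \<alpha> where "\<alpha> = Min ((\<lambda>n. (b n)\<^sup>2) ` {1..7})"
  have \<alpha>: "\<alpha> > 0" unfolding \<alpha>_def using b by (subst Min_gr_iff) auto
  have \<alpha>_le: "\<alpha> \<le> (b n)\<^sup>2" if "n \<in> {1..7}" for n unfolding \<alpha>_def using that by (intro Min_le) auto
  define m where "m = 1 + \<kappa> + (\<Sum>i\<le>6. \<bar>a i\<bar>)"
  have am: "\<bar>a i\<bar> \<le> m" if "i \<le> 6" for i
  proof -
    have "\<bar>a i\<bar> \<le> (\<Sum>i\<le>6. \<bar>a i\<bar>)" using that by (intro member_le_sum) auto
    then show ?thesis using \<kappa> by (simp add: m_def)
  qed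
  have "(\<Sum>i\<le>6. \<bar>a i\<bar>) \<ge> 0" by (intro sum_nonneg) auto
  then have m: "\<bar>\<kappa>\<bar> \<le> m" "\<bar>1\<bar> \<le> m" "m \<ge> 0" using \<kappa> by (auto simp: m_def)
  \<comment> \<open>The fifth correction has the most error products, namely five, each with four
    coefficient factors bounded by \<open>m\<close>.\<close>
  define M where "M = 5 * m ^ 4"
  have M: "M \<ge> 0" using m by (simp add: M_def)
  have \<kappa>2: "0 < 2 * \<kappa>" using \<kappa> by simp
  define P where "P \<epsilon> c \<longleftrightarrow> c > 0 \<and> (\<forall>n. 0 < \<epsilon> n) \<and> (\<forall>n\<in>{1..7}. \<epsilon> n \<le> \<delta>) \<and>
    (\<forall>y :: nat \<Rightarrow> real. (\<forall>i. y i \<ge> 0) \<longrightarrow>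
       - (2 * \<kappa>) * (y 0)\<^sup>2 + (\<Sum>n=1..7. \<epsilon> n * (- \<alpha> * (y n)\<^sup>2 + M * ((\<Sum>i<n. y i) * (\<Sum>j\<le>min 7 (n+1). y j))))
       \<le> - c * (\<Sum>i\<le>7. (y i)\<^sup>2))" for \<epsilon> :: "nat \<Rightarrow> real" and c
  have "\<exists>\<epsilon> c. P \<epsilon> c"
    unfolding P_def by (rule hierarchical_form_negative[OF \<kappa>2 \<alpha> M \<delta>])
  then obtain \<epsilon> c where P: "P \<epsilon> c" by blast
  have c: "c > 0" and \<epsilon>: "\<And>n. 0 < \<epsilon> n" "\<And>n. n \<in> {1..7} \<Longrightarrow> \<epsilon> n \<le> \<delta>"
    using P by (auto simp: P_def)
  have form: "- (2 * \<kappa>) * (y 0)\<^sup>2 + (\<Sum>n=1..7. \<epsilon> n * (- \<alpha> * (y n)\<^sup>2 + M * ((\<Sum>i<n. y i) * (\<Sum>j\<le>min 7 (n+1). y j))))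
       \<le> - c * (\<Sum>i\<le>7. (y i)\<^sup>2)" if "\<And>i. y i \<ge> 0" for y :: "nat \<Rightarrow> real"
    using P that unfolding P_def by (elim conjE allE[of _ y] impE) simp_all
  show ?thesis
  proof (rule that[OF c \<epsilon>])
    fix \<xi> r g :: real and x d :: "nat \<Rightarrow> real"
    assume g: "g \<ge> 0" "g \<le> 1" and r1: "\<bar>r\<bar> \<le> 1" and r: "r = \<xi> * g"
      and d: "d 0 = - \<kappa> * x 0 + a 0 * \<xi> * x 1"
       "d 1 = a 1 * \<xi> * x 2 - a 0 * \<xi> * x 0"
       "d 2 = a 2 * \<xi> * x 3 - a 1 * \<xi> * x 1"
       "d 3 = a 3 * x 4 - a 2 * \<xi> * x 2"
       "d 4 = a 4 * \<xi> * x 5 - a 3 * x 3"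
       "d 5 = a 5 * \<xi> * x 6 - a 4 * \<xi> * x 4"
       "d 6 = a 6 * \<xi> * x 7 - a 5 * \<xi> * x 5"
       "d 7 = - a 6 * \<xi> * x 6"
    \<comment> \<open>Each of the first three couplings costs a factor \<open>r\<close>. The
      coupling of \<open>x 3\<close> and \<open>x 4\<close> carries no \<xi>, and keeping the errors
      bounded at high frequencies costs a factor \<open>g\<close> there; the later couplings are
      free. The smallest weight \<open>r^3 * g\<close> squares to the rate.\<close>
    define w where "w i = (if i = 0 then 1 else if i = 1 then r else if i = 2 then r^2 else if i = 3 then r^3 else r^3 * g)" for i :: nat
    define y where "y i = w i * x i" for i
    have y_simps: "y 0 = x 0" "y 1 = r * x 1" "y 2 = r^2 * x 2" "y 3 = r^3 * x 3"
      "y 4 = r^3 * g * x 4" "y 5 = r^3 * g * x 5" "y 6 = r^3 * g * x 6" "y 7 = r^3 * g * x 7"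
      by (simp_all add: y_def w_def)
    define Y where "Y i = \<bar>y i\<bar>" for i
    define p where "p i j = d i * x j + x i * d j" for i j
    have p_eq: "p = (\<lambda>i j. d i * x j + x i * d j)" by (simp add: p_def fun_eq_iff)
    define S where "S n = (\<Sum>i<n. Y i)" for n
    define T where "T n = (\<Sum>i\<le>min 7 (n+1). Y i)" for n
    have S: "\<bar>y i\<bar> \<le> S n" if "i < n" for i n
      unfolding S_def Y_def[symmetric] using that by (intro member_le_sum) (auto simp: Y_def)
    have T: "\<bar>y i\<bar> \<le> T n" if "i \<le> min 7 (n+1)" for i n
      unfolding T_def Y_def[symmetric] using that by (intro member_le_sum) (auto simp: Y_def)
    have bd: "p1 * p2 * p3 * p4 * q * (y i * y j) \<le> m ^ 4 * (S n * T n)"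
      if "\<bar>p1\<bar> \<le> m" "\<bar>p2\<bar> \<le> m" "\<bar>p3\<bar> \<le> m" "\<bar>p4\<bar> \<le> m" "\<bar>q\<bar> \<le> 1" "i < n" "j \<le> min 7 (n+1)" for p1 p2 p3 p4 q i j n
      using monomial_bound[of p1 m p2 p3 p4 q "y i" "S n" "y j" "T n"] that S[of i n] T[of j n] by linarith
    have g': "\<bar>g\<bar> \<le> 1" "\<bar>- 1\<bar> \<le> (1::real)" "\<bar>1\<bar> \<le> (1::real)" using g by auto
    have q: "\<bar>r\<^sup>2\<bar> \<le> 1" "\<bar>g\<^sup>2\<bar> \<le> 1" "\<bar>- r\<bar> \<le> 1" "\<bar>- g\<^sup>2\<bar> \<le> 1" "\<bar>r * g\<^sup>2\<bar> \<le> 1"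
      using g r1 by (auto simp: abs_square_le_1 abs_mult intro!: power_le_one mult_le_one)
    have p0: "0 \<le> m ^ 4 * (S n * T n)" for n
      unfolding S_def T_def Y_def using m by (intro mult_nonneg_nonneg sum_nonneg) auto
    note am' = am[of 0] am[of 1] am[of 2] am[of 3] am[of 4] am[of 5] am[of 6]
    \<comment> \<open>In each of the seven identities \<open>r = \<xi> * g\<close> absorbs the \<xi>
      of a coupling; the factors 1 only bring the errors into the shape that \<open>bd\<close>
      expects.\<close>
    have "- interaction a r g p 1 = - (b 1 * y 1)\<^sup>2 + a 0 * \<kappa> * 1 * 1 * g * (y 0 * y 1)
        + a 0 * a 1 * 1 * 1 * (- 1) * (y 0 * y 2) + a 0 * a 0 * 1 * 1 * r\<^sup>2 * (y 0 * y 0)"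
      unfolding interaction_simps b_simps y_simps p_def d r by algebra
    also have "\<dots> \<le> - (b 1 * y 1)\<^sup>2 + M * (S 1 * T 1)"
      using bd[OF am'(1) m(1) m(2) m(2) g'(1), of 0 1 1] bd[OF am'(1) am'(2) m(2) m(2) g'(2), of 0 1 2]
        bd[OF am'(1) am'(1) m(2) m(2) q(1), of 0 1 0] p0[of 1] by (simp add: M_def)
    finally have 1: "- interaction a r g p 1 \<le> - (b 1 * y 1)\<^sup>2 + M * (S 1 * T 1)" .
    have "- interaction a r g p 2 = - (b 2 * y 2)\<^sup>2 + a 1 * a 0 * 1 * 1 * r\<^sup>2 * (y 0 * y 2)
        + a 1 * a 2 * 1 * 1 * (- 1) * (y 1 * y 3) + a 1 * a 1 * 1 * 1 * r\<^sup>2 * (y 1 * y 1)"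
      unfolding interaction_simps b_simps y_simps p_def d r by algebra
    also have "\<dots> \<le> - (b 2 * y 2)\<^sup>2 + M * (S 2 * T 2)"
      using bd[OF am'(2) am'(1) m(2) m(2) q(1), of 0 2 2] bd[OF am'(2) am'(3) m(2) m(2) g'(2), of 1 2 3]
        bd[OF am'(2) am'(2) m(2) m(2) q(1), of 1 2 1] p0[of 2] by (simp add: M_def)
    finally have 2: "- interaction a r g p 2 \<le> - (b 2 * y 2)\<^sup>2 + M * (S 2 * T 2)" .
    have "- interaction a r g p 3 = - (b 3 * y 3)\<^sup>2 + a 2 * a 1 * 1 * 1 * r\<^sup>2 * (y 1 * y 3)
        + a 2 * a 3 * 1 * 1 * (- 1) * (y 2 * y 4) + a 2 * a 2 * 1 * 1 * r\<^sup>2 * (y 2 * y 2)"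
      unfolding interaction_simps b_simps y_simps p_def d r by algebra
    also have "\<dots> \<le> - (b 3 * y 3)\<^sup>2 + M * (S 3 * T 3)"
      using bd[OF am'(3) am'(2) m(2) m(2) q(1), of 1 3 3] bd[OF am'(3) am'(4) m(2) m(2) g'(2), of 2 3 4]
        bd[OF am'(3) am'(3) m(2) m(2) q(1), of 2 3 2] p0[of 3] by (simp add: M_def)
    finally have 3: "- interaction a r g p 3 \<le> - (b 3 * y 3)\<^sup>2 + M * (S 3 * T 3)" .
    have "- interaction a r g p 4 = - (b 4 * y 4)\<^sup>2 + a 3 * a 2 * 1 * 1 * r\<^sup>2 * (y 2 * y 4)
        + a 3 * a 4 * 1 * 1 * (- r) * (y 3 * y 5) + a 3 * a 3 * 1 * 1 * g\<^sup>2 * (y 3 * y 3)"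
      unfolding interaction_simps b_simps y_simps p_def d r by algebra
    also have "\<dots> \<le> - (b 4 * y 4)\<^sup>2 + M * (S 4 * T 4)"
      using bd[OF am'(4) am'(3) m(2) m(2) q(1), of 2 4 4] bd[OF am'(4) am'(5) m(2) m(2) q(3), of 3 4 5]
        bd[OF am'(4) am'(4) m(2) m(2) q(2), of 3 4 3] p0[of 4] by (simp add: M_def)
    finally have 4: "- interaction a r g p 4 \<le> - (b 4 * y 4)\<^sup>2 + M * (S 4 * T 4)" .
    have "- interaction a r g p 5 = - (b 5 * y 5)\<^sup>2 + a 2 * a 4 * a 1 * a 3 * (r * g\<^sup>2) * (y 1 * y 5)
        + a 2 * a 4 * a 5 * a 3 * (- g\<^sup>2) * (y 2 * y 6) + a 2 * a 4 * a 5 * a 2 * (- 1) * (y 4 * y 6)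
        + a 2 * a 4 * a 4 * a 3 * g\<^sup>2 * (y 2 * y 4) + a 2 * a 4 * a 4 * a 2 * 1 * (y 4 * y 4)"
      unfolding interaction_simps b_simps y_simps p_def d r by algebra
    also have "\<dots> \<le> - (b 5 * y 5)\<^sup>2 + M * (S 5 * T 5)"
      using bd[OF am'(3) am'(5) am'(2) am'(4) q(5), of 1 5 5] bd[OF am'(3) am'(5) am'(6) am'(4) q(4), of 2 5 6]
        bd[OF am'(3) am'(5) am'(6) am'(3) g'(2), of 4 5 6] bd[OF am'(3) am'(5) am'(5) am'(4) q(2), of 2 5 4]
        bd[OF am'(3) am'(5) am'(5) am'(3) g'(3), of 4 5 4] p0[of 5] by (simp add: M_def)
    finally have 5: "- interaction a r g p 5 \<le> - (b 5 * y 5)\<^sup>2 + M * (S 5 * T 5)" .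
    have "- interaction a r g p 6 = - (b 6 * y 6)\<^sup>2 + a 5 * a 4 * 1 * 1 * 1 * (y 4 * y 6)
        + a 5 * a 6 * 1 * 1 * (- 1) * (y 5 * y 7) + a 5 * a 5 * 1 * 1 * 1 * (y 5 * y 5)"
      unfolding interaction_simps b_simps y_simps p_def d r by algebra
    also have "\<dots> \<le> - (b 6 * y 6)\<^sup>2 + M * (S 6 * T 6)"
      using bd[OF am'(6) am'(5) m(2) m(2) g'(3), of 4 6 6] bd[OF am'(6) am'(7) m(2) m(2) g'(2), of 5 6 7]
        bd[OF am'(6) am'(6) m(2) m(2) g'(3), of 5 6 5] p0[of 6] by (simp add: M_def)
    finally have 6: "- interaction a r g p 6 \<le> - (b 6 * y 6)\<^sup>2 + M * (S 6 * T 6)" .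
    have "- interaction a r g p 7 = - (b 7 * y 7)\<^sup>2 + a 6 * a 5 * 1 * 1 * 1 * (y 5 * y 7)
        + a 6 * a 6 * 1 * 1 * 1 * (y 6 * y 6)"
      unfolding interaction_simps b_simps y_simps p_def d r by algebra
    also have "\<dots> \<le> - (b 7 * y 7)\<^sup>2 + M * (S 7 * T 7)"
      using bd[OF am'(7) am'(6) m(2) m(2) g'(3), of 5 7 7]
        bd[OF am'(7) am'(7) m(2) m(2) g'(3), of 6 7 6] p0[of 7] by (simp add: M_def)
    finally have 7: "- interaction a r g p 7 \<le> - (b 7 * y 7)\<^sup>2 + M * (S 7 * T 7)" .
    have "- interaction a r g p n \<le> - \<alpha> * (Y n)\<^sup>2 + M * (S n * T n)" if n: "n \<in> {1..7}" for n
    proof -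
      have "- interaction a r g p n \<le> - (b n * y n)\<^sup>2 + M * (S n * T n)"
        using n 1 2 3 4 5 6 7 by (simp only: atLeastAtMost_1_7 insert_iff empty_iff) (elim disjE; simp only:)
      moreover have "\<alpha> * (Y n)\<^sup>2 \<le> (b n)\<^sup>2 * (Y n)\<^sup>2" using \<alpha>_le[OF n] by (intro mult_right_mono) auto
      ultimately show ?thesis by (simp add: Y_def power_mult_distrib)
    qed
    then have "(\<Sum>n=1..7. \<epsilon> n * (- interaction a r g p n)) \<le> (\<Sum>n=1..7. \<epsilon> n * (- \<alpha> * (Y n)\<^sup>2 + M * (S n * T n)))"
      using \<epsilon> by (intro sum_mono mult_left_mono) (auto intro: less_imp_le)
    \<comment> \<open>The couplings are skew-symmetric and cancel in the energy balance, so only the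
      damping of \<open>x 0\<close> survives.\<close>
    moreover have "2 * (\<Sum>i\<le>7. x i * d i) = - (2 * \<kappa>) * (Y 0)\<^sup>2"
      by (simp add: atMost_7 Y_def y_def w_def d[unfolded One_nat_def] d power2_eq_square) (simp add: algebra_simps)
    moreover have "- (2 * \<kappa>) * (Y 0)\<^sup>2 + (\<Sum>n=1..7. \<epsilon> n * (- \<alpha> * (Y n)\<^sup>2 + M * (S n * T n))) \<le> - c * (\<Sum>i\<le>7. (Y i)\<^sup>2)"
      unfolding S_def T_def by (rule form) (simp add: Y_def)
    moreover have "c * ((r^6 * g^2) * (\<Sum>i\<le>7. (x i)\<^sup>2)) \<le> c * (\<Sum>i\<le>7. (Y i)\<^sup>2)"
    proof (intro mult_left_mono)
      have r2: "r\<^sup>2 \<le> 1" "g\<^sup>2 \<le> 1" using q by auto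
      have "r^6 * g^2 \<le> (w i)\<^sup>2" for i
      proof -
        have A: "r\<^sup>2 ^ 3 * g\<^sup>2 \<le> r\<^sup>2 ^ k" if "k \<le> 3" for k
        proof -
          have "r\<^sup>2 ^ 3 * g\<^sup>2 \<le> r\<^sup>2 ^ 3" using r2 by (intro mult_left_le) auto
          also have "\<dots> \<le> r\<^sup>2 ^ k" using r2 that by (intro power_decreasing) auto
          finally show ?thesis .
        qed
        have "w i \<in> {1, r, r^2, r^3, r^3 * g}" by (simp add: w_def)
        moreover have "r^6 * g^2 \<le> 1\<^sup>2" "r^6 * g^2 \<le> r\<^sup>2" "r^6 * g^2 \<le> (r^2)\<^sup>2" "r^6 * g^2 \<le> (r^3)\<^sup>2"
          using A[of 0] A[of 1] A[of 2] A[of 3] by (simp_all flip: power_mult)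
        moreover have "r^6 * g^2 = (r^3 * g)\<^sup>2" by (simp add: power_mult_distrib flip: power_mult)
        ultimately show ?thesis by auto
      qed
      then show "(r^6 * g^2) * (\<Sum>i\<le>7. (x i)\<^sup>2) \<le> (\<Sum>i\<le>7. (Y i)\<^sup>2)"
        unfolding sum_distrib_left by (intro sum_mono) (simp add: Y_def y_def power_mult_distrib mult_right_mono)
    qed (use c in auto)
    ultimately show "2 * (\<Sum>i\<le>7. x i * d i) - (\<Sum>n=1..7. \<epsilon> n * interaction a r g (\<lambda>i j. d i * x j + x i * d j) n)
       \<le> - c * (r^6 * g^2) * (\<Sum>i\<le>7. (x i)\<^sup>2)"
      unfolding p_eq[symmetric] mult_minus_right sum_negf mult_minus_left mult.assoc by linarith
  qed
qed

text \<open>Since \<open>interaction\<close> is linear in its array \<open>p\<close>,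
  differentiating it means replacing the products by their derivatives; this is why the array is a
  parameter.\<close>

lemma interaction_has_real_derivative:
  assumes "\<And>i. i \<le> 7 \<Longrightarrow> (x i has_real_derivative d i) (at t within S)"
  shows "((\<lambda>s. interaction a r g (\<lambda>i j. x i s * x j s) n) has_real_derivative
    interaction a r g (\<lambda>i j. d i * x j t + x i t * d j) n) (at t within S)"
proof -
  have p: "((\<lambda>s. x i s * x j s) has_real_derivative d i * x j t + x i t * d j) (at t within S)" if "i \<le> 7" "j \<le> 7" for i j
    using DERIV_mult[OF assms[OF that(1)] assms[OF that(2)]] by (simp add: mult.commute add.commute)
  show ?thesis
    unfolding interaction_def by (cases "n \<in> {1,2,3,4,5,6}") (auto intro!: DERIV_cmult DERIV_add p)
qed

text \<open>Each unknown is at most the square root of the energy, and \<open>r\<close>,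
  \<open>g\<close> are at most 1. The constant does not depend on \<xi>, so small multiples of the
  corrections leave the energy equivalent to the corrected one.\<close>

lemma interaction_bound:
  fixes a :: "nat \<Rightarrow> real"
  obtains K :: real where "K > 0"
    "\<And>r g x n. \<bar>r\<bar> \<le> 1 \<Longrightarrow> \<bar>g\<bar> \<le> 1 \<Longrightarrow> n \<in> {1..7} \<Longrightarrow> \<bar>interaction a r g (\<lambda>i j. x i * x j) n\<bar> \<le> K * (\<Sum>i\<le>7. (x i)\<^sup>2)"
proof -
  define m where "m = 1 + (\<Sum>i\<le>6. \<bar>a i\<bar>)"
  have m1: "m \<ge> 1" by (simp add: m_def sum_nonneg)
  have am: "\<bar>a i\<bar> \<le> m" if "i \<le> 6" for i
  proof -
    have "\<bar>a i\<bar> \<le> (\<Sum>i\<le>6. \<bar>a i\<bar>)" using that by (intro member_le_sum) auto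
    then show ?thesis by (simp add: m_def)
  qed
  have m': "\<bar>1\<bar> \<le> m" using m1 by simp
  show thesis
  proof (rule that)
    \<comment> \<open>The factor 2 accounts for the two products of the fifth correction; all others
      consist of one.\<close>
    show "2 * m ^ 4 > 0" using m1 by simp
    fix r g :: real and x :: "nat \<Rightarrow> real" and n :: nat
    assume rg: "\<bar>r\<bar> \<le> 1" "\<bar>g\<bar> \<le> 1" and n: "n \<in> {1..7}"
    define E where "E = (\<Sum>i\<le>7. (x i)\<^sup>2)"
    have E0: "E \<ge> 0" by (simp add: E_def sum_nonneg)
    have x: "\<bar>x i\<bar> \<le> sqrt E" if "i \<le> 7" for i
    proof (rule real_le_rsqrt)
      have "(x i)\<^sup>2 \<le> E" unfolding E_def using that by (intro member_le_sum) auto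
      then show "\<bar>x i\<bar>\<^sup>2 \<le> E" by simp
    qed
    have b: "\<bar>p1 * p2 * p3 * 1 * (r ^ k * g ^ l) * (x i * x j)\<bar> \<le> m ^ 4 * E"
      if "\<bar>p1\<bar> \<le> m" "\<bar>p2\<bar> \<le> m" "\<bar>p3\<bar> \<le> m" "i \<le> 7" "j \<le> 7" for p1 p2 p3 k l i j
    proof -
      have "\<bar>r ^ k * g ^ l\<bar> \<le> 1" using rg by (simp add: abs_mult power_abs mult_le_one power_le_one)
      from monomial_bound[OF that(1-3) m' this x[OF that(4)] x[OF that(5)]] show ?thesis
        using E0 by simp
    qed
    note am' = am[of 0] am[of 1] am[of 2] am[of 3] am[of 4] am[of 5] am[of 6]
    have p: "0 \<le> m ^ 4 * E" using E0 m1 by simp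
    have "\<bar>interaction a r g (\<lambda>i j. x i * x j) n\<bar> \<le> m ^ 4 * E + m ^ 4 * E"
      using n unfolding atLeastAtMost_1_7 insert_iff empty_iff
    proof (elim disjE)
      assume n: "n = 1"
      show ?thesis using b[OF am'(1) m' m', of 0 1 1 1] p unfolding n interaction_simps by (simp add: mult_ac)
    next
      assume n: "n = 2"
      show ?thesis using b[OF am'(2) m' m', of 1 2 3 1] p unfolding n interaction_simps by (simp add: mult_ac)
    next
      assume n: "n = 3"
      show ?thesis using b[OF am'(3) m' m', of 2 3 5 1] p unfolding n interaction_simps by (simp add: mult_ac)
    next
      assume n: "n = 4"
      show ?thesis using b[OF am'(4) m' m', of 3 4 6 2] p unfolding n interaction_simps by (simp add: mult_ac)
    next
      assume n: "n = 5"
      have "interaction a r g (\<lambda>i j. x i * x j) n = a 2 * a 4 * a 3 * 1 * (r ^ 4 * g ^ 4) * (x 2 * x 5)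
          + a 2 * a 4 * a 2 * 1 * (r ^ 5 * g ^ 3) * (x 4 * x 5)"
        unfolding n interaction_simps by algebra
      then show ?thesis
        using b[OF am'(3) am'(5) am'(4), of 2 5 4 4] b[OF am'(3) am'(5) am'(3), of 4 5 5 3]
        by (simp only:) (intro order.trans[OF abs_triangle_ineq] add_mono; simp)
    next
      assume n: "n = 6"
      show ?thesis using b[OF am'(6) m' m', of 5 6 5 3] p unfolding n interaction_simps by (simp add: mult_ac)
    next
      assume n: "n = 7"
      show ?thesis using b[OF am'(7) m' m', of 6 7 5 3] p unfolding n interaction_simps by (simp add: mult_ac)
    qed simp
    then show "\<bar>interaction a r g (\<lambda>i j. x i * x j) n\<bar> \<le> 2 * m ^ 4 * (\<Sum>i\<le>7. (x i)\<^sup>2)"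
      unfolding E_def[symmetric] by (simp add: mult_ac)
  qed
qed

section \<open>Exponential decay of the damped chain\<close>

definition decay_rate :: "real \<Rightarrow> real" where
  "decay_rate \<xi> = \<xi> ^ 6 / (1 + \<xi>\<^sup>2) ^ 4"

definition damped_chain :: "real \<Rightarrow> (nat \<Rightarrow> real) \<Rightarrow> real \<Rightarrow> (nat \<Rightarrow> real \<Rightarrow> real) \<Rightarrow> bool" where
  "damped_chain \<kappa> a \<xi> x \<longleftrightarrow> (\<forall>t\<ge>0. let D = (\<lambda>i d. (x i has_real_derivative d) (at t within {0..})) in
     D 0 (- \<kappa> * x 0 t + a 0 * \<xi> * x 1 t) \<and>
     D 1 (a 1 * \<xi> * x 2 t - a 0 * \<xi> * x 0 t) \<and>
     D 2 (a 2 * \<xi> * x 3 t - a 1 * \<xi> * x 1 t) \<and>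
     D 3 (a 3 * x 4 t - a 2 * \<xi> * x 2 t) \<and>
     D 4 (a 4 * \<xi> * x 5 t - a 3 * x 3 t) \<and>
     D 5 (a 5 * \<xi> * x 6 t - a 4 * \<xi> * x 4 t) \<and>
     D 6 (a 6 * \<xi> * x 7 t - a 5 * \<xi> * x 5 t) \<and>
     D 7 (- a 6 * \<xi> * x 6 t))"

lemma damped_chain_decay:
  fixes a :: "nat \<Rightarrow> real" and \<kappa> :: real
  assumes \<kappa>: "\<kappa> > 0" and a: "\<And>i. i < 7 \<Longrightarrow> a i \<noteq> 0"
  shows "\<exists>C>0. \<exists>c>0. \<forall>\<xi> x t. damped_chain \<kappa> a \<xi> x \<longrightarrow> t \<ge> 0 \<longrightarrow>
    (\<Sum>i\<le>7. (x i t)\<^sup>2) \<le> C * exp (- c * decay_rate \<xi> * t) * (\<Sum>i\<le>7. (x i 0)\<^sup>2)"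
proof -
  obtain K where K: "K > 0"
    "\<And>r g x n. \<bar>r\<bar> \<le> 1 \<Longrightarrow> \<bar>g\<bar> \<le> 1 \<Longrightarrow> n \<in> {1..7} \<Longrightarrow> \<bar>interaction a r g (\<lambda>i j. x i * x j) n\<bar> \<le> K * (\<Sum>i\<le>7. (x i)\<^sup>2)"
    by (rule interaction_bound[of a]) blast
  \<comment> \<open>Seven corrections, each at most \<open>\<delta> * K\<close> times the energy,
    add up to half of it, whence \<open>E / 2 \<le> L \<le> 3 * E / 2\<close>.\<close>
  define \<delta> where "\<delta> = 1 / (14 * K)"
  have \<delta>: "\<delta> > 0" using K by (simp add: \<delta>_def)
  show ?thesis
  proof (rule damped_chain_dissipation[OF \<kappa> a \<delta>], assumption)
    fix \<epsilon> :: "nat \<Rightarrow> real" and c :: real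
    assume c: "c > 0" and \<epsilon>: "\<And>n. 0 < \<epsilon> n" "\<And>n. n \<in> {1..7} \<Longrightarrow> \<epsilon> n \<le> \<delta>" and
     diss: "\<And>\<xi> r g x d. g \<ge> 0 \<Longrightarrow> g \<le> 1 \<Longrightarrow> \<bar>r\<bar> \<le> 1 \<Longrightarrow> r = \<xi> * g \<Longrightarrow>
       d 0 = - \<kappa> * x 0 + a 0 * \<xi> * x 1 \<Longrightarrow>
       d 1 = a 1 * \<xi> * x 2 - a 0 * \<xi> * x 0 \<Longrightarrow>
       d 2 = a 2 * \<xi> * x 3 - a 1 * \<xi> * x 1 \<Longrightarrow>
       d 3 = a 3 * x 4 - a 2 * \<xi> * x 2 \<Longrightarrow>
       d 4 = a 4 * \<xi> * x 5 - a 3 * x 3 \<Longrightarrow>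
       d 5 = a 5 * \<xi> * x 6 - a 4 * \<xi> * x 4 \<Longrightarrow>
       d 6 = a 6 * \<xi> * x 7 - a 5 * \<xi> * x 5 \<Longrightarrow>
       d 7 = - a 6 * \<xi> * x 6 \<Longrightarrow>
       2 * (\<Sum>i\<le>7. x i * d i) - (\<Sum>n=1..7. \<epsilon> n * interaction a r g (\<lambda>i j. d i * x j + x i * d j) n)
       \<le> - c * (r^6 * g^2) * (\<Sum>i\<le>7. (x i)\<^sup>2)"
    show ?thesis
    proof (intro exI conjI allI impI)
      \<comment> \<open>The upper comparison \<open>L \<le> 3 * E / 2\<close> turns the dissipation
        rate \<open>c\<close> into \<open>2 * c / 3\<close>, and 3 is the product of the two
        comparison constants 2 and 3/2.\<close>
      show "(3::real) > 0" "2 * c / 3 > 0" using c by auto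
      fix \<xi> :: real and x :: "nat \<Rightarrow> real \<Rightarrow> real" and t :: real
      assume x: "damped_chain \<kappa> a \<xi> x" and t: "t \<ge> 0"
      define g where "g = 1 / sqrt (1 + \<xi>\<^sup>2)"
      define r where "r = \<xi> * g"
      have pos: "1 + \<xi>\<^sup>2 > 0" by (simp add: add_pos_nonneg)
      have s: "sqrt (1 + \<xi>\<^sup>2) \<ge> 1" by simp
      have g: "g \<ge> 0" "g \<le> 1" using s pos unfolding g_def by (simp_all add: divide_le_eq)
      have g2: "g\<^sup>2 = 1 / (1 + \<xi>\<^sup>2)" by (simp add: g_def power_divide)
      have "r\<^sup>2 \<le> 1" using pos by (simp add: r_def power_mult_distrib g2 divide_le_eq)
      then have r: "\<bar>r\<bar> \<le> 1" by (simp add: abs_square_le_1)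
      have "r^6 * g^2 = \<xi>^6 * (g\<^sup>2)^4" by (simp add: r_def power_mult_distrib flip: power_mult power_add)
      then have rate: "r^6 * g^2 = decay_rate \<xi>" by (simp add: g2 decay_rate_def power_divide)
      define d where "d i t = (if i = 0 then - \<kappa> * x 0 t + a 0 * \<xi> * x 1 t
        else if i = 1 then a 1 * \<xi> * x 2 t - a 0 * \<xi> * x 0 t
        else if i = 2 then a 2 * \<xi> * x 3 t - a 1 * \<xi> * x 1 t
        else if i = 3 then a 3 * x 4 t - a 2 * \<xi> * x 2 t
        else if i = 4 then a 4 * \<xi> * x 5 t - a 3 * x 3 t
        else if i = 5 then a 5 * \<xi> * x 6 t - a 4 * \<xi> * x 4 t
        else if i = 6 then a 6 * \<xi> * x 7 t - a 5 * \<xi> * x 5 t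
        else - a 6 * \<xi> * x 6 t)" for i :: nat and t
      have d: "(x i has_real_derivative d i s) (at s within {0..})" if "s \<ge> 0" "i \<le> 7" for i s
      proof -
        have "i \<in> {..7}" using that by simp
        then show ?thesis unfolding atMost_7
          using x[unfolded damped_chain_def Let_def, rule_format, OF that(1)] by (auto simp: d_def)
      qed
      define E where "E s = (\<Sum>i\<le>7. (x i s)\<^sup>2)" for s
      define I where "I s = (\<Sum>n=1..7. \<epsilon> n * interaction a r g (\<lambda>i j. x i s * x j s) n)" for s
      define L where "L s = E s - I s" for s
      define L' where "L' s = 2 * (\<Sum>i\<le>7. x i s * d i s) - (\<Sum>n=1..7. \<epsilon> n * interaction a r g (\<lambda>i j. d i s * x j s + x i s * d j s) n)" for s
      have L': "(L has_real_derivative L' s) (at s within {0..})" if s: "s \<ge> 0" for s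
        unfolding L_def L'_def E_def I_def sum_distrib_left
        by (intro DERIV_diff DERIV_sum DERIV_cmult interaction_has_real_derivative d s)
           (auto intro!: derivative_eq_intros d s)
      have I: "\<bar>I s\<bar> \<le> E s / 2" for s
      proof -
        have "\<bar>I s\<bar> \<le> (\<Sum>n=1..(7::nat). \<delta> * (K * E s))" unfolding I_def
        proof (rule order.trans[OF sum_abs], intro sum_mono)
          fix n :: nat assume n: "n \<in> {1..7}"
          show "\<bar>\<epsilon> n * interaction a r g (\<lambda>i j. x i s * x j s) n\<bar> \<le> \<delta> * (K * E s)"
            unfolding abs_mult E_def using \<epsilon>(1)[of n] \<epsilon>(2)[OF n] \<delta> K(2)[of r g n "\<lambda>i. x i s"] r g n
            by (intro mult_mono) auto
        qed
        then show ?thesis using K(1) by (simp add: \<delta>_def field_simps)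
      qed
      have E0: "E s \<ge> 0" for s by (simp add: E_def sum_nonneg)
      have rate0: "decay_rate \<xi> \<ge> 0" by (simp add: decay_rate_def)
      have "L' s \<le> - (2 * c / 3 * decay_rate \<xi>) * L s" if "s \<ge> 0" for s
      proof -
        have "L' s \<le> - c * decay_rate \<xi> * E s"
          using diss[OF g r r_def, of "\<lambda>i. d i s" "\<lambda>i. x i s"] unfolding L'_def E_def rate by (simp add: d_def)
        moreover have "c * decay_rate \<xi> * (2 / 3 * L s) \<le> c * decay_rate \<xi> * E s"
          using I[of s] c rate0 by (intro mult_left_mono) (auto simp: L_def abs_le_iff)
        ultimately show ?thesis by simp
      qed
      from exponential_decay_of_dissipation[OF L' this t]
      have "L t \<le> exp (- (2 * c / 3 * decay_rate \<xi>) * t) * L 0" by simp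
      also have "\<dots> \<le> exp (- (2 * c / 3 * decay_rate \<xi>) * t) * (3 / 2 * E 0)"
        using I[of 0] by (intro mult_left_mono) (auto simp: L_def abs_le_iff)
      finally have "L t \<le> exp (- (2 * c / 3 * decay_rate \<xi>) * t) * (3 / 2 * E 0)" .
      moreover have "E t \<le> 2 * L t" using I[of t] by (auto simp: L_def abs_le_iff)
      ultimately have "E t \<le> 3 * exp (- (2 * c / 3 * decay_rate \<xi>) * t) * E 0" by simp
      then show "(\<Sum>i\<le>7. (x i t)\<^sup>2) \<le> 3 * exp (- (2 * c / 3) * decay_rate \<xi> * t) * (\<Sum>i\<le>7. (x i 0)\<^sup>2)"
        unfolding E_def by simp
    qed
  qed
qed

section \<open>The transformed system\<close>

lemma exhaust_8:
  fixes x :: 8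
  shows "x = 1 \<or> x = 2 \<or> x = 3 \<or> x = 4 \<or> x = 5 \<or> x = 6 \<or> x = 7 \<or> x = 8"
proof (induct x)
  case (of_int z)
  then have "z = 0 \<or> z = 1 \<or> z = 2 \<or> z = 3 \<or> z = 4 \<or> z = 5 \<or> z = 6 \<or> z = 7" by fastforce
  then show ?case by auto
qed

lemma UNIV_8: "(UNIV :: 8 set) = {1, 2, 3, 4, 5, 6, 7, 8}"
  using exhaust_8 by auto

text \<open>Boundedness of a functional of the coordinates 0 to 7 in the energy norm. It is stable
  under sums and multiples, which yields it for the inverse coordinate change term by term, without
  computing a matrix norm.\<close>

definition linear_bound :: "((nat \<Rightarrow> complex) \<Rightarrow> complex) \<Rightarrow> bool" where
  "linear_bound f \<longleftrightarrow> (\<exists>K\<ge>0. \<forall>X. (cmod (f X))\<^sup>2 \<le> K * (\<Sum>i\<le>7. (cmod (X i))\<^sup>2))"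

lemma linear_bound_proj: "i \<le> 7 \<Longrightarrow> linear_bound (\<lambda>X. X i)"
  unfolding linear_bound_def by (rule exI[of _ 1]) (auto intro!: member_le_sum)

lemma linear_bound_scale:
  assumes "linear_bound f" shows "linear_bound (\<lambda>X. c * f X)"
proof -
  obtain K where K: "K \<ge> 0" "\<And>X. (cmod (f X))\<^sup>2 \<le> K * (\<Sum>i\<le>7. (cmod (X i))\<^sup>2)"
    using assms by (auto simp: linear_bound_def)
  show ?thesis unfolding linear_bound_def
  proof (intro exI[of _ "(cmod c)\<^sup>2 * K"] conjI allI)
    fix X :: "nat \<Rightarrow> complex"
    show "(cmod (c * f X))\<^sup>2 \<le> (cmod c)\<^sup>2 * K * (\<Sum>i\<le>7. (cmod (X i))\<^sup>2)"
      using K(2)[of X] by (simp add: norm_mult power_mult_distrib mult_left_mono mult.assoc)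
  qed (use K in simp)
qed

lemma linear_bound_add:
  assumes "linear_bound f" "linear_bound g" shows "linear_bound (\<lambda>X. f X + g X)"
proof -
  obtain K where K: "K \<ge> 0" "\<And>X. (cmod (f X))\<^sup>2 \<le> K * (\<Sum>i\<le>7. (cmod (X i))\<^sup>2)"
    using assms by (auto simp: linear_bound_def)
  obtain K' where K': "K' \<ge> 0" "\<And>X. (cmod (g X))\<^sup>2 \<le> K' * (\<Sum>i\<le>7. (cmod (X i))\<^sup>2)"
    using assms by (auto simp: linear_bound_def)
  show ?thesis unfolding linear_bound_def
  proof (intro exI[of _ "2 * K + 2 * K'"] conjI allI)
    fix X :: "nat \<Rightarrow> complex"
    have "(cmod (f X + g X))\<^sup>2 \<le> (cmod (f X) + cmod (g X))\<^sup>2"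
      by (intro power_mono norm_triangle_ineq) auto
    also have "\<dots> \<le> 2 * (cmod (f X))\<^sup>2 + 2 * (cmod (g X))\<^sup>2"
      using sum_squares_bound[of "cmod (f X)" "cmod (g X)"] by (simp add: power2_sum)
    also have "\<dots> \<le> (2 * K + 2 * K') * (\<Sum>i\<le>7. (cmod (X i))\<^sup>2)"
      using K(2)[of X] K'(2)[of X] by (simp add: algebra_simps)
    finally show "(cmod (f X + g X))\<^sup>2 \<le> (2 * K + 2 * K') * (\<Sum>i\<le>7. (cmod (X i))\<^sup>2)" .
  qed (use K K' in simp)
qed

lemma linear_bound_minus: "linear_bound f \<Longrightarrow> linear_bound (\<lambda>X. - f X)"
  using linear_bound_scale[of f "-1"] by simp

lemma linear_bound_diff: "linear_bound f \<Longrightarrow> linear_bound g \<Longrightarrow> linear_bound (\<lambda>X. f X - g X)"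
  using linear_bound_add[OF _ linear_bound_minus] by simp

text \<open>The squared moduli of the new coordinates add up to the physical energy \<open>k1 |v|^2
  + |u|^2 + k2 |z|^2 + |y|^2 + k3 |\<phi>|^2 + |\<theta>|^2 + |\<eta>|^2 + |q|^2\<close>. The change
  of coordinates does not involve \<xi>, so it and its inverse have bounds uniform in the frequency
  and the decay of the chain carries over.\<close>

lemma transformed_system_decay:
  fixes k1 k2 k3 k4 k5 \<gamma> :: real
  assumes pos: "k1 > 0" "k2 > 0" "k3 > 0" "k4 > 0" "k5 > 0" "\<gamma> > 0" and neq: "k2 \<noteq> k3"
  obtains C c :: real where "C > 0" "c > 0"
    "\<And>\<xi> W t i. solves_transformed_system k1 k2 k3 k4 k5 \<gamma> \<xi> W \<Longrightarrow> t \<ge> 0 \<Longrightarrow>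
       (cmod (W t $ i))\<^sup>2 \<le> C * exp (- c * decay_rate \<xi> * t) * (\<Sum>i\<in>UNIV. (cmod (W 0 $ i))\<^sup>2)"
proof -
  define p where "p = sqrt k1"
  define w where "w = sqrt 2"
  define s where "s = sqrt (k2 + k3)"
  \<comment> \<open>Reciprocals get their own names together with \<open>w * v = 1\<close> and
    \<open>s * u = 1\<close>; all identities below then become polynomial identities modulo these
    relations.\<close>
  define v where "v = 1 / w"
  define u where "u = 1 / s"
  define m where "m = sqrt (k2 * k3)"
  have sq: "p * p = k1" "w * w = 2" "s * s = k2 + k3" "m * m = k2 * k3"
    and nz: "p \<noteq> 0" "w \<noteq> 0" "s \<noteq> 0" "m \<noteq> 0" "v \<noteq> 0" "u \<noteq> 0"
    using pos by (auto simp: p_def w_def s_def m_def v_def u_def)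
  have inv: "w * v = 1" "s * u = 1" using nz by (simp_all add: v_def u_def)
  define a where "a i = (if i = 0 then k4 else if i = 1 then \<gamma> else if i = 2 then p else if i = 3 then w * p
    else if i = 4 then s * v else if i = 5 then (k2 - k3) * v * u else w * m * u)" for i :: nat
  have a_simps: "a 0 = k4" "a 1 = \<gamma>" "a 2 = p" "a 3 = w * p" "a 4 = s * v" "a 5 = (k2 - k3) * v * u" "a 6 = w * m * u"
    by (simp_all add: a_def)
  have a: "a i \<noteq> 0" for i using nz pos neq by (simp add: a_def)
  obtain C c where C: "C > 0" and c: "c > 0" and decay: "\<And>\<xi> x t. damped_chain k5 a \<xi> x \<Longrightarrow> t \<ge> 0 \<Longrightarrow>
      (\<Sum>i\<le>7. (x i t)\<^sup>2) \<le> C * exp (- c * decay_rate \<xi> * t) * (\<Sum>i\<le>7. (x i 0)\<^sup>2)"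
    using damped_chain_decay[of k5 a, OF pos(5) a] by auto
  \<comment> \<open>The coordinates that make the undamped part real, skew-symmetric and tridiagonal; they arise by
    orthonormalising \<open>q\<close> and its successive images under the system in the energy inner product.\<close>
  define X where "X V i = (if i = 0 then V $ 8 else if i = 1 then - \<i> * V $ 7 else if i = 2 then - V $ 2
    else if i = 3 then - \<i> * of_real p * V $ 1
    else if i = 4 then - \<i> * of_real v * (V $ 4 + V $ 6)
    else if i = 5 then of_real u * (of_real k2 * V $ 3 + of_real k3 * V $ 5)
    else if i = 6 then \<i> * of_real v * (V $ 4 - V $ 6)
    else - (of_real m * of_real u) * (V $ 3 - V $ 5))" for V :: "complex ^ 8" and i :: nat
  have X_simps: "X V 0 = V $ 8" "X V 1 = - \<i> * V $ 7" "X V 2 = - V $ 2" "X V 3 = - \<i> * of_real p * V $ 1"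
    "X V 4 = - \<i> * of_real v * (V $ 4 + V $ 6)"
    "X V 5 = of_real u * (of_real k2 * V $ 3 + of_real k3 * V $ 5)"
    "X V 6 = \<i> * of_real v * (V $ 4 - V $ 6)"
    "X V 7 = - (of_real m * of_real u) * (V $ 3 - V $ 5)" for V
    by (simp_all add: X_def)
  have cx: "of_real p * of_real p = (of_real k1 :: complex)" "of_real w * of_real w = (2 :: complex)"
        "of_real s * of_real s = (of_real k2 + of_real k3 :: complex)" "of_real m * of_real m = (of_real k2 * of_real k3 :: complex)"
        "of_real w * of_real v = (1 :: complex)" "of_real s * of_real u = (1 :: complex)"
    unfolding of_real_mult[symmetric] of_real_add[symmetric] sq inv by simp_all
  have ii: "\<i> * \<i> = (- 1 :: complex)" by simp
  have decay_X: "(\<Sum>i\<le>7. (cmod (X (W t) i))\<^sup>2) \<le> C * exp (- c * decay_rate \<xi> * t) * (\<Sum>i\<le>7. (cmod (X (W 0) i))\<^sup>2)"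
    if W: "solves_transformed_system k1 k2 k3 k4 k5 \<gamma> \<xi> W" and t: "t \<ge> 0" for \<xi> W t
  proof -
    define e where "e t i = (if i = 0 then (- k5) *\<^sub>R X (W t) 0 + (a 0 * \<xi>) *\<^sub>R X (W t) 1
      else if i = 1 then (a 1 * \<xi>) *\<^sub>R X (W t) 2 - (a 0 * \<xi>) *\<^sub>R X (W t) 0
      else if i = 2 then (a 2 * \<xi>) *\<^sub>R X (W t) 3 - (a 1 * \<xi>) *\<^sub>R X (W t) 1
      else if i = 3 then a 3 *\<^sub>R X (W t) 4 - (a 2 * \<xi>) *\<^sub>R X (W t) 2
      else if i = 4 then (a 4 * \<xi>) *\<^sub>R X (W t) 5 - a 3 *\<^sub>R X (W t) 3
      else if i = 5 then (a 5 * \<xi>) *\<^sub>R X (W t) 6 - (a 4 * \<xi>) *\<^sub>R X (W t) 4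
      else if i = 6 then (a 6 * \<xi>) *\<^sub>R X (W t) 7 - (a 5 * \<xi>) *\<^sub>R X (W t) 5
      else (- a 6 * \<xi>) *\<^sub>R X (W t) 6)" for t and i :: nat
    have eqs: "e t 0 = (- k5) *\<^sub>R X (W t) 0 + (a 0 * \<xi>) *\<^sub>R X (W t) 1"
      "e t 1 = (a 1 * \<xi>) *\<^sub>R X (W t) 2 - (a 0 * \<xi>) *\<^sub>R X (W t) 0"
      "e t 2 = (a 2 * \<xi>) *\<^sub>R X (W t) 3 - (a 1 * \<xi>) *\<^sub>R X (W t) 1"
      "e t 3 = a 3 *\<^sub>R X (W t) 4 - (a 2 * \<xi>) *\<^sub>R X (W t) 2"
      "e t 4 = (a 4 * \<xi>) *\<^sub>R X (W t) 5 - a 3 *\<^sub>R X (W t) 3"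
      "e t 5 = (a 5 * \<xi>) *\<^sub>R X (W t) 6 - (a 4 * \<xi>) *\<^sub>R X (W t) 4"
      "e t 6 = (a 6 * \<xi>) *\<^sub>R X (W t) 7 - (a 5 * \<xi>) *\<^sub>R X (W t) 5"
      "e t 7 = (- a 6 * \<xi>) *\<^sub>R X (W t) 6" for t
      by (simp_all add: e_def)
    have chain: "((\<lambda>r. X (W r) i) has_vector_derivative e t i) (at t within {0..})" if t: "t \<ge> 0" and i: "i \<in> {..7}" for t i
    proof -
      define dx where "dx i = \<i> * of_real \<xi> * W t $ i" for i
      have D: "((\<lambda>r. W r $ 1) has_vector_derivative dx 2 + W t $ 4 + W t $ 6) (at t within {0..})"
        "((\<lambda>r. W r $ 2) has_vector_derivative of_real k1 * dx 1 - of_real \<gamma> * dx 7) (at t within {0..})"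
        "((\<lambda>r. W r $ 3) has_vector_derivative dx 4) (at t within {0..})"
        "((\<lambda>r. W r $ 4) has_vector_derivative of_real k2 * dx 3 - of_real k1 * W t $ 1) (at t within {0..})"
        "((\<lambda>r. W r $ 5) has_vector_derivative dx 6) (at t within {0..})"
        "((\<lambda>r. W r $ 6) has_vector_derivative of_real k3 * dx 5 - of_real k1 * W t $ 1) (at t within {0..})"
        "((\<lambda>r. W r $ 7) has_vector_derivative - of_real k4 * dx 8 - of_real \<gamma> * dx 2) (at t within {0..})"
        "((\<lambda>r. W r $ 8) has_vector_derivative - of_real k5 * W t $ 8 - of_real k4 * dx 7) (at t within {0..})"
        using W[unfolded solves_transformed_system_def Let_def, rule_format, OF t] unfolding dx_def by auto
      note conv = a_simps X_simps dx_def scaleR_conv_of_real of_real_mult of_real_add of_real_diff of_real_minus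
      have rw: "(F has_vector_derivative e') (at t within {0..})" if "(F has_vector_derivative e'') (at t within {0..})" "e' = e''" for F and e' e'' :: complex
        using that by simp
      show ?thesis
        using i unfolding atMost_7 insert_iff empty_iff
      proof (elim disjE)
        assume i: "i = 0"
        show ?thesis unfolding i eqs unfolding conv
          by (rule rw[OF D(8)], unfold dx_def) (simp add: algebra_simps)
      next
        assume i: "i = 1"
        show ?thesis unfolding i eqs unfolding conv
          by (rule rw[OF has_vector_derivative_mult_right[OF D(7)]], unfold dx_def) (simp add: algebra_simps)
      next
        assume i: "i = 2"
        show ?thesis unfolding i eqs unfolding conv
          by (rule rw[OF has_vector_derivative_minus[OF D(2)]], unfold dx_def) (simp add: algebra_simps flip: cx(1))
      next
        assume i: "i = 3"
        show ?thesis unfolding i eqs unfolding conv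
          by (rule rw[OF has_vector_derivative_mult_right[OF D(1)]], unfold dx_def) (use ii cx(5) in algebra)
      next
        assume i: "i = 4"
        show ?thesis unfolding i eqs unfolding conv
          by (rule rw[OF has_vector_derivative_mult_right[OF has_vector_derivative_add[OF D(4) D(6)]]], unfold dx_def) (use ii cx(1,2,5,6) in algebra)
      next
        assume i: "i = 5"
        show ?thesis unfolding i eqs unfolding conv
          by (rule rw[OF has_vector_derivative_mult_right[OF has_vector_derivative_add[OF has_vector_derivative_mult_right[OF D(3)] has_vector_derivative_mult_right[OF D(5)]]]], unfold dx_def) (use ii cx(2,3,5,6) in algebra)
      next
        assume i: "i = 6"
        show ?thesis unfolding i eqs unfolding conv
          by (rule rw[OF has_vector_derivative_mult_right[OF has_vector_derivative_diff[OF D(4) D(6)]]], unfold dx_def) (use ii cx(3,4,2,5,6) in algebra)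
      next
        assume i: "i = 7"
        show ?thesis unfolding i eqs unfolding conv
          by (rule rw[OF has_vector_derivative_mult_right[OF has_vector_derivative_diff[OF D(3) D(5)]]], unfold dx_def) (use ii cx(5) in algebra)
      qed simp
    qed
    \<comment> \<open>The chain has real coefficients, so every real-linear functional of a complex
      solution solves the real chain. The real and imaginary parts together give the squared
      moduli.\<close>
    have part: "(\<Sum>i\<le>7. (h (X (W t) i))\<^sup>2) \<le> C * exp (- c * decay_rate \<xi> * t) * (\<Sum>i\<le>7. (h (X (W 0) i))\<^sup>2)"
      if h: "bounded_linear h" for h :: "complex \<Rightarrow> real"
    proof (rule decay[OF _ t])
      interpret h: bounded_linear h by (rule h)
      show "damped_chain k5 a \<xi> (\<lambda>i t. h (X (W t) i))"
        unfolding damped_chain_def Let_def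
      proof (intro allI impI)
        fix t :: real assume t: "t \<ge> 0"
        have D: "((\<lambda>t. h (X (W t) i)) has_real_derivative d) (at t within {0..})" if "i \<in> {..7}" "d = h (e t i)" for i d
          using h.has_vector_derivative[OF chain[OF t that(1)]] that(2)
          by (simp add: has_real_derivative_iff_has_vector_derivative o_def)
        show "((\<lambda>t. h (X (W t) 0)) has_real_derivative - k5 * h (X (W t) 0) + a 0 * \<xi> * h (X (W t) 1)) (at t within {0..}) \<and>
          ((\<lambda>t. h (X (W t) 1)) has_real_derivative a 1 * \<xi> * h (X (W t) 2) - a 0 * \<xi> * h (X (W t) 0)) (at t within {0..}) \<and>
          ((\<lambda>t. h (X (W t) 2)) has_real_derivative a 2 * \<xi> * h (X (W t) 3) - a 1 * \<xi> * h (X (W t) 1)) (at t within {0..}) \<and>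
          ((\<lambda>t. h (X (W t) 3)) has_real_derivative a 3 * h (X (W t) 4) - a 2 * \<xi> * h (X (W t) 2)) (at t within {0..}) \<and>
          ((\<lambda>t. h (X (W t) 4)) has_real_derivative a 4 * \<xi> * h (X (W t) 5) - a 3 * h (X (W t) 3)) (at t within {0..}) \<and>
          ((\<lambda>t. h (X (W t) 5)) has_real_derivative a 5 * \<xi> * h (X (W t) 6) - a 4 * \<xi> * h (X (W t) 4)) (at t within {0..}) \<and>
          ((\<lambda>t. h (X (W t) 6)) has_real_derivative a 6 * \<xi> * h (X (W t) 7) - a 5 * \<xi> * h (X (W t) 5)) (at t within {0..}) \<and>
          ((\<lambda>t. h (X (W t) 7)) has_real_derivative - a 6 * \<xi> * h (X (W t) 6)) (at t within {0..})"
          by (intro conjI D) (simp, simp only: eqs h.add h.diff h.scaleR real_scaleR_def)+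
      qed
    qed
    show ?thesis
      using add_mono[OF part[OF bounded_linear_Re] part[OF bounded_linear_Im]]
      by (simp only: cmod_power2 sum.distrib distrib_left)
  qed
  define q where "q = 1 / p"
  define n where "n = 1 / m"
  have cx2: "of_real p * of_real q = (1 :: complex)" "of_real m * of_real n = (1 :: complex)"
    using nz by (simp_all add: q_def n_def flip: of_real_mult)
  \<comment> \<open>The inverse of \<open>X\<close>. Components 3 and 5 are recovered from
    \<open>Z 5\<close> and \<open>Z 7\<close> by means of \<open>u^2 * (k2 + k3) = 1\<close>,
    components 4 and 6 from half the sum and difference of \<open>y\<close> and \<theta>.\<close>
  define Y where "Y i Z = (if i = 1 then \<i> * of_real q * Z 3 else if i = 2 then - 1 * Z 2
      else if i = 3 then of_real u * Z 5 + (- of_real k3 * of_real u * of_real n) * Z 7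
      else if i = 4 then \<i> * of_real v * Z 4 + (- \<i> * of_real v) * Z 6
      else if i = 5 then of_real u * Z 5 + of_real k2 * of_real u * of_real n * Z 7
      else if i = 6 then \<i> * of_real v * Z 4 + \<i> * of_real v * Z 6
      else if i = 7 then \<i> * Z 1 else Z 0)" for i :: 8 and Z :: "nat \<Rightarrow> complex"
  have Y: "Y i (X V) = V $ i" for i V
  proof -
    have Y_simps: "Y 1 Z = \<i> * of_real q * Z 3" "Y 2 Z = - 1 * Z 2"
      "Y 3 Z = of_real u * Z 5 + (- of_real k3 * of_real u * of_real n) * Z 7"
      "Y 4 Z = \<i> * of_real v * Z 4 + (- \<i> * of_real v) * Z 6"
      "Y 5 Z = of_real u * Z 5 + of_real k2 * of_real u * of_real n * Z 7"
      "Y 6 Z = \<i> * of_real v * Z 4 + \<i> * of_real v * Z 6"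
      "Y 7 Z = \<i> * Z 1" "Y 8 Z = Z 0" for Z by (simp_all add: Y_def)
    show ?thesis using exhaust_8[of i]
    proof (elim disjE)
      assume i: "i = 1" show ?thesis unfolding i Y_simps X_simps using ii cx2(1) by algebra
    next
      assume i: "i = 2" show ?thesis unfolding i Y_simps X_simps by simp
    next
      assume i: "i = 3" show ?thesis unfolding i Y_simps X_simps using cx(3,6) cx2(2) by algebra
    next
      assume i: "i = 4" show ?thesis unfolding i Y_simps X_simps using ii cx(2,5) by algebra
    next
      assume i: "i = 5" show ?thesis unfolding i Y_simps X_simps using cx(3,6) cx2(2) by algebra
    next
      assume i: "i = 6" show ?thesis unfolding i Y_simps X_simps using ii cx(2,5) by algebra
    next
      assume i: "i = 7" show ?thesis unfolding i Y_simps X_simps using ii by algebra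
    next
      assume i: "i = 8" show ?thesis unfolding i Y_simps X_simps ..
    qed
  qed
  have lb: "linear_bound (Y i)" for i
  proof -
    have "\<forall>i\<in>UNIV. linear_bound (Y i)"
      unfolding UNIV_8 Y_def by (simp add: linear_bound_add linear_bound_minus linear_bound_diff linear_bound_scale linear_bound_proj)
    then show ?thesis by simp
  qed
  then obtain K where K: "\<And>i. K i \<ge> 0" "\<And>i Z. (cmod (Y i Z))\<^sup>2 \<le> K i * (\<Sum>i\<le>7. (cmod (Z i))\<^sup>2)"
    unfolding linear_bound_def by metis
  have "bounded_linear (\<lambda>V. X V i)" for i
    unfolding X_def linear_conv_bounded_linear[symmetric]
    by (rule linearI) (simp_all add: algebra_simps)
  then have "\<exists>B. \<forall>V. cmod (X V i) \<le> norm V * B" for i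
    by (metis bounded_linear.bounded)
  then obtain B where B: "\<And>i V. cmod (X V i) \<le> norm V * B i" by metis
  define KK where "KK = (\<Sum>i\<in>UNIV. K i)"
  define BB where "BB = (\<Sum>i\<le>7. (B i)\<^sup>2)"
  show thesis
  proof (rule that[OF _ c])
    have KK: "KK \<ge> 0" and BB: "BB \<ge> 0" unfolding KK_def BB_def using K by (auto intro: sum_nonneg)
    then show "(KK + 1) * C * (BB + 1) > 0" using C by (intro mult_pos_pos) auto
    fix \<xi> W and t :: real and i :: 8
    assume W: "solves_transformed_system k1 k2 k3 k4 k5 \<gamma> \<xi> W" and t: "t \<ge> 0"
    define E where "E = exp (- c * decay_rate \<xi> * t)"
    define N where "N = (\<Sum>i\<in>UNIV. (cmod (W 0 $ i))\<^sup>2)"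
    have N: "N = (norm (W 0))\<^sup>2" "N \<ge> 0" by (auto simp: N_def norm_vec_def L2_set_def sum_nonneg)
    have S0: "(\<Sum>i\<le>7. (cmod (X V i))\<^sup>2) \<ge> 0" for V by (simp add: sum_nonneg)
    have Ki: "K i \<le> KK + 1" unfolding KK_def using K(1) member_le_sum[of i UNIV K] by simp
    have "(\<Sum>i\<le>7. (cmod (X (W 0) i))\<^sup>2) \<le> (\<Sum>i\<le>7. (norm (W 0))\<^sup>2 * (B i)\<^sup>2)"
      unfolding power_mult_distrib[symmetric] by (intro sum_mono power_mono B) auto
    also have "\<dots> = BB * N" by (simp add: BB_def N sum_distrib_left mult.commute)
    also have "\<dots> \<le> (BB + 1) * N" using N by (intro mult_right_mono) auto
    finally have X0: "(\<Sum>i\<le>7. (cmod (X (W 0) i))\<^sup>2) \<le> (BB + 1) * N" .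
    have "(cmod (W t $ i))\<^sup>2 \<le> K i * (\<Sum>i\<le>7. (cmod (X (W t) i))\<^sup>2)"
      using K(2)[of i "X (W t)"] by (simp only: Y)
    also have "\<dots> \<le> (KK + 1) * (C * E * (\<Sum>i\<le>7. (cmod (X (W 0) i))\<^sup>2))"
      using decay_X[OF W t] Ki KK S0 unfolding E_def by (intro mult_mono) auto
    also have "\<dots> \<le> (KK + 1) * (C * E * ((BB + 1) * N))"
      using X0 KK C by (intro mult_left_mono) (auto simp: E_def)
    also have "\<dots> = (KK + 1) * C * (BB + 1) * E * N" by simp
    finally show "(cmod (W t $ i))\<^sup>2 \<le> (KK + 1) * C * (BB + 1) * exp (- c * decay_rate \<xi> * t) * (\<Sum>i\<in>UNIV. (cmod (W 0 $ i))\<^sup>2)"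
      unfolding E_def N_def .
  qed
qed

section \<open>Bessel and Parseval relations for the Fourier transform\<close>

lemma integrable_pair_mult:
  fixes f g :: "real \<Rightarrow> complex"
  assumes f: "integrable lborel f" and g: "integrable lborel g"
    and K[measurable]: "case_prod K \<in> borel_measurable (lborel \<Otimes>\<^sub>M lborel)" and K1: "\<And>x y. cmod (K x y) \<le> 1"
  shows "integrable (lborel \<Otimes>\<^sub>M lborel) (\<lambda>(x, y). K x y * (f x * g y))"
proof -
  have [measurable]: "f \<in> borel_measurable lborel" "g \<in> borel_measurable lborel" using f g by auto
  have "integrable (lborel \<Otimes>\<^sub>M lborel) (\<lambda>(x, y). f x * g y)"
  proof (rule lborel_pair.Fubini_integrable)
    show "(\<lambda>(x, y). f x * g y) \<in> borel_measurable (lborel \<Otimes>\<^sub>M lborel)" by measurable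
    show "integrable lborel (\<lambda>x. \<integral>y. norm (case (x, y) of (x, y) \<Rightarrow> f x * g y) \<partial>lborel)"
      using f by (simp add: norm_mult)
    show "AE x in lborel. integrable lborel (\<lambda>y. case (x, y) of (x, y) \<Rightarrow> f x * g y)"
      using g by simp
  qed
  then show ?thesis
  proof (rule Bochner_Integration.integrable_bound)
    show "(\<lambda>(x, y). K x y * (f x * g y)) \<in> borel_measurable (lborel \<Otimes>\<^sub>M lborel)"
      using measurable_compose[OF _ K] by measurable
    show "AE p in lborel \<Otimes>\<^sub>M lborel. norm (case p of (x, y) \<Rightarrow> K x y * (f x * g y)) \<le> norm (case p of (x, y) \<Rightarrow> f x * g y)"
      using K1 by (auto simp: norm_mult mult_left_le_one_le)
  qed
qed

lemma norm_fourier_kernel [simp]: "cmod (exp (- (\<i> * of_real \<xi> * of_real x))) = 1"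
  by simp

lemma borel_measurable_fourier:
  assumes [measurable]: "f \<in> borel_measurable borel" and [measurable]: "h \<in> borel_measurable M"
  shows "(\<lambda>\<xi>. fourier f (h \<xi>)) \<in> borel_measurable M"
  unfolding fourier_def by measurable

lemma integrable_fourier_kernel_mult:
  assumes f: "integrable lborel f"
  shows "integrable lborel (\<lambda>x. exp (- \<i> * of_real \<xi> * of_real x) * f x)"
proof (rule Bochner_Integration.integrable_bound[OF f])
  have [measurable]: "f \<in> borel_measurable lborel" using f by auto
  show "(\<lambda>x. exp (- \<i> * of_real \<xi> * of_real x) * f x) \<in> borel_measurable lborel" by measurable
qed (simp add: norm_mult)

lemma norm_fourier_le: "cmod (fourier f \<xi>) \<le> (\<integral>x. cmod (f x) \<partial>lborel)"
  unfolding fourier_def by (rule order.trans[OF integral_norm_bound]) (simp add: norm_mult)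

text \<open>Fubini's theorem, the kernel being symmetric in the two variables and of modulus
  1.\<close>

lemma fourier_multiplication_formula:
  assumes f: "integrable lborel f" and g: "integrable lborel g"
  shows "(\<integral>\<xi>. fourier f \<xi> * g \<xi> \<partial>lborel) = (\<integral>x. f x * fourier g x \<partial>lborel)"
proof -
  have int: "integrable (lborel \<Otimes>\<^sub>M lborel) (\<lambda>(x, \<xi>). exp (- \<i> * of_real \<xi> * of_real x) * (f x * g \<xi>))"
  proof (rule integrable_pair_mult[OF f g])
    show "(\<lambda>(x, \<xi>). exp (- \<i> * of_real \<xi> * of_real x)) \<in> borel_measurable (lborel \<Otimes>\<^sub>M lborel)"
      by measurable
    show "cmod (exp (- \<i> * of_real \<xi> * of_real x)) \<le> 1" for x \<xi> by simp
  qed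
  have "(\<integral>\<xi>. fourier f \<xi> * g \<xi> \<partial>lborel) = (\<integral>\<xi>. (\<integral>x. exp (- \<i> * of_real \<xi> * of_real x) * (f x * g \<xi>) \<partial>lborel) \<partial>lborel)"
    unfolding fourier_def integral_mult_left_zero[symmetric] by (simp only: mult.assoc)
  also have "\<dots> = (\<integral>x. (\<integral>\<xi>. exp (- \<i> * of_real \<xi> * of_real x) * (f x * g \<xi>) \<partial>lborel) \<partial>lborel)"
    using lborel_pair.Fubini_integral[OF int] by simp
  also have "\<dots> = (\<integral>x. f x * fourier g x \<partial>lborel)"
    unfolding fourier_def integral_mult_right_zero[symmetric]
    by (intro Bochner_Integration.integral_cong refl) (simp add: mult_ac)
  finally show ?thesis .
qed

section \<open>Gaussian regularisation of the frequency integrals\<close>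

definition gauss :: "real \<Rightarrow> real \<Rightarrow> real" where
  "gauss \<epsilon> \<xi> = exp (- (\<epsilon> * \<xi>)\<^sup>2 / 2)"

lemma gauss_bounds: "0 < gauss \<epsilon> \<xi>" "gauss \<epsilon> \<xi> \<le> 1"
  by (auto simp: gauss_def)

lemma borel_measurable_gauss [measurable]: "gauss \<epsilon> \<in> borel_measurable borel"
  unfolding gauss_def[abs_def] by measurable

lemma gauss_std_normal: "gauss \<epsilon> \<xi> = sqrt (2 * pi) * std_normal_density (\<epsilon> * \<xi>)"
  by (simp add: gauss_def std_normal_density_def)

lemma integrable_gauss: "\<epsilon> \<noteq> 0 \<Longrightarrow> integrable lborel (gauss \<epsilon>)"
  unfolding gauss_std_normal[abs_def]
  using lborel_integrable_real_affine[of "std_normal_density" \<epsilon> 0] by simp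

text \<open>A rescaling of the characteristic function of the standard normal law. The result is
  \<open>2 * pi\<close> times a probability density that concentrates at 0 with \<epsilon>, which is
  where the constant of all later relations comes from.\<close>

lemma fourier_gauss:
  assumes "\<epsilon> > 0"
  shows "fourier (\<lambda>\<xi>. of_real (gauss \<epsilon> \<xi>)) u = of_real (2 * pi * normal_density 0 \<epsilon> u)"
proof -
  define t where "t = - u / \<epsilon>"
  have "of_real (exp (- (t^2) / 2)) = char std_normal_distribution t"
    by (simp add: char_std_normal_distribution)
  also have "\<dots> = (\<integral>x. of_real (std_normal_density x) * iexp (t * x) \<partial>lborel)"
    unfolding char_def by (subst integral_density) (auto simp: scaleR_conv_of_real)
  also have "\<dots> = \<bar>\<epsilon>\<bar> *\<^sub>R (\<integral>\<xi>. of_real (std_normal_density (0 + \<epsilon> * \<xi>)) * iexp (t * (0 + \<epsilon> * \<xi>)) \<partial>lborel)"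
    using assms by (intro lborel_integral_real_affine) auto
  also have "(\<lambda>\<xi>. of_real (std_normal_density (0 + \<epsilon> * \<xi>)) * iexp (t * (0 + \<epsilon> * \<xi>)))
      = (\<lambda>\<xi>. of_real (1 / sqrt (2 * pi)) * (exp (- \<i> * of_real u * of_real \<xi>) * of_real (gauss \<epsilon> \<xi>)))"
    using assms by (simp add: gauss_std_normal t_def fun_eq_iff mult.assoc)
  finally have eq: "of_real (exp (- (t^2) / 2)) = \<epsilon> *\<^sub>R (of_real (1 / sqrt (2 * pi)) * fourier (\<lambda>\<xi>. of_real (gauss \<epsilon> \<xi>)) u)"
    using assms by (simp add: fourier_def)
  have "fourier (\<lambda>\<xi>. of_real (gauss \<epsilon> \<xi>)) u = of_real (sqrt (2 * pi) / \<epsilon>) * (\<epsilon> *\<^sub>R (of_real (1 / sqrt (2 * pi)) * fourier (\<lambda>\<xi>. of_real (gauss \<epsilon> \<xi>)) u))"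
    using assms by (simp add: scaleR_conv_of_real field_simps flip: of_real_mult)
  also have "\<dots> = of_real (sqrt (2 * pi) / \<epsilon> * exp (- (t^2) / 2))"
    unfolding eq[symmetric] by simp
  also have "sqrt (2 * pi) / \<epsilon> * exp (- (t^2) / 2) = 2 * pi * normal_density 0 \<epsilon> u"
  proof -
    have "sqrt (2 * pi) * sqrt (2 * pi) = 2 * pi" by simp
    then show ?thesis using assms
      by (simp add: normal_density_def t_def real_sqrt_mult power_divide field_simps)
  qed
  finally show ?thesis .
qed

lemma fourier_reflect: "fourier (\<lambda>x. f (- x)) \<xi> = fourier f (- \<xi>)"
  unfolding fourier_def
  using lborel_integral_real_affine[of "-1" "\<lambda>x. exp (- \<i> * of_real (- \<xi>) * of_real x) * f x" 0] by simp

text \<open>The Gaussian factor makes the frequency integral converge for merely integrable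
  functions, so Fubini can be used twice. Choosing \<open>b\<close> as the conjugate of
  \<open>a\<close> leads to the Bessel inequality, choosing a test function leads to
  Parseval.\<close>

lemma fourier_gauss_bilinear:
  assumes a: "integrable lborel a" and b: "integrable lborel b" and \<epsilon>: "\<epsilon> > 0"
  shows "(\<integral>\<xi>. fourier a \<xi> * (fourier b (- \<xi>) * of_real (gauss \<epsilon> \<xi>)) \<partial>lborel)
    = of_real (2 * pi) * (\<integral>x. a x * (\<integral>y. b y * of_real (normal_density 0 \<epsilon> (x - y)) \<partial>lborel) \<partial>lborel)"
proof -
  have [measurable]: "b \<in> borel_measurable borel" using b by auto
  have bm: "integrable lborel (\<lambda>x. b (- x))"
    using lborel_integrable_real_affine[OF b, of "-1" 0] by simp
  have G: "integrable lborel (\<lambda>\<xi>. of_real (gauss \<epsilon> \<xi>) :: complex)"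
    using integrable_gauss[of \<epsilon>] \<epsilon> by simp
  have inner: "fourier (\<lambda>\<xi>. fourier b (- \<xi>) * of_real (gauss \<epsilon> \<xi>)) x
      = of_real (2 * pi) * (\<integral>y. b y * of_real (normal_density 0 \<epsilon> (x - y)) \<partial>lborel)" for x
  proof -
    have "fourier (\<lambda>\<xi>. fourier b (- \<xi>) * of_real (gauss \<epsilon> \<xi>)) x
        = (\<integral>\<xi>. fourier (\<lambda>x. b (- x)) \<xi> * (exp (- \<i> * of_real x * of_real \<xi>) * of_real (gauss \<epsilon> \<xi>)) \<partial>lborel)"
      unfolding fourier_reflect by (simp add: fourier_def mult_ac)
    also have "\<dots> = (\<integral>y. b (- y) * fourier (\<lambda>\<xi>. exp (- \<i> * of_real x * of_real \<xi>) * of_real (gauss \<epsilon> \<xi>)) y \<partial>lborel)"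
      by (intro fourier_multiplication_formula bm integrable_fourier_kernel_mult G)
    also have "\<dots> = (\<integral>y. b y * fourier (\<lambda>\<xi>. exp (- \<i> * of_real x * of_real \<xi>) * of_real (gauss \<epsilon> \<xi>)) (- y) \<partial>lborel)"
      using lborel_integral_real_affine[of "-1" "\<lambda>y. b (- y) * fourier (\<lambda>\<xi>. exp (- \<i> * of_real x * of_real \<xi>) * of_real (gauss \<epsilon> \<xi>)) y" 0] by simp
    \<comment> \<open>Modulation becomes translation: the shifted Gaussian transform depends on
      \<open>x - y\<close> only, hence acts as a convolution kernel.\<close>
    also have "(\<lambda>y. fourier (\<lambda>\<xi>. exp (- \<i> * of_real x * of_real \<xi>) * of_real (gauss \<epsilon> \<xi>)) (- y))
        = (\<lambda>y. fourier (\<lambda>\<xi>. of_real (gauss \<epsilon> \<xi>)) (x - y))"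
    proof
      fix y
      have "exp (- \<i> * of_real (- y) * of_real \<xi>) * exp (- \<i> * of_real x * of_real \<xi>) = exp (- \<i> * of_real (x - y) * of_real \<xi>)" for \<xi>
        unfolding exp_add[symmetric] by (simp add: algebra_simps)
      then show "fourier (\<lambda>\<xi>. exp (- \<i> * of_real x * of_real \<xi>) * of_real (gauss \<epsilon> \<xi>)) (- y) = fourier (\<lambda>\<xi>. of_real (gauss \<epsilon> \<xi>)) (x - y)"
        unfolding fourier_def mult.assoc[symmetric] by simp
    qed
    finally have "fourier (\<lambda>\<xi>. fourier b (- \<xi>) * of_real (gauss \<epsilon> \<xi>)) x = (\<integral>y. b y * of_real (2 * pi * normal_density 0 \<epsilon> (x - y)) \<partial>lborel)"
      by (simp only: fourier_gauss[OF \<epsilon>])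
    also have "\<dots> = (\<integral>y. of_real (2 * pi) * (b y * of_real (normal_density 0 \<epsilon> (x - y))) \<partial>lborel)"
      by (intro Bochner_Integration.integral_cong) auto
    finally show ?thesis by (simp only: integral_mult_right_zero)
  qed
  have "integrable lborel (\<lambda>\<xi>. fourier b (- \<xi>) * of_real (gauss \<epsilon> \<xi>))"
  proof (rule Bochner_Integration.integrable_bound)
    show "integrable lborel (\<lambda>\<xi>. of_real (\<integral>x. cmod (b x) \<partial>lborel) * of_real (gauss \<epsilon> \<xi>) :: complex)"
      using G by simp
    have "cmod (fourier b (- \<xi>)) * gauss \<epsilon> \<xi> \<le> (\<integral>x. cmod (b x) \<partial>lborel) * gauss \<epsilon> \<xi>" for \<xi>
      by (intro mult_right_mono norm_fourier_le less_imp_le gauss_bounds)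
    then show "AE \<xi> in lborel. norm (fourier b (- \<xi>) * of_real (gauss \<epsilon> \<xi>)) \<le> norm (of_real (\<integral>x. cmod (b x) \<partial>lborel) * of_real (gauss \<epsilon> \<xi>) :: complex)"
      using gauss_bounds(1)[THEN less_imp_le] by (simp add: norm_mult abs_mult)
    have "(\<lambda>\<xi>. fourier b (- \<xi>)) \<in> borel_measurable borel" by (rule borel_measurable_fourier) measurable
    note [measurable] = this
    show "(\<lambda>\<xi>. fourier b (- \<xi>) * of_real (gauss \<epsilon> \<xi>)) \<in> borel_measurable lborel" by measurable
  qed
  from fourier_multiplication_formula[OF a this] show ?thesis
    unfolding inner by (simp only: mult.left_commute[of _ "of_real (2 * pi)"] integral_mult_right_zero)
qed

text \<open>Fatou's lemma, in the form needed to remove a regularisation from an estimate whose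
  bound does not depend on it.\<close>

lemma nn_integral_le_of_tendsto:
  fixes u :: "nat \<Rightarrow> 'a \<Rightarrow> ennreal"
  assumes [measurable]: "\<And>n. u n \<in> borel_measurable M"
    and lim: "AE x in M. (\<lambda>n. u n x) \<longlonglongrightarrow> v x"
    and le: "\<forall>\<^sub>F n in sequentially. (\<integral>\<^sup>+x. u n x \<partial>M) \<le> B"
  shows "(\<integral>\<^sup>+x. v x \<partial>M) \<le> B"
proof -
  have "(\<integral>\<^sup>+x. v x \<partial>M) = (\<integral>\<^sup>+x. liminf (\<lambda>n. u n x) \<partial>M)"
    using lim by (intro nn_integral_cong_AE) (auto elim!: eventually_mono simp: lim_imp_Liminf)
  also have "\<dots> \<le> liminf (\<lambda>n. \<integral>\<^sup>+x. u n x \<partial>M)" by (intro nn_integral_liminf) measurable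
  also have "\<dots> \<le> limsup (\<lambda>n. \<integral>\<^sup>+x. u n x \<partial>M)" by (intro Liminf_le_Limsup) auto
  also have "\<dots> \<le> B" by (rule Limsup_bounded[OF le])
  finally show ?thesis .
qed

definition sq_norm :: "(real \<Rightarrow> complex) \<Rightarrow> ennreal" where
  "sq_norm f = (\<integral>\<^sup>+x. ennreal ((cmod (f x))\<^sup>2) \<partial>lborel)"

lemma nn_integral_normal_density_shift:
  assumes "\<epsilon> > 0"
  shows "(\<integral>\<^sup>+y. ennreal (normal_density 0 \<epsilon> (x - y)) \<partial>lborel) = 1"
    and "(\<integral>\<^sup>+x. ennreal (normal_density 0 \<epsilon> (x - y)) \<partial>lborel) = 1"
proof -
  have 1: "(\<integral>\<^sup>+y. ennreal (normal_density 0 \<epsilon> y) \<partial>lborel) = 1"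
    using assms by (subst nn_integral_eq_integral) auto
  show "(\<integral>\<^sup>+y. ennreal (normal_density 0 \<epsilon> (x - y)) \<partial>lborel) = 1"
    using nn_integral_real_affine[of "\<lambda>y. ennreal (normal_density 0 \<epsilon> y)" "-1" x] 1 by simp
  show "(\<integral>\<^sup>+x. ennreal (normal_density 0 \<epsilon> (x - y)) \<partial>lborel) = 1"
    using nn_integral_real_affine[of "\<lambda>y. ennreal (normal_density 0 \<epsilon> y)" 1 "-y"] 1 by simp
qed

text \<open>If \<open>f\<close> is not integrable, its Bochner integral is 0 by convention and the
  inequality is trivial.\<close>

lemma ennreal_norm_integral_le:
  fixes f :: "'a \<Rightarrow> 'b :: {banach, second_countable_topology}"
  shows "ennreal (norm (integral\<^sup>L M f)) \<le> (\<integral>\<^sup>+x. ennreal (norm (f x)) \<partial>M)"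
  by (cases "integrable M f") (auto intro: integral_norm_bound_ennreal simp: not_integrable_integral_eq)

text \<open>The weighted energy is a double integral of \<open>a x\<close> and the conjugate of
  \<open>a y\<close> against a normal density in \<open>x - y\<close>. The inequality of arithmetic
  and geometric means separates the two factors, and the density has mass 1 in either variable, so
  the constant is exactly \<open>2 * pi\<close>.\<close>

lemma gauss_weighted_energy_le:
  assumes a: "integrable lborel a" and \<epsilon>: "\<epsilon> > 0"
  shows "(\<integral>\<^sup>+\<xi>. ennreal ((cmod (fourier a \<xi>))\<^sup>2 * gauss \<epsilon> \<xi>) \<partial>lborel) \<le> ennreal (2 * pi) * sq_norm a"
proof -
  have [measurable]: "a \<in> borel_measurable borel" using a by auto
  have [measurable]: "fourier a \<in> borel_measurable borel"
    using borel_measurable_fourier[of a "\<lambda>x. x" borel] by simp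
  define n where "n x = normal_density 0 \<epsilon> x" for x
  have [measurable]: "n \<in> borel_measurable borel" unfolding n_def by measurable
  have n0: "n x \<ge> 0" for x by (simp add: n_def)
  have cn: "integrable lborel (\<lambda>x. cnj (a x))" using a by simp
  have f_cnj: "fourier (\<lambda>x. cnj (a x)) (- \<xi>) = cnj (fourier a \<xi>)" for \<xi>
  proof -
    have "cnj (exp (- \<i> * of_real \<xi> * of_real x) * a x) = exp (- \<i> * of_real (- \<xi>) * of_real x) * cnj (a x)" for x
      by (simp add: exp_cnj)
    then have "fourier (\<lambda>x. cnj (a x)) (- \<xi>) = (\<integral>x. cnj (exp (- \<i> * of_real \<xi> * of_real x) * a x) \<partial>lborel)"
      unfolding fourier_def by (simp only:)
    also have "\<dots> = cnj (fourier a \<xi>)" unfolding fourier_def by (rule Bochner_Integration.integral_cnj)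
    finally show ?thesis .
  qed
  define F where "F \<xi> = (cmod (fourier a \<xi>))\<^sup>2 * gauss \<epsilon> \<xi>" for \<xi>
  have F0: "F \<xi> \<ge> 0" for \<xi> using gauss_bounds(1)[of \<epsilon> \<xi>, THEN less_imp_le] by (simp add: F_def)
  have "integrable lborel F"
  proof (rule Bochner_Integration.integrable_bound)
    show "integrable lborel (\<lambda>\<xi>. (\<integral>x. cmod (a x) \<partial>lborel)\<^sup>2 * gauss \<epsilon> \<xi>)"
      using integrable_gauss[of \<epsilon>] \<epsilon> by simp
    show "F \<in> borel_measurable lborel" unfolding F_def[abs_def] by measurable
    have "F \<xi> \<le> (\<integral>x. cmod (a x) \<partial>lborel)\<^sup>2 * gauss \<epsilon> \<xi>" for \<xi>
      unfolding F_def by (intro mult_right_mono power_mono norm_fourier_le gauss_bounds(1)[THEN less_imp_le] norm_ge_zero)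
    then show "AE \<xi> in lborel. norm (F \<xi>) \<le> norm ((\<integral>x. cmod (a x) \<partial>lborel)\<^sup>2 * gauss \<epsilon> \<xi>)"
      using F0 by (intro AE_I2) (metis abs_of_nonneg abs_ge_self order.trans real_norm_def)
  qed
  then have "(\<integral>\<^sup>+\<xi>. ennreal (F \<xi>) \<partial>lborel) = ennreal (\<integral>\<xi>. F \<xi> \<partial>lborel)"
    using F0 by (intro nn_integral_eq_integral) auto
  also have "\<dots> \<le> ennreal (cmod (\<integral>\<xi>. of_real (F \<xi>) \<partial>lborel))"
    unfolding integral_complex_of_real norm_of_real by (intro ennreal_leI) simp
  also have "(\<lambda>\<xi>. of_real (F \<xi>)) = (\<lambda>\<xi>. fourier a \<xi> * (fourier (\<lambda>x. cnj (a x)) (- \<xi>) * of_real (gauss \<epsilon> \<xi>)))"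
    unfolding f_cnj by (simp only: F_def of_real_mult complex_norm_square mult.assoc)
  also have "(\<integral>\<xi>. fourier a \<xi> * (fourier (\<lambda>x. cnj (a x)) (- \<xi>) * of_real (gauss \<epsilon> \<xi>)) \<partial>lborel)
     = of_real (2 * pi) * (\<integral>x. a x * (\<integral>y. cnj (a y) * of_real (n (x - y)) \<partial>lborel) \<partial>lborel)"
    unfolding n_def by (rule fourier_gauss_bilinear[OF a cn \<epsilon>])
  also have "ennreal (cmod \<dots>) = ennreal (2 * pi) * ennreal (cmod (\<integral>x. a x * (\<integral>y. cnj (a y) * of_real (n (x - y)) \<partial>lborel) \<partial>lborel))"
    by (simp add: norm_mult ennreal_mult)
  also have "ennreal (cmod (\<integral>x. a x * (\<integral>y. cnj (a y) * of_real (n (x - y)) \<partial>lborel) \<partial>lborel))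
     \<le> (\<integral>\<^sup>+x. ennreal (cmod (\<integral>y. a x * (cnj (a y) * of_real (n (x - y))) \<partial>lborel)) \<partial>lborel)"
    unfolding integral_mult_right_zero[symmetric] by (rule ennreal_norm_integral_le)
  also have "\<dots> \<le> (\<integral>\<^sup>+x. (\<integral>\<^sup>+y. ennreal (cmod (a x * (cnj (a y) * of_real (n (x - y))))) \<partial>lborel) \<partial>lborel)"
    by (intro nn_integral_mono ennreal_norm_integral_le)
  also have "\<dots> \<le> (\<integral>\<^sup>+x. (\<integral>\<^sup>+y. ennreal ((cmod (a x))\<^sup>2 / 2) * ennreal (n (x - y)) + ennreal ((cmod (a y))\<^sup>2 / 2) * ennreal (n (x - y)) \<partial>lborel) \<partial>lborel)"
  proof (intro nn_integral_mono)
    fix x y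
    have "cmod (a x * (cnj (a y) * of_real (n (x - y)))) = (cmod (a x) * cmod (a y)) * n (x - y)"
      using n0 by (simp add: norm_mult)
    also have "\<dots> \<le> ((cmod (a x))\<^sup>2 / 2 + (cmod (a y))\<^sup>2 / 2) * n (x - y)"
      using sum_squares_bound[of "cmod (a x)" "cmod (a y)"] by (intro mult_right_mono n0) simp
    finally show "ennreal (cmod (a x * (cnj (a y) * of_real (n (x - y)))))
      \<le> ennreal ((cmod (a x))\<^sup>2 / 2) * ennreal (n (x - y)) + ennreal ((cmod (a y))\<^sup>2 / 2) * ennreal (n (x - y))"
      using n0 by (simp add: ennreal_leI flip: ennreal_mult ennreal_plus) (simp add: algebra_simps)
  qed
  also have "\<dots> = (\<integral>\<^sup>+x. (\<integral>\<^sup>+y. ennreal ((cmod (a x))\<^sup>2 / 2) * ennreal (n (x - y)) \<partial>lborel) \<partial>lborel)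
     + (\<integral>\<^sup>+x. (\<integral>\<^sup>+y. ennreal ((cmod (a y))\<^sup>2 / 2) * ennreal (n (x - y)) \<partial>lborel) \<partial>lborel)"
    by (simp add: nn_integral_add)
  also have "(\<integral>\<^sup>+x. (\<integral>\<^sup>+y. ennreal ((cmod (a y))\<^sup>2 / 2) * ennreal (n (x - y)) \<partial>lborel) \<partial>lborel)
     = (\<integral>\<^sup>+y. (\<integral>\<^sup>+x. ennreal ((cmod (a y))\<^sup>2 / 2) * ennreal (n (x - y)) \<partial>lborel) \<partial>lborel)"
    by (rule lborel_pair.Fubini') measurable
  also have "(\<integral>\<^sup>+x. (\<integral>\<^sup>+y. ennreal ((cmod (a x))\<^sup>2 / 2) * ennreal (n (x - y)) \<partial>lborel) \<partial>lborel)
     + (\<integral>\<^sup>+y. (\<integral>\<^sup>+x. ennreal ((cmod (a y))\<^sup>2 / 2) * ennreal (n (x - y)) \<partial>lborel) \<partial>lborel)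
     = (\<integral>\<^sup>+x. ennreal ((cmod (a x))\<^sup>2 / 2) \<partial>lborel) + (\<integral>\<^sup>+x. ennreal ((cmod (a x))\<^sup>2 / 2) \<partial>lborel)"
    by (simp add: nn_integral_cmult nn_integral_normal_density_shift[OF \<epsilon>, folded n_def])
  also have "\<dots> = (\<integral>\<^sup>+x. ennreal ((cmod (a x))\<^sup>2 / 2) + ennreal ((cmod (a x))\<^sup>2 / 2) \<partial>lborel)"
    by (simp add: nn_integral_add)
  also have "\<dots> = sq_norm a"
    unfolding sq_norm_def by (simp flip: ennreal_plus)
  finally show ?thesis unfolding F_def by (simp add: mult_left_mono)
qed

lemma gauss_tendsto_1: "(\<lambda>n. gauss (1 / real (Suc n)) \<xi>) \<longlonglongrightarrow> 1"
proof -
  have "(\<lambda>n. 1 / real (Suc n)) \<longlonglongrightarrow> 0"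
    using LIMSEQ_inverse_real_of_nat by (simp add: inverse_eq_divide)
  then have "(\<lambda>n. exp (- (1 / real (Suc n) * \<xi>)\<^sup>2 / 2)) \<longlonglongrightarrow> exp (- (0 * \<xi>)\<^sup>2 / 2)"
    by (intro tendsto_intros) simp_all
  then show ?thesis by (simp add: gauss_def)
qed

text \<open>The Gaussian weights tend to 1 pointwise while the bound stays fixed, so Fatou's lemma
  applies. An inequality is enough here, which is why no convergence of the mollified functions has
  to be shown.\<close>

theorem fourier_bessel:
  assumes a: "integrable lborel a"
  shows "sq_norm (fourier a) \<le> ennreal (2 * pi) * sq_norm a"
  unfolding sq_norm_def[of "fourier a"]
proof (rule nn_integral_le_of_tendsto)
  have [measurable]: "a \<in> borel_measurable borel" using a by auto
  have [measurable]: "fourier a \<in> borel_measurable borel"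
    using borel_measurable_fourier[of a "\<lambda>x. x" borel] by simp
  show "(\<lambda>\<xi>. ennreal ((cmod (fourier a \<xi>))\<^sup>2 * gauss (1 / real (Suc n)) \<xi>)) \<in> borel_measurable lborel" for n
    by measurable
  have "(\<lambda>n. ennreal ((cmod (fourier a \<xi>))\<^sup>2 * gauss (1 / real (Suc n)) \<xi>)) \<longlonglongrightarrow> ennreal ((cmod (fourier a \<xi>))\<^sup>2 * 1)" for \<xi>
    by (intro tendsto_ennrealI tendsto_mult tendsto_const gauss_tendsto_1)
  then show "AE \<xi> in lborel. (\<lambda>n. ennreal ((cmod (fourier a \<xi>))\<^sup>2 * gauss (1 / real (Suc n)) \<xi>)) \<longlonglongrightarrow> ennreal ((cmod (fourier a \<xi>))\<^sup>2)"
    by simp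
  show "\<forall>\<^sub>F n in sequentially. (\<integral>\<^sup>+\<xi>. ennreal ((cmod (fourier a \<xi>))\<^sup>2 * gauss (1 / real (Suc n)) \<xi>) \<partial>lborel) \<le> ennreal (2 * pi) * sq_norm a"
    by (intro always_eventually allI gauss_weighted_energy_le[OF a]) simp
qed

text \<open>The substitution \<open>y = x - \<epsilon> s\<close> fixes the density and moves the
  scale into the argument of \<tau>; dominated convergence with majorant
  \<open>B * std_normal_density s\<close> finishes.\<close>

lemma normal_density_approximate_identity:
  fixes \<tau> :: "real \<Rightarrow> complex"
  assumes cont: "continuous_on UNIV \<tau>" and B: "\<And>y. cmod (\<tau> y) \<le> B"
  shows "(\<lambda>n. \<integral>y. \<tau> y * of_real (normal_density 0 (1 / real (Suc n)) (x - y)) \<partial>lborel) \<longlonglongrightarrow> \<tau> x"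
proof -
  have [measurable]: "\<tau> \<in> borel_measurable borel" using cont by (rule borel_measurable_continuous_onI)
  define \<epsilon> where "\<epsilon> n = 1 / real (Suc n)" for n
  have \<epsilon>: "\<epsilon> n > 0" for n by (simp add: \<epsilon>_def)
  have eq: "(\<integral>y. \<tau> y * of_real (normal_density 0 (\<epsilon> n) (x - y)) \<partial>lborel)
     = (\<integral>s. \<tau> (x - \<epsilon> n * s) * of_real (std_normal_density s) \<partial>lborel)" for n
  proof -
    have nd: "\<epsilon> n * normal_density 0 (\<epsilon> n) (\<epsilon> n * s) = std_normal_density s" for s
      using \<epsilon>[of n] by (simp add: normal_density_def real_sqrt_mult power_mult_distrib)
    have "(\<integral>y. \<tau> y * of_real (normal_density 0 (\<epsilon> n) (x - y)) \<partial>lborel)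
      = \<bar>- \<epsilon> n\<bar> *\<^sub>R (\<integral>s. \<tau> (x + (- \<epsilon> n) * s) * of_real (normal_density 0 (\<epsilon> n) (x - (x + (- \<epsilon> n) * s))) \<partial>lborel)"
      using \<epsilon>[of n] by (intro lborel_integral_real_affine) auto
    also have "\<dots> = (\<integral>s. \<bar>- \<epsilon> n\<bar> *\<^sub>R (\<tau> (x + (- \<epsilon> n) * s) * of_real (normal_density 0 (\<epsilon> n) (x - (x + (- \<epsilon> n) * s)))) \<partial>lborel)"
      by (rule integral_scaleR_right[symmetric])
    also have "\<dots> = (\<integral>s. \<tau> (x - \<epsilon> n * s) * of_real (std_normal_density s) \<partial>lborel)"
      using \<epsilon>[of n] by (intro Bochner_Integration.integral_cong) (auto simp: scaleR_conv_of_real mult_ac simp flip: nd)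
    finally show ?thesis .
  qed
  have "(\<lambda>n. \<integral>s. \<tau> (x - \<epsilon> n * s) * of_real (std_normal_density s) \<partial>lborel) \<longlonglongrightarrow> (\<integral>s. \<tau> x * of_real (std_normal_density s) \<partial>lborel)"
  proof (rule integral_dominated_convergence)
    show "integrable lborel (\<lambda>s. B * std_normal_density s)" by simp
    have "\<epsilon> \<longlonglongrightarrow> 0"
      using LIMSEQ_inverse_real_of_nat by (simp add: inverse_eq_divide \<epsilon>_def[abs_def])
    then have "(\<lambda>n. x - \<epsilon> n * s) \<longlonglongrightarrow> x - 0 * s" for s by (intro tendsto_intros)
    then have "(\<lambda>n. \<tau> (x - \<epsilon> n * s)) \<longlonglongrightarrow> \<tau> x" for s
      using cont by (intro isCont_tendsto_compose[of x \<tau>]) (auto simp: continuous_on_eq_continuous_at)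
    then show "AE s in lborel. (\<lambda>n. \<tau> (x - \<epsilon> n * s) * of_real (std_normal_density s)) \<longlonglongrightarrow> \<tau> x * of_real (std_normal_density s)"
      by (intro AE_I2 tendsto_mult tendsto_const)
    show "AE s in lborel. norm (\<tau> (x - \<epsilon> n * s) * of_real (std_normal_density s)) \<le> B * std_normal_density s" for n
      using B by (intro AE_I2) (auto simp: norm_mult intro!: mult_right_mono)
  qed measurable
  also have "(\<integral>s. \<tau> x * of_real (std_normal_density s) \<partial>lborel) = \<tau> x"
    by (simp add: integral_complex_of_real)
  finally show ?thesis unfolding eq[symmetric] unfolding \<epsilon>_def .
qed

text \<open>Both sides of \<open>fourier_gauss_bilinear\<close> converge as the Gaussian disappears:
  the left one because the product of the transforms is integrable, the right one because \<tau> is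
  continuous and bounded. Reflecting one transform keeps the relation bilinear, without
  conjugates.\<close>

theorem fourier_parseval:
  assumes a: "integrable lborel a" and t: "integrable lborel \<tau>"
    and cont: "continuous_on UNIV \<tau>" and B: "\<And>y. cmod (\<tau> y) \<le> B"
    and int: "integrable lborel (\<lambda>\<xi>. fourier a \<xi> * fourier \<tau> (- \<xi>))"
  shows "(\<integral>\<xi>. fourier a \<xi> * fourier \<tau> (- \<xi>) \<partial>lborel) = of_real (2 * pi) * (\<integral>x. a x * \<tau> x \<partial>lborel)"
proof (rule LIMSEQ_unique)
  have [measurable]: "a \<in> borel_measurable borel" "\<tau> \<in> borel_measurable borel" using a t by auto
  have m1 [measurable]: "fourier a \<in> borel_measurable borel"
    using borel_measurable_fourier[of a "\<lambda>x. x" borel] by simp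
  have m2 [measurable]: "(\<lambda>\<xi>. fourier \<tau> (- \<xi>)) \<in> borel_measurable borel"
    by (rule borel_measurable_fourier) measurable
  define \<epsilon> where "\<epsilon> n = 1 / real (Suc n)" for n
  have \<epsilon>: "\<epsilon> n > 0" for n by (simp add: \<epsilon>_def)
  have B0: "B \<ge> 0" using B[of 0] norm_ge_zero order.trans by blast
  define J where "J n x = (\<integral>y. \<tau> y * of_real (normal_density 0 (\<epsilon> n) (x - y)) \<partial>lborel)" for n x
  have [measurable]: "J n \<in> borel_measurable borel" for n unfolding J_def[abs_def] by measurable
  have J: "cmod (J n x) \<le> B" for n x
  proof -
    have "ennreal (cmod (J n x)) \<le> (\<integral>\<^sup>+y. ennreal (cmod (\<tau> y * of_real (normal_density 0 (\<epsilon> n) (x - y)))) \<partial>lborel)"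
      unfolding J_def by (rule ennreal_norm_integral_le)
    also have "\<dots> \<le> (\<integral>\<^sup>+y. ennreal B * ennreal (normal_density 0 (\<epsilon> n) (x - y)) \<partial>lborel)"
      using B B0 by (intro nn_integral_mono) (auto simp: norm_mult intro!: ennreal_leI mult_right_mono simp flip: ennreal_mult)
    also have "\<dots> = ennreal B" using nn_integral_normal_density_shift(1)[OF \<epsilon>, of n x] by (simp add: nn_integral_cmult)
    finally show ?thesis using B0 by simp
  qed
  show "(\<lambda>n. \<integral>\<xi>. fourier a \<xi> * (fourier \<tau> (- \<xi>) * of_real (gauss (\<epsilon> n) \<xi>)) \<partial>lborel) \<longlonglongrightarrow> (\<integral>\<xi>. fourier a \<xi> * fourier \<tau> (- \<xi>) \<partial>lborel)"
  proof (rule integral_dominated_convergence)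
    show "integrable lborel (\<lambda>\<xi>. norm (fourier a \<xi> * fourier \<tau> (- \<xi>)))" using int by simp
    have "(\<lambda>n. fourier a \<xi> * (fourier \<tau> (- \<xi>) * of_real (gauss (\<epsilon> n) \<xi>))) \<longlonglongrightarrow> fourier a \<xi> * (fourier \<tau> (- \<xi>) * of_real 1)" for \<xi>
      unfolding \<epsilon>_def by (intro tendsto_intros gauss_tendsto_1)
    then show "AE \<xi> in lborel. (\<lambda>n. fourier a \<xi> * (fourier \<tau> (- \<xi>) * of_real (gauss (\<epsilon> n) \<xi>))) \<longlonglongrightarrow> fourier a \<xi> * fourier \<tau> (- \<xi>)"
      by simp
    have "cmod (fourier a \<xi>) * cmod (fourier \<tau> (- \<xi>)) * gauss (\<epsilon> n) \<xi> \<le> cmod (fourier a \<xi>) * cmod (fourier \<tau> (- \<xi>))" for n \<xi>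
      using gauss_bounds[of "\<epsilon> n" \<xi>] by (intro mult_left_le) auto
    then show "AE \<xi> in lborel. norm (fourier a \<xi> * (fourier \<tau> (- \<xi>) * of_real (gauss (\<epsilon> n) \<xi>))) \<le> norm (fourier a \<xi> * fourier \<tau> (- \<xi>))" for n
      using gauss_bounds(1)[of "\<epsilon> n", THEN less_imp_le] by (simp add: norm_mult mult.assoc)
  qed measurable
  have "(\<lambda>n. \<integral>x. a x * J n x \<partial>lborel) \<longlonglongrightarrow> (\<integral>x. a x * \<tau> x \<partial>lborel)"
  proof (rule integral_dominated_convergence)
    show "integrable lborel (\<lambda>x. norm (a x) * B)" using a by simp
    show "AE x in lborel. (\<lambda>n. a x * J n x) \<longlonglongrightarrow> a x * \<tau> x"
      unfolding J_def \<epsilon>_def by (intro AE_I2 tendsto_mult tendsto_const normal_density_approximate_identity[OF cont B])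
    show "AE x in lborel. norm (a x * J n x) \<le> norm (a x) * B" for n
      using J by (intro AE_I2) (auto simp: norm_mult intro!: mult_left_mono)
  qed measurable
  then have "(\<lambda>n. of_real (2 * pi) * (\<integral>x. a x * J n x \<partial>lborel)) \<longlonglongrightarrow> of_real (2 * pi) * (\<integral>x. a x * \<tau> x \<partial>lborel)"
    by (intro tendsto_mult tendsto_const)
  then show "(\<lambda>n. \<integral>\<xi>. fourier a \<xi> * (fourier \<tau> (- \<xi>) * of_real (gauss (\<epsilon> n) \<xi>)) \<partial>lborel) \<longlonglongrightarrow> of_real (2 * pi) * (\<integral>x. a x * \<tau> x \<partial>lborel)"
    unfolding fourier_gauss_bilinear[OF a t \<epsilon>] J_def .
qed

section \<open>Square-integrable functions\<close>

lemma nn_integral_mult_squared_le: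
  assumes [measurable]: "f \<in> borel_measurable borel" "g \<in> borel_measurable borel"
  shows "(\<integral>\<^sup>+x. ennreal (cmod (f x * g x)) \<partial>lborel)\<^sup>2 \<le> sq_norm f * sq_norm g"
  using Cauchy_Schwarz_nn_integral[of "\<lambda>x. ennreal (cmod (f x))" lborel "\<lambda>x. ennreal (cmod (g x))"]
  unfolding sq_norm_def by (simp add: norm_mult ennreal_mult ennreal_power)

lemma integrable_mult_of_sq_norm:
  assumes [measurable]: "f \<in> borel_measurable borel" "g \<in> borel_measurable borel"
    and fin: "sq_norm f < \<infinity>" "sq_norm g < \<infinity>"
  shows "integrable lborel (\<lambda>x. f x * g x)"
proof (rule integrableI_bounded)
  have "(\<integral>\<^sup>+x. ennreal (cmod (f x * g x)) \<partial>lborel)\<^sup>2 < \<infinity>"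
    using nn_integral_mult_squared_le[of f g] fin by (auto simp: ennreal_mult_less_top intro: le_less_trans)
  then show "(\<integral>\<^sup>+x. ennreal (norm (f x * g x)) \<partial>lborel) < \<infinity>"
    by (simp add: power2_eq_square ennreal_mult_less_top less_top[symmetric] ennreal_mult_eq_top_iff)
qed measurable

lemma sq_norm_zero [simp]: "sq_norm (\<lambda>x. 0) = 0"
  by (simp add: sq_norm_def)

lemma sq_norm_mono: "(\<And>x. cmod (f x) \<le> cmod (g x)) \<Longrightarrow> sq_norm f \<le> sq_norm g"
  unfolding sq_norm_def by (intro nn_integral_mono ennreal_leI power_mono) auto

lemma sq_norm_minus_commute: "sq_norm (\<lambda>x. f x - g x) = sq_norm (\<lambda>x. g x - f x)"
  by (simp add: sq_norm_def norm_minus_commute)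

lemma sq_norm_cmult:
  assumes [measurable]: "f \<in> borel_measurable borel"
  shows "sq_norm (\<lambda>x. c * f x) = ennreal ((cmod c)\<^sup>2) * sq_norm f"
  unfolding sq_norm_def by (simp add: norm_mult power_mult_distrib ennreal_mult nn_integral_cmult)

lemma sq_norm_reflect:
  assumes [measurable]: "f \<in> borel_measurable borel"
  shows "sq_norm (\<lambda>x. f (- x)) = sq_norm f"
  unfolding sq_norm_def
  using nn_integral_real_affine[of "\<lambda>x. ennreal ((cmod (f x))\<^sup>2)" "-1" 0] by simp

text \<open>Cauchy-Schwarz for \<open>F n - f\<close> against \<open>g\<close>.\<close>

lemma tendsto_integral_mult_of_sq_norm:
  fixes F :: "nat \<Rightarrow> real \<Rightarrow> complex"
  assumes [measurable]: "\<And>n. F n \<in> borel_measurable borel" "f \<in> borel_measurable borel" "g \<in> borel_measurable borel"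
    and f: "sq_norm f < \<infinity>" and g: "sq_norm g < \<infinity>"
    and lim: "(\<lambda>n. sq_norm (\<lambda>x. F n x - f x)) \<longlonglongrightarrow> 0"
  shows "(\<lambda>n. \<integral>x. F n x * g x \<partial>lborel) \<longlonglongrightarrow> (\<integral>x. f x * g x \<partial>lborel)"
proof -
  define e where "e n = (\<integral>x. (F n x - f x) * g x \<partial>lborel)" for n
  have "(\<lambda>n. ennreal ((cmod (e n))\<^sup>2)) \<longlonglongrightarrow> 0"
  proof (rule tendsto_sandwich[OF _ _ tendsto_const])
    have "(\<lambda>n. sq_norm g * sq_norm (\<lambda>x. F n x - f x)) \<longlonglongrightarrow> sq_norm g * 0"
      using g by (intro ennreal_tendsto_cmult lim) auto
    then show "(\<lambda>n. sq_norm (\<lambda>x. F n x - f x) * sq_norm g) \<longlonglongrightarrow> 0" by (simp add: mult.commute)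
    have "ennreal ((cmod (e n))\<^sup>2) \<le> sq_norm (\<lambda>x. F n x - f x) * sq_norm g" for n
    proof -
      have "ennreal ((cmod (e n))\<^sup>2) = (ennreal (cmod (e n)))\<^sup>2" by (simp add: ennreal_power)
      also have "\<dots> \<le> (\<integral>\<^sup>+x. ennreal (cmod ((F n x - f x) * g x)) \<partial>lborel)\<^sup>2"
        unfolding e_def by (intro power_mono ennreal_norm_integral_le) auto
      also have "\<dots> \<le> sq_norm (\<lambda>x. F n x - f x) * sq_norm g"
        by (intro nn_integral_mult_squared_le) measurable
      finally show ?thesis .
    qed
    then show "\<forall>\<^sub>F n in sequentially. ennreal ((cmod (e n))\<^sup>2) \<le> sq_norm (\<lambda>x. F n x - f x) * sq_norm g"
      by simp
  qed simp
  then have "(\<lambda>n. (cmod (e n))\<^sup>2) \<longlonglongrightarrow> 0" by (simp add: ennreal_tendsto_0_iff)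
  then have "(\<lambda>n. sqrt ((cmod (e n))\<^sup>2)) \<longlonglongrightarrow> sqrt 0" by (intro tendsto_real_sqrt)
  then have e: "e \<longlonglongrightarrow> 0" by (simp add: tendsto_norm_zero_iff)
  \<comment> \<open>The distance may be infinite for finitely many \<open>n\<close>, where integrals
    could take the default value 0; linearity of the integral is therefore used only
    eventually.\<close>
  have "\<forall>\<^sub>F n in sequentially. sq_norm (\<lambda>x. F n x - f x) < \<infinity>"
    using order_tendstoD(2)[OF lim, of \<infinity>] by simp
  then have "\<forall>\<^sub>F n in sequentially. e n + (\<integral>x. f x * g x \<partial>lborel) = (\<integral>x. F n x * g x \<partial>lborel)"
  proof eventually_elim
    case (elim n)
    have "integrable lborel (\<lambda>x. (F n x - f x) * g x)" using elim g by (intro integrable_mult_of_sq_norm) auto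
    moreover have "integrable lborel (\<lambda>x. f x * g x)" using f g by (intro integrable_mult_of_sq_norm) auto
    ultimately have "e n + (\<integral>x. f x * g x \<partial>lborel) = (\<integral>x. (F n x - f x) * g x + f x * g x \<partial>lborel)"
      unfolding e_def by simp
    then show ?case by (simp add: algebra_simps)
  qed
  moreover have "(\<lambda>n. e n + (\<integral>x. f x * g x \<partial>lborel)) \<longlonglongrightarrow> 0 + (\<integral>x. f x * g x \<partial>lborel)"
    by (intro tendsto_add e tendsto_const)
  ultimately show ?thesis by (simp add: filterlim_cong)
qed

text \<open>The terms of a convergent series are eventually below 1, which bounds \<open>d k\<close>
  by the geometric sequence \<open>2^(-k/2)\<close>.\<close>

lemma summable_of_weighted_squares:
  fixes d :: "nat \<Rightarrow> complex"
  assumes "(\<Sum>k. ennreal (2 ^ k * (cmod (d k))\<^sup>2)) \<noteq> \<infinity>"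
  shows "summable d"
proof -
  have "summable (\<lambda>k. 2 ^ k * (cmod (d k))\<^sup>2)"
    using assms by (intro summable_suminf_not_top) auto
  then have "(\<lambda>k. 2 ^ k * (cmod (d k))\<^sup>2) \<longlonglongrightarrow> 0" by (rule summable_LIMSEQ_zero)
  then have ev: "\<forall>\<^sub>F k in sequentially. 2 ^ k * (cmod (d k))\<^sup>2 < 1" by (rule order_tendstoD) simp
  show ?thesis
  proof (rule summable_comparison_test_ev)
    show "\<forall>\<^sub>F k in sequentially. norm (d k) \<le> sqrt (1 / 2) ^ k"
      using ev
    proof eventually_elim
      case (elim k)
      then have "(cmod (d k))\<^sup>2 \<le> (1 / 2) ^ k" by (simp add: field_simps)
      then have "cmod (d k) \<le> sqrt ((1 / 2) ^ k)" by (rule real_le_rsqrt)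
      then show ?case by (simp add: real_sqrt_power)
    qed
    have "sqrt (1 / 2) < 1" by simp
    then show "summable (\<lambda>k. sqrt (1 / 2) ^ k)" by (intro summable_geometric) simp
  qed
qed

text \<open>The Riesz-Fischer theorem by a rapidly converging subsequence. The modulus
  \<open>T\<close> passes to the limit by Fatou's lemma; this is used later to read off a norm bound
  for the limit.\<close>

theorem sq_norm_complete:
  fixes h :: "nat \<Rightarrow> real \<Rightarrow> complex" and T :: "nat \<Rightarrow> ennreal"
  assumes [measurable]: "\<And>n. h n \<in> borel_measurable borel"
    and T: "T \<longlonglongrightarrow> 0" and cauchy: "\<And>n m. n \<le> m \<Longrightarrow> sq_norm (\<lambda>x. h m x - h n x) \<le> T n"
  obtains H where "H \<in> borel_measurable borel" "\<And>n. sq_norm (\<lambda>x. H x - h n x) \<le> T n"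
proof -
  have "\<exists>N. \<forall>n\<ge>N. T n \<le> ennreal ((1/4) ^ k)" for k
  proof -
    have "\<forall>\<^sub>F n in sequentially. T n < ennreal ((1/4) ^ k)" by (rule order_tendstoD[OF T]) simp
    then show ?thesis unfolding eventually_sequentially by (meson less_imp_le)
  qed
  then obtain N where N: "\<And>k n. n \<ge> N k \<Longrightarrow> T n \<le> ennreal ((1/4) ^ k)" by metis
  \<comment> \<open>A nondecreasing choice that is above \<open>N k\<close> and above
    \<open>k\<close>. Successive distances are then at most \<open>(1/4)^k\<close>, which leaves
    \<open>(1/2)^k\<close> after weighting with \<open>2^k\<close>.\<close>
  define r where "r k = k + (\<Sum>i\<le>k. N i)" for k
  have rN: "r k \<ge> N k" for k unfolding r_def using member_le_sum[of k "{..k}" N] by simp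
  have r_mono: "r k \<le> r (Suc k)" for k by (simp add: r_def)
  have r_id: "r k \<ge> k" for k by (simp add: r_def)
  define d where "d k x = h (r (Suc k)) x - h (r k) x" for k x
  have [measurable]: "d k \<in> borel_measurable borel" for k unfolding d_def[abs_def] by measurable
  have d: "sq_norm (d k) \<le> ennreal ((1/4) ^ k)" for k
    unfolding d_def[abs_def] by (rule order.trans[OF cauchy[OF r_mono] N[OF rN]])
  have "(\<integral>\<^sup>+x. (\<Sum>k. ennreal (2 ^ k * (cmod (d k x))\<^sup>2)) \<partial>lborel) = (\<Sum>k. (\<integral>\<^sup>+x. ennreal (2 ^ k * (cmod (d k x))\<^sup>2) \<partial>lborel))"
    by (rule nn_integral_suminf) measurable
  also have "\<dots> \<le> (\<Sum>k. ennreal ((1/2) ^ k))"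
  proof (intro suminf_le summableI)
    fix k
    have "(\<integral>\<^sup>+x. ennreal (2 ^ k * (cmod (d k x))\<^sup>2) \<partial>lborel) = ennreal (2 ^ k) * sq_norm (d k)"
      unfolding sq_norm_def by (simp add: ennreal_mult nn_integral_cmult)
    also have "\<dots> \<le> ennreal (2 ^ k) * ennreal ((1/4) ^ k)" by (intro mult_left_mono d) auto
    also have "\<dots> = ennreal ((1/2) ^ k)"
      by (simp flip: ennreal_mult power_mult_distrib)
    finally show "(\<integral>\<^sup>+x. ennreal (2 ^ k * (cmod (d k x))\<^sup>2) \<partial>lborel) \<le> ennreal ((1/2) ^ k)" .
  qed
  also have "\<dots> = ennreal (\<Sum>k. (1/2) ^ k)"
    by (intro suminf_ennreal2) (auto intro: summable_geometric)
  also have "\<dots> < \<infinity>" by simp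
  finally have "AE x in lborel. (\<Sum>k. ennreal (2 ^ k * (cmod (d k x))\<^sup>2)) \<noteq> \<infinity>"
    by (intro nn_integral_PInf_AE) auto
  then have conv: "AE x in lborel. convergent (\<lambda>k. h (r k) x)"
  proof eventually_elim
    case (elim x)
    then have "summable (\<lambda>k. d k x)" by (rule summable_of_weighted_squares)
    then have "(\<lambda>n. \<Sum>k<n. d k x) \<longlonglongrightarrow> (\<Sum>k. d k x)" by (rule summable_LIMSEQ)
    moreover have "(\<Sum>k<n. d k x) = h (r n) x - h (r 0) x" for n
      unfolding d_def by (rule sum_lessThan_telescope)
    ultimately have "(\<lambda>n. h (r n) x - h (r 0) x + h (r 0) x) \<longlonglongrightarrow> (\<Sum>k. d k x) + h (r 0) x"
      by (intro tendsto_add tendsto_const) simp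
    then show ?case by (auto simp: convergent_def)
  qed
  \<comment> \<open>On the null set where the subsequence diverges the value of \<open>lim\<close>
    does not matter; measurability holds everywhere.\<close>
  define H where "H x = lim (\<lambda>k. h (r k) x)" for x
  show thesis
  proof (rule that)
    show [measurable]: "H \<in> borel_measurable borel" unfolding H_def[abs_def] by measurable
    show "sq_norm (\<lambda>x. H x - h n x) \<le> T n" for n
      unfolding sq_norm_def
    proof (rule nn_integral_le_of_tendsto)
      show "AE x in lborel. (\<lambda>k. ennreal ((cmod (h (r k) x - h n x))\<^sup>2)) \<longlonglongrightarrow> ennreal ((cmod (H x - h n x))\<^sup>2)"
        using conv
      proof eventually_elim
        case (elim x)
        then have "(\<lambda>k. h (r k) x) \<longlonglongrightarrow> H x" unfolding H_def by (simp add: convergent_LIMSEQ_iff)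
        then show ?case by (intro tendsto_ennrealI tendsto_intros)
      qed
      show "\<forall>\<^sub>F k in sequentially. (\<integral>\<^sup>+x. ennreal ((cmod (h (r k) x - h n x))\<^sup>2) \<partial>lborel) \<le> T n"
        using eventually_ge_at_top[of n]
      proof eventually_elim
        case (elim k)
        then show ?case using cauchy[of n "r k"] r_id[of k] by (simp add: sq_norm_def)
      qed
    qed measurable
  qed
qed

section \<open>Test functions and weak derivatives\<close>

text \<open>A function that vanishes near a point has derivative 0 there, so differentiation does
  not enlarge the closed support.\<close>

lemma test_function_funpow_deriv:
  assumes "test_function \<rho>" shows "test_function ((deriv ^^ k) \<rho>)"
proof (induction k)
  case (Suc k)
  define \<tau> where "\<tau> = (deriv ^^ k) \<rho>"
  have \<tau>: "test_function \<tau>" using Suc by (simp add: \<tau>_def)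
  have "{x. deriv \<tau> x \<noteq> 0} \<subseteq> closure {x. \<tau> x \<noteq> 0}"
  proof
    fix x assume x: "x \<in> {x. deriv \<tau> x \<noteq> 0}"
    show "x \<in> closure {x. \<tau> x \<noteq> 0}"
    proof (rule ccontr)
      assume "x \<notin> closure {x. \<tau> x \<noteq> 0}"
      then have "\<forall>\<^sub>F y in nhds x. y \<in> - closure {x. \<tau> x \<noteq> 0}"
        by (intro eventually_nhds_in_open) auto
      then have "\<forall>\<^sub>F y in nhds x. \<tau> y = 0"
        by (rule eventually_mono) (use closure_subset[of "{x. \<tau> x \<noteq> 0}"] in auto)
      then have "deriv \<tau> x = deriv (\<lambda>y. 0) x" by (intro deriv_cong_ev) auto
      then show False using x by simp
    qed
  qed
  then have "closure {x. deriv \<tau> x \<noteq> 0} \<subseteq> closure {x. \<tau> x \<noteq> 0}" by (rule closure_minimal) simp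
  then have "compact (closure {x. deriv \<tau> x \<noteq> 0})"
    using \<tau> unfolding test_function_def by (metis closed_closure compact_Int_closed inf.absorb_iff2)
  moreover have "(deriv ^^ i) (deriv \<tau>) differentiable (at x)" for i x
  proof -
    have "(deriv ^^ Suc i) \<tau> differentiable (at x)" using \<tau> unfolding test_function_def by blast
    then show ?thesis by (simp add: funpow_swap1)
  qed
  ultimately have "test_function (deriv \<tau>)" unfolding test_function_def by blast
  then show ?case by (simp add: \<tau>_def)
qed (use assms in simp)

lemma test_function_DERIV:
  assumes "test_function \<rho>" shows "(\<rho> has_real_derivative deriv \<rho> x) (at x)"
proof -
  have "(deriv ^^ 0) \<rho> differentiable (at x)" using assms unfolding test_function_def by blast
  then show ?thesis
    by (simp add: DERIV_deriv_iff_real_differentiable)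
qed

lemma test_function_continuous:
  assumes "test_function \<rho>" shows "continuous_on UNIV \<rho>"
  using DERIV_continuous_on[of UNIV \<rho> "deriv \<rho>"] test_function_DERIV[OF assms] by simp

lemma test_function_support:
  assumes "test_function \<rho>" obtains R where "R > 0" "\<And>x. R \<le> \<bar>x\<bar> \<Longrightarrow> \<rho> x = 0"
proof -
  have "bounded (closure {x. \<rho> x \<noteq> 0})" using assms by (simp add: test_function_def compact_imp_bounded)
  then obtain B where B: "\<And>x. x \<in> closure {x. \<rho> x \<noteq> 0} \<Longrightarrow> norm x \<le> B" by (auto simp: bounded_iff)
  show thesis
  proof (rule that[of "max B 0 + 1"])
    fix x :: real assume "max B 0 + 1 \<le> \<bar>x\<bar>"
    then show "\<rho> x = 0" using B[of x] closure_subset[of "{x. \<rho> x \<noteq> 0}"] by fastforce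
  qed simp
qed

lemma test_function_bounded:
  assumes "test_function \<rho>" obtains B where "\<And>x. \<bar>\<rho> x\<bar> \<le> B" "B \<ge> 0"
proof -
  obtain R where R: "R > 0" "\<And>x. R \<le> \<bar>x\<bar> \<Longrightarrow> \<rho> x = 0" using test_function_support[OF assms] by blast
  have "compact (\<rho> ` {-R..R})"
    by (intro compact_continuous_image continuous_on_subset[OF test_function_continuous[OF assms]]) auto
  then have "\<exists>B. \<forall>x\<in>{-R..R}. \<bar>\<rho> x\<bar> \<le> B"
    using compact_imp_bounded[of "\<rho> ` {-R..R}"] by (simp add: bounded_iff)
  then obtain B where B: "\<And>x. x \<in> {-R..R} \<Longrightarrow> \<bar>\<rho> x\<bar> \<le> B" by blast
  show thesis
  proof (rule that)
    show "B \<ge> 0" using B[of 0] R by auto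
    then show "\<bar>\<rho> x\<bar> \<le> B" for x using B[of x] R(2)[of x] by (cases "R \<le> \<bar>x\<bar>") (auto simp: abs_le_iff not_le abs_less_iff)
  qed
qed

lemma test_function_measurable: "test_function \<rho> \<Longrightarrow> \<rho> \<in> borel_measurable borel"
  by (intro borel_measurable_continuous_onI test_function_continuous)

lemma test_function_integrable:
  assumes "test_function \<rho>" shows "integrable lborel \<rho>"
proof -
  obtain R where R: "R > 0" "\<And>x. R \<le> \<bar>x\<bar> \<Longrightarrow> \<rho> x = 0" using test_function_support[OF assms] by blast
  have "integrable lborel (\<lambda>x. indicator {-R..R} x *\<^sub>R \<rho> x)"
    by (intro borel_integrable_compact continuous_on_subset[OF test_function_continuous[OF assms]]) auto
  moreover have "(\<lambda>x. indicator {-R..R} x *\<^sub>R \<rho> x) = \<rho>"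
    using R(2) by (force simp: fun_eq_iff indicator_def)
  ultimately show ?thesis by simp
qed

lemma test_function_sq_norm:
  assumes "test_function \<rho>" shows "sq_norm (\<lambda>x. of_real (\<rho> x)) < \<infinity>"
proof -
  obtain B where B: "\<And>x. \<bar>\<rho> x\<bar> \<le> B" "B \<ge> 0" using test_function_bounded[OF assms] by blast
  have "sq_norm (\<lambda>x. of_real (\<rho> x)) \<le> (\<integral>\<^sup>+x. ennreal B * ennreal \<bar>\<rho> x\<bar> \<partial>lborel)"
    unfolding sq_norm_def
  proof (intro nn_integral_mono)
    fix x
    have "\<bar>\<rho> x\<bar> * \<bar>\<rho> x\<bar> \<le> B * \<bar>\<rho> x\<bar>" using B by (intro mult_right_mono) auto
    then show "ennreal ((cmod (of_real (\<rho> x)))\<^sup>2) \<le> ennreal B * ennreal \<bar>\<rho> x\<bar>"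
      using B by (simp add: power2_eq_square ennreal_leI flip: ennreal_mult)
  qed
  also have "\<dots> = ennreal B * (\<integral>\<^sup>+x. ennreal \<bar>\<rho> x\<bar> \<partial>lborel)"
    using test_function_measurable[OF assms] by (intro nn_integral_cmult) auto
  also have "\<dots> < \<infinity>"
    using test_function_integrable[OF assms] by (auto simp: integrable_iff_bounded ennreal_mult_less_top)
  finally show ?thesis .
qed

text \<open>Integration by parts: the derivative of kernel times \<rho> integrates to 0 over an
  interval at whose ends \<rho> vanishes.\<close>

lemma fourier_deriv_test_function:
  assumes \<rho>: "test_function \<rho>"
  shows "fourier (\<lambda>x. of_real (deriv \<rho> x)) \<xi> = \<i> * of_real \<xi> * fourier (\<lambda>x. of_real (\<rho> x)) \<xi>"
proof -
  have \<rho>': "test_function (deriv \<rho>)" using test_function_funpow_deriv[OF \<rho>, of 1] by simp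
  obtain R1 where R1: "R1 > 0" "\<And>x. R1 \<le> \<bar>x\<bar> \<Longrightarrow> \<rho> x = 0" using test_function_support[OF \<rho>] by blast
  obtain R2 where R2: "R2 > 0" "\<And>x. R2 \<le> \<bar>x\<bar> \<Longrightarrow> deriv \<rho> x = 0" using test_function_support[OF \<rho>'] by blast
  define R where "R = max R1 R2"
  define E where "E x = exp (- \<i> * of_real \<xi> * of_real x)" for x
  define F where "F x = E x * of_real (\<rho> x)" for x
  define F' where "F' x = E x * of_real (deriv \<rho> x) - \<i> * of_real \<xi> * (E x * of_real (\<rho> x))" for x
  have E: "(E has_vector_derivative - \<i> * of_real \<xi> * E x) (at x)" for x
    unfolding E_def by (auto intro!: derivative_eq_intros has_vector_derivative_real_field simp: algebra_simps)
  have F: "(F has_vector_derivative F' x) (at x)" for x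
  proof -
    have "((\<lambda>x. of_real (\<rho> x) :: complex) has_vector_derivative of_real (deriv \<rho> x)) (at x)"
      using test_function_DERIV[OF \<rho>, of x]
      by (intro has_vector_derivative_of_real) (simp add: has_real_derivative_iff_has_vector_derivative)
    from has_vector_derivative_mult[OF E this] show ?thesis
      unfolding F_def F'_def by (simp add: algebra_simps)
  qed
  have contE: "continuous_on S E" for S unfolding E_def by (intro continuous_intros)
  have c\<rho>: "continuous_on S \<rho>" for S by (rule continuous_on_subset[OF test_function_continuous[OF \<rho>]]) simp
  have c\<rho>': "continuous_on S (deriv \<rho>)" for S by (rule continuous_on_subset[OF test_function_continuous[OF \<rho>']]) simp
  have "(\<integral>x. indicator {-R..R} x *\<^sub>R F' x \<partial>lborel) = F R - F (-R)"
  proof (rule integral_FTC_Icc)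
    show "- R \<le> R" using R1 by (simp add: R_def)
    show "(F has_vector_derivative F' x) (at x within {-R..R})" for x
      by (rule has_vector_derivative_at_within[OF F])
    show "continuous_on {-R..R} F'" unfolding F'_def by (intro continuous_intros contE c\<rho> c\<rho>')
  qed
  also have "\<dots> = 0" using R1(1) R1(2)[of R] R1(2)[of "-R"] by (simp add: F_def R_def)
  also have "(\<lambda>x. indicator {-R..R} x *\<^sub>R F' x) = F'"
  proof
    fix x show "indicator {-R..R} x *\<^sub>R F' x = F' x"
      using R1(2)[of x] R2(2)[of x] by (cases "R \<le> \<bar>x\<bar>") (auto simp: indicator_def F'_def R_def)
  qed
  finally have "(\<integral>x. F' x \<partial>lborel) = 0" .
  moreover have "integrable lborel (\<lambda>x. E x * of_real (deriv \<rho> x))"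
    unfolding E_def by (intro integrable_fourier_kernel_mult integrable_of_real test_function_integrable \<rho>')
  moreover have "integrable lborel (\<lambda>x. E x * of_real (\<rho> x))"
    unfolding E_def by (intro integrable_fourier_kernel_mult integrable_of_real test_function_integrable \<rho>)
  ultimately show ?thesis
    unfolding F'_def fourier_def E_def[symmetric] by simp
qed

lemma fourier_funpow_deriv_test_function:
  assumes \<rho>: "test_function \<rho>"
  shows "fourier (\<lambda>x. of_real ((deriv ^^ k) \<rho> x)) \<xi> = (\<i> * of_real \<xi>) ^ k * fourier (\<lambda>x. of_real (\<rho> x)) \<xi>"
proof (induction k)
  case (Suc k)
  show ?case using fourier_deriv_test_function[OF test_function_funpow_deriv[OF \<rho>, of k]] Suc by simp
qed simp

section \<open>Fourier-Plancherel transforms and the construction of weak derivatives\<close>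

lemma borel_measurable_of_L2 [dest]: "f \<in> L2 \<Longrightarrow> f \<in> borel_measurable borel"
  by (simp add: L2_def)

lemma sq_norm_of_L2:
  assumes "f \<in> L2" shows "sq_norm f < \<infinity>"
  using assms by (simp add: L2_def sq_norm_def integrable_iff_bounded)

lemma fourier_sq_norm_finite:
  assumes "integrable lborel a" "sq_norm a < \<infinity>" shows "sq_norm (fourier a) < \<infinity>"
  using fourier_bessel[OF assms(1)] assms(2) by (auto intro: le_less_trans simp: ennreal_mult_less_top)

lemma integrable_of_sq_norm_indicator:
  assumes [measurable]: "f \<in> borel_measurable borel" and f: "sq_norm f < \<infinity>"
  shows "integrable lborel (\<lambda>x. indicator {a..b::real} x *\<^sub>R f x)"
proof -
  have "sq_norm (\<lambda>x. indicator {a..b} x) = (\<integral>\<^sup>+x. indicator {a..b} x \<partial>lborel)"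
    unfolding sq_norm_def by (intro nn_integral_cong) (auto split: split_indicator)
  also have "\<dots> < \<infinity>" using emeasure_bounded_finite[of "{a..b}"] by simp
  finally show ?thesis
    using integrable_mult_of_sq_norm[of "indicator {a..b}" f] f
    by (simp add: scaleR_conv_of_real of_real_indicator)
qed

text \<open>Truncations of \<open>f\<close> are both integrable and square-integrable, so
  \<open>fourier_parseval\<close> applies to them. The frequency side converges by the very
  definition of the transform, the other side by dominated convergence.\<close>

lemma has_L2_fourier_parseval:
  assumes fg: "has_L2_fourier f g" and \<rho>: "test_function \<rho>"
  shows "(\<integral>\<xi>. g \<xi> * fourier (\<lambda>x. of_real (\<rho> x)) (- \<xi>) \<partial>lborel) = of_real (2 * pi) * (\<integral>x. f x * of_real (\<rho> x) \<partial>lborel)"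
proof (rule LIMSEQ_unique)
  define \<tau> :: "real \<Rightarrow> complex" where "\<tau> x = of_real (\<rho> x)" for x
  have f: "f \<in> L2" and g: "g \<in> L2" using fg by (auto simp: has_L2_fourier_def)
  note [measurable] = borel_measurable_of_L2[OF f] borel_measurable_of_L2[OF g] test_function_measurable[OF \<rho>]
  have \<tau>: "integrable lborel \<tau>" unfolding \<tau>_def using test_function_integrable[OF \<rho>] by simp
  have \<tau>2: "sq_norm \<tau> < \<infinity>" unfolding \<tau>_def by (rule test_function_sq_norm[OF \<rho>])
  have \<tau>_m [measurable]: "\<tau> \<in> borel_measurable borel" unfolding \<tau>_def by measurable
  obtain B where B: "\<And>x. \<bar>\<rho> x\<bar> \<le> B" using test_function_bounded[OF \<rho>] by blast
  define F where "F n x = indicator {- real n..real n} x *\<^sub>R f x" for n :: nat and x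
  have [measurable]: "F n \<in> borel_measurable borel" for n unfolding F_def by measurable
  have F: "integrable lborel (F n)" for n
    unfolding F_def by (intro integrable_of_sq_norm_indicator sq_norm_of_L2 f) measurable
  have F2: "sq_norm (F n) < \<infinity>" for n
    by (rule le_less_trans[OF sq_norm_mono sq_norm_of_L2[OF f]]) (auto simp: F_def split: split_indicator)
  have mF [measurable]: "fourier (F n) \<in> borel_measurable borel" for n
    using borel_measurable_fourier[of "F n" "\<lambda>x. x" borel] by simp
  have mT [measurable]: "fourier \<tau> \<in> borel_measurable borel"
    using borel_measurable_fourier[of \<tau> "\<lambda>x. x" borel] by simp
  have mT' [measurable]: "(\<lambda>\<xi>. fourier \<tau> (- \<xi>)) \<in> borel_measurable borel"
    by (rule borel_measurable_fourier) measurable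
  have T2: "sq_norm (\<lambda>\<xi>. fourier \<tau> (- \<xi>)) < \<infinity>"
    using sq_norm_reflect[OF mT] fourier_sq_norm_finite[OF \<tau> \<tau>2] by simp
  have eq: "(\<integral>\<xi>. fourier (F n) \<xi> * fourier \<tau> (- \<xi>) \<partial>lborel) = of_real (2 * pi) * (\<integral>x. F n x * \<tau> x \<partial>lborel)" for n
  proof (rule fourier_parseval[OF F \<tau>])
    show "continuous_on UNIV \<tau>" unfolding \<tau>_def by (intro continuous_intros test_function_continuous[OF \<rho>])
    show "cmod (\<tau> y) \<le> B" for y using B by (simp add: \<tau>_def)
    show "integrable lborel (\<lambda>\<xi>. fourier (F n) \<xi> * fourier \<tau> (- \<xi>))"
      by (rule integrable_mult_of_sq_norm[OF mF mT' fourier_sq_norm_finite[OF F F2] T2])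
  qed
  have "((\<lambda>R. sq_norm (\<lambda>\<xi>. g \<xi> - fourier (\<lambda>x. indicator {-R..R} x *\<^sub>R f x) \<xi>)) \<longlongrightarrow> 0) at_top"
    using fg by (simp add: has_L2_fourier_def sq_norm_def)
  from filterlim_compose[OF this filterlim_real_sequentially]
  have "(\<lambda>n. sq_norm (\<lambda>\<xi>. fourier (F n) \<xi> - g \<xi>)) \<longlonglongrightarrow> 0"
    by (subst sq_norm_minus_commute) (simp add: F_def[abs_def])
  then show "(\<lambda>n. \<integral>\<xi>. fourier (F n) \<xi> * fourier \<tau> (- \<xi>) \<partial>lborel) \<longlonglongrightarrow> (\<integral>\<xi>. g \<xi> * fourier (\<lambda>x. of_real (\<rho> x)) (- \<xi>) \<partial>lborel)"
    unfolding \<tau>_def[symmetric]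
    by (intro tendsto_integral_mult_of_sq_norm[OF mF _ mT' sq_norm_of_L2[OF g] T2]) measurable
  have "(\<lambda>n. \<integral>x. F n x * \<tau> x \<partial>lborel) \<longlonglongrightarrow> (\<integral>x. f x * \<tau> x \<partial>lborel)"
  proof (rule integral_dominated_convergence)
    show "integrable lborel (\<lambda>x. norm (f x * \<tau> x))"
      by (intro integrable_norm integrable_mult_of_sq_norm sq_norm_of_L2[OF f] \<tau>2) measurable
    show "AE x in lborel. (\<lambda>n. F n x * \<tau> x) \<longlonglongrightarrow> f x * \<tau> x"
    proof (intro AE_I2 tendsto_eventually)
      fix x
      show "\<forall>\<^sub>F n in sequentially. F n x * \<tau> x = f x * \<tau> x"
        using eventually_ge_at_top[of "nat \<lceil>\<bar>x\<bar>\<rceil>"]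
        by eventually_elim (auto simp: F_def indicator_def nat_le_iff ceiling_le_iff)
    qed
    show "AE x in lborel. norm (F n x * \<tau> x) \<le> norm (f x * \<tau> x)" for n
      by (intro AE_I2) (auto simp: F_def split: split_indicator)
  qed measurable
  then have "(\<lambda>n. of_real (2 * pi) * (\<integral>x. F n x * \<tau> x \<partial>lborel)) \<longlonglongrightarrow> of_real (2 * pi) * (\<integral>x. f x * \<tau> x \<partial>lborel)"
    by (intro tendsto_mult tendsto_const)
  then show "(\<lambda>n. \<integral>\<xi>. fourier (F n) \<xi> * fourier \<tau> (- \<xi>) \<partial>lborel) \<longlonglongrightarrow> of_real (2 * pi) * (\<integral>x. f x * of_real (\<rho> x) \<partial>lborel)"
    unfolding eq \<tau>_def[symmetric] .
qed

lemma sq_norm_tail_tendsto_0: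
  assumes [measurable]: "p \<in> borel_measurable borel" and p: "sq_norm p < \<infinity>"
  shows "(\<lambda>n. sq_norm (\<lambda>\<xi>. indicator (- {- real n<..<real n}) \<xi> *\<^sub>R p \<xi>)) \<longlonglongrightarrow> 0"
proof -
  have "(\<lambda>n. \<integral>\<^sup>+\<xi>. ennreal ((cmod (indicator (- {- real n<..<real n}) \<xi> *\<^sub>R p \<xi>))\<^sup>2) \<partial>lborel) \<longlonglongrightarrow> (\<integral>\<^sup>+\<xi>. 0 \<partial>(lborel :: real measure))"
  proof (rule nn_integral_dominated_convergence[where w = "\<lambda>\<xi>. ennreal ((cmod (p \<xi>))\<^sup>2)"])
    show "(\<integral>\<^sup>+x. ennreal ((cmod (p x))\<^sup>2) \<partial>lborel) < \<infinity>" using p by (simp add: sq_norm_def)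
    show "AE x in lborel. (\<lambda>i. ennreal ((cmod (indicator (- {- real i<..<real i}) x *\<^sub>R p x))\<^sup>2)) \<longlonglongrightarrow> 0"
    proof (intro AE_I2 tendsto_eventually)
      fix x :: real
      obtain N :: nat where N: "\<bar>x\<bar> < real N" using reals_Archimedean2 by blast
      show "\<forall>\<^sub>F i in sequentially. ennreal ((cmod (indicator (- {- real i<..<real i}) x *\<^sub>R p x))\<^sup>2) = 0"
        using eventually_ge_at_top[of N]
      proof eventually_elim
        case (elim i)
        then have "\<bar>x\<bar> < real i" using N by linarith
        then show ?case by (simp add: indicator_def abs_less_iff)
      qed
    qed
    show "AE x in lborel. ennreal ((cmod (indicator (- {- real j<..<real j}) x *\<^sub>R p x))\<^sup>2) \<le> ennreal ((cmod (p x))\<^sup>2)" for j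
      by (intro AE_I2) (auto split: split_indicator)
  qed measurable
  then show ?thesis by (simp add: sq_norm_def)
qed

text \<open>The weak derivative is built as the inverse transform of
  \<open>(\<i> \<xi>)^k * g\<close>. Inverse transforms of its truncations form a Cauchy sequence by
  the Bessel inequality, and pairing their limit with test functions identifies it by means of
  Parseval.\<close>

theorem weak_deriv_from_fourier:
  fixes f :: "real \<Rightarrow> real"
  assumes fg: "has_L2_fourier (\<lambda>x. of_real (f x)) g" and fin: "sq_norm (\<lambda>\<xi>. (\<i> * of_real \<xi>) ^ k * g \<xi>) < \<infinity>"
  obtains H :: "real \<Rightarrow> real" where "H \<in> borel_measurable borel"
    "sq_norm (\<lambda>x. of_real (H x)) \<le> ennreal (1 / (2 * pi)) * sq_norm (\<lambda>\<xi>. (\<i> * of_real \<xi>) ^ k * g \<xi>)"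
    "\<And>\<rho>. test_function \<rho> \<Longrightarrow> (\<integral>x. (deriv ^^ k) \<rho> x * f x \<partial>lborel) = (-1) ^ k * (\<integral>x. \<rho> x * H x \<partial>lborel)"
proof -
  have f: "(\<lambda>x. of_real (f x) :: complex) \<in> L2" and g: "g \<in> L2" using fg by (auto simp: has_L2_fourier_def)
  note [measurable] = borel_measurable_of_L2[OF g]
  define p where "p \<xi> = (\<i> * of_real \<xi>) ^ k * g \<xi>" for \<xi>
  have pm [measurable]: "p \<in> borel_measurable borel" unfolding p_def by measurable
  have p: "sq_norm p < \<infinity>" using fin by (simp add: p_def[abs_def])
  \<comment> \<open>The open interval is empty for \<open>n = 0\<close>, so \<open>a 0\<close> and
    \<open>h 0\<close> vanish and the norm bound for the limit is the case \<open>n = 0\<close> of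
    the error estimate.\<close>
  define a where "a n \<xi> = indicator {- real n<..<real n} \<xi> *\<^sub>R p \<xi>" for n :: nat and \<xi>
  have am [measurable]: "a n \<in> borel_measurable borel" for n unfolding a_def by measurable
  have a: "integrable lborel (a n)" for n
  proof (rule Bochner_Integration.integrable_bound[OF integrable_of_sq_norm_indicator[OF pm p, of "- real n" "real n"]])
    show "AE x in lborel. norm (a n x) \<le> norm (indicator {- real n..real n} x *\<^sub>R p x)"
      by (intro AE_I2) (auto simp: a_def split: split_indicator)
  qed simp
  have fa [measurable]: "(\<lambda>x. fourier (a n) (- x)) \<in> borel_measurable borel" for n
    by (rule borel_measurable_fourier) measurable
  \<comment> \<open>The inverse transform is the transform at the reflected point, divided by
    \<open>2 * pi\<close>; with the Bessel constant this leaves \<open>1 / (2 * pi)\<close> in front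
    of the squared norms.\<close>
  define h where "h n x = of_real (1 / (2 * pi)) * fourier (a n) (- x)" for n x
  have hm [measurable]: "h n \<in> borel_measurable borel" for n unfolding h_def by measurable
  define T where "T n = ennreal (1 / (2 * pi)) * sq_norm (\<lambda>\<xi>. indicator (- {- real n<..<real n}) \<xi> *\<^sub>R p \<xi>)" for n :: nat
  have "T \<longlonglongrightarrow> ennreal (1 / (2 * pi)) * 0"
    unfolding T_def by (intro ennreal_tendsto_cmult sq_norm_tail_tendsto_0 p) auto
  then have T: "T \<longlonglongrightarrow> 0" by simp
  have cauchy: "sq_norm (\<lambda>x. h m x - h n x) \<le> T n" if "n \<le> m" for n m
  proof -
    define b where "b \<xi> = a m \<xi> - a n \<xi>" for \<xi>
    have bm [measurable]: "b \<in> borel_measurable borel" unfolding b_def by measurable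
    have b: "integrable lborel b" unfolding b_def using a by simp
    have fb [measurable]: "fourier b \<in> borel_measurable borel"
      using borel_measurable_fourier[of b "\<lambda>x. x" borel] by simp
    have "fourier b \<xi> = fourier (a m) \<xi> - fourier (a n) \<xi>" for \<xi>
      unfolding fourier_def b_def right_diff_distrib
      by (intro Bochner_Integration.integral_diff integrable_fourier_kernel_mult a)
    then have "(\<lambda>x. h m x - h n x) = (\<lambda>x. of_real (1 / (2 * pi)) * fourier b (- x))"
      by (simp add: h_def fun_eq_iff diff_divide_distrib)
    then have "sq_norm (\<lambda>x. h m x - h n x) = ennreal ((cmod (of_real (1 / (2 * pi))))\<^sup>2) * sq_norm (fourier b)"
      using sq_norm_cmult[of "\<lambda>x. fourier b (- x)" "of_real (1 / (2 * pi))"] sq_norm_reflect[OF fb] by simp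
    also have "\<dots> \<le> ennreal ((1 / (2 * pi))\<^sup>2) * (ennreal (2 * pi) * sq_norm b)"
      unfolding norm_of_real using fourier_bessel[OF b] by (simp add: mult_left_mono)
    also have "\<dots> = ennreal (1 / (2 * pi)) * sq_norm b"
    proof -
      have "(1 / (2 * pi))\<^sup>2 * (2 * pi) = 1 / (2 * pi)" by (simp add: power2_eq_square)
      then show ?thesis by (simp add: mult.assoc[symmetric] flip: ennreal_mult)
    qed
    also have "\<dots> \<le> T n"
      unfolding T_def using that
      by (intro mult_left_mono sq_norm_mono) (auto simp: b_def a_def split: split_indicator)
    finally show ?thesis .
  qed
  obtain H where H [measurable]: "H \<in> borel_measurable borel" and Hn: "\<And>n. sq_norm (\<lambda>x. H x - h n x) \<le> T n"
    using sq_norm_complete[OF hm T cauchy] by blast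
  have h0: "h 0 x = 0" for x by (simp add: h_def a_def fourier_def)
  have H2: "sq_norm H \<le> ennreal (1 / (2 * pi)) * sq_norm p"
  proof -
    have "sq_norm H \<le> T 0" using Hn[of 0] by (simp add: h0)
    also have "\<dots> \<le> ennreal (1 / (2 * pi)) * sq_norm p"
      unfolding T_def by (intro mult_left_mono sq_norm_mono) auto
    finally show ?thesis .
  qed
  also have "\<dots> < \<infinity>" using p by (simp add: ennreal_mult_less_top)
  finally have Hfin: "sq_norm H < \<infinity>" .
  have hlim: "(\<lambda>n. sq_norm (\<lambda>x. h n x - H x)) \<longlonglongrightarrow> 0"
    by (rule tendsto_sandwich[OF _ _ tendsto_const T])
       (use Hn in \<open>auto simp: sq_norm_minus_commute[of "h _" H]\<close>)
  have key: "(\<integral>x. of_real ((deriv ^^ k) \<rho> x) * of_real (f x) \<partial>lborel) = (-1) ^ k * (\<integral>x. H x * of_real (\<rho> x) \<partial>lborel)"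
    if \<rho>: "test_function \<rho>" for \<rho>
  proof -
    define r :: "real \<Rightarrow> complex" where "r x = of_real (\<rho> x)" for x
    have rm [measurable]: "r \<in> borel_measurable borel" unfolding r_def using test_function_measurable[OF \<rho>] by measurable
    have r: "integrable lborel r" unfolding r_def using test_function_integrable[OF \<rho>] by simp
    have r2: "sq_norm r < \<infinity>" unfolding r_def by (rule test_function_sq_norm[OF \<rho>])
    have fr [measurable]: "fourier r \<in> borel_measurable borel"
      using borel_measurable_fourier[of r "\<lambda>x. x" borel] by simp
    have frm [measurable]: "(\<lambda>\<xi>. fourier r (- \<xi>)) \<in> borel_measurable borel"
      by (rule borel_measurable_fourier) measurable
    have fr2: "sq_norm (\<lambda>\<xi>. fourier r (- \<xi>)) < \<infinity>"
      using sq_norm_reflect[OF fr] fourier_sq_norm_finite[OF r r2] by simp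
    have rr: "integrable lborel (\<lambda>x. r (- x))"
      using lborel_integrable_real_affine[OF r, of "-1" 0] by simp
    have hn: "(\<integral>x. h n x * r x \<partial>lborel) = of_real (1 / (2 * pi)) * (\<integral>\<xi>. a n \<xi> * fourier r (- \<xi>) \<partial>lborel)" for n
    proof -
      have "(\<integral>x. h n x * r x \<partial>lborel) = (\<integral>x. of_real (1 / (2 * pi)) * (fourier (a n) (- x) * r x) \<partial>lborel)"
        by (simp only: h_def mult.assoc)
      also have "\<dots> = of_real (1 / (2 * pi)) * (\<integral>x. fourier (a n) (- x) * r x \<partial>lborel)"
        by (rule integral_mult_right_zero)
      also have "(\<integral>x. fourier (a n) (- x) * r x \<partial>lborel) = (\<integral>x. fourier (a n) x * r (- x) \<partial>lborel)"
        using lborel_integral_real_affine[of "-1" "\<lambda>x. fourier (a n) (- x) * r x" 0] by simp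
      also have "\<dots> = (\<integral>\<xi>. a n \<xi> * fourier (\<lambda>x. r (- x)) \<xi> \<partial>lborel)"
        by (rule fourier_multiplication_formula[OF a rr])
      finally show ?thesis by (simp only: fourier_reflect)
    qed
    have "(\<lambda>n. \<integral>\<xi>. a n \<xi> * fourier r (- \<xi>) \<partial>lborel) \<longlonglongrightarrow> (\<integral>\<xi>. p \<xi> * fourier r (- \<xi>) \<partial>lborel)"
    proof (rule tendsto_integral_mult_of_sq_norm[OF am pm frm p fr2])
      have "(\<lambda>x. cmod (a n x - p x)) = (\<lambda>x. cmod (indicator (- {- real n<..<real n}) x *\<^sub>R p x))" for n
        by (auto simp: a_def fun_eq_iff split: split_indicator)
      then have "sq_norm (\<lambda>x. a n x - p x) = sq_norm (\<lambda>\<xi>. indicator (- {- real n<..<real n}) \<xi> *\<^sub>R p \<xi>)" for n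
        unfolding sq_norm_def by metis
      then show "(\<lambda>n. sq_norm (\<lambda>x. a n x - p x)) \<longlonglongrightarrow> 0" using sq_norm_tail_tendsto_0[OF pm p] by simp
    qed
    then have "(\<lambda>n. \<integral>x. h n x * r x \<partial>lborel) \<longlonglongrightarrow> of_real (1 / (2 * pi)) * (\<integral>\<xi>. p \<xi> * fourier r (- \<xi>) \<partial>lborel)"
      unfolding hn by (intro tendsto_mult tendsto_const)
    moreover have "(\<lambda>n. \<integral>x. h n x * r x \<partial>lborel) \<longlonglongrightarrow> (\<integral>x. H x * r x \<partial>lborel)"
      by (rule tendsto_integral_mult_of_sq_norm[OF hm H rm Hfin r2 hlim])
    ultimately have "(\<integral>x. H x * r x \<partial>lborel) = of_real (1 / (2 * pi)) * (\<integral>\<xi>. p \<xi> * fourier r (- \<xi>) \<partial>lborel)"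
      by (rule LIMSEQ_unique[symmetric])
    \<comment> \<open>The transform of the test function is taken at \<open>- \<xi>\<close>, where
      its k-th derivative has the multiplier \<open>(- \<i> \<xi>)^k\<close>; this produces the sign
      of the weak derivative.\<close>
    also have "(\<lambda>\<xi>. p \<xi> * fourier r (- \<xi>)) = (\<lambda>\<xi>. (-1) ^ k * (g \<xi> * fourier (\<lambda>x. of_real ((deriv ^^ k) \<rho> x)) (- \<xi>)))"
    proof
      fix \<xi> :: real
      have "(\<i> * of_real \<xi>) ^ k = (-1) ^ k * (\<i> * of_real (- \<xi>)) ^ k"
        unfolding power_mult_distrib[symmetric] by simp
      then show "p \<xi> * fourier r (- \<xi>) = (-1) ^ k * (g \<xi> * fourier (\<lambda>x. of_real ((deriv ^^ k) \<rho> x)) (- \<xi>))"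
        unfolding fourier_funpow_deriv_test_function[OF \<rho>] p_def r_def by (simp add: mult_ac)
    qed
    also have "(\<integral>\<xi>. (-1) ^ k * (g \<xi> * fourier (\<lambda>x. of_real ((deriv ^^ k) \<rho> x)) (- \<xi>)) \<partial>lborel)
      = (-1) ^ k * (of_real (2 * pi) * (\<integral>x. of_real (f x) * of_real ((deriv ^^ k) \<rho> x) \<partial>lborel))"
      unfolding has_L2_fourier_parseval[OF fg test_function_funpow_deriv[OF \<rho>], symmetric] by (rule integral_mult_right_zero)
    finally have "(\<integral>x. H x * r x \<partial>lborel) = (-1) ^ k * (\<integral>x. of_real (f x) * of_real ((deriv ^^ k) \<rho> x) \<partial>lborel)"
      by simp
    then have "(-1) ^ k * (\<integral>x. H x * r x \<partial>lborel) = ((-1) ^ k * (-1) ^ k) * (\<integral>x. of_real (f x) * of_real ((deriv ^^ k) \<rho> x) \<partial>lborel)"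
      by (simp only: mult.assoc)
    also have "(-1) ^ k * (-1) ^ k = (1 :: complex)" by (simp flip: power_mult_distrib)
    finally show ?thesis unfolding r_def by (simp add: mult.commute)
  qed
  show thesis
  proof (rule that)
    \<comment> \<open>The limit is complex-valued a priori. As \<open>f\<close> and the test
      functions are real, its real part satisfies the same relation with no larger norm.\<close>
    show "(\<lambda>x. Re (H x)) \<in> borel_measurable borel" by measurable
    have "sq_norm (\<lambda>x. of_real (Re (H x))) \<le> sq_norm H"
      by (intro sq_norm_mono) (simp add: abs_Re_le_cmod)
    also note H2
    finally show "sq_norm (\<lambda>x. of_real (Re (H x))) \<le> ennreal (1 / (2 * pi)) * sq_norm (\<lambda>\<xi>. (\<i> * of_real \<xi>) ^ k * g \<xi>)"
      unfolding p_def .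
    fix \<rho> assume \<rho>: "test_function \<rho>"
    have "integrable lborel (\<lambda>x. H x * of_real (\<rho> x))"
      using test_function_measurable[OF \<rho>] by (intro integrable_mult_of_sq_norm Hfin test_function_sq_norm[OF \<rho>]) auto
    from integral_bounded_linear[OF bounded_linear_Re this]
    have Re_H: "Re (\<integral>x. H x * of_real (\<rho> x) \<partial>lborel) = (\<integral>x. \<rho> x * Re (H x) \<partial>lborel)"
      by (simp add: mult.commute)
    have "(\<integral>x. of_real ((deriv ^^ k) \<rho> x) * of_real (f x) \<partial>lborel) = complex_of_real (\<integral>x. (deriv ^^ k) \<rho> x * f x \<partial>lborel)"
      by (simp flip: of_real_mult)
    then have "complex_of_real (\<integral>x. (deriv ^^ k) \<rho> x * f x \<partial>lborel) = of_real ((-1) ^ k) * (\<integral>x. H x * of_real (\<rho> x) \<partial>lborel)"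
      using key[OF \<rho>] by simp
    then have "(\<integral>x. (deriv ^^ k) \<rho> x * f x \<partial>lborel) = Re (of_real ((-1) ^ k) * (\<integral>x. H x * of_real (\<rho> x) \<partial>lborel))"
      by (metis Re_complex_of_real)
    then show "(\<integral>x. (deriv ^^ k) \<rho> x * f x \<partial>lborel) = (-1) ^ k * (\<integral>x. \<rho> x * Re (H x) \<partial>lborel)"
      unfolding Re_H[symmetric] by simp
  qed
qed

text \<open>This family is closed under differentiation, and for \<open>P = 1\<close>, \<open>n = 0\<close> it tends to the indicator of
  \<open>(a, b)\<close> as \<open>\<delta> \<rightarrow> 0\<close>.\<close>

definition bump :: "real \<Rightarrow> real \<Rightarrow> real \<Rightarrow> real poly \<Rightarrow> nat \<Rightarrow> real \<Rightarrow> real" where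
  "bump a b \<delta> P n x = (if a < x \<and> x < b
     then poly P x / ((x - a) * (b - x)) ^ n * exp (- \<delta> / ((x - a) * (b - x))) else 0)"

section \<open>Smoothness of the bumps, and functions orthogonal to all test functions\<close>

lemma has_real_derivative_0_of_quadratic_bound:
  fixes F :: "real \<Rightarrow> real"
  assumes "\<And>x. \<bar>F x\<bar> \<le> C * (x - p)\<^sup>2"
  shows "(F has_real_derivative 0) (at p)"
proof -
  have F0: "F p = 0" using assms[of p] by simp
  have "((\<lambda>h. (F (p + h) - F p) / h) \<longlongrightarrow> 0) (at 0)"
  proof (rule Lim_null_comparison)
    show "\<forall>\<^sub>F h in at 0. norm ((F (p + h) - F p) / h) \<le> C * \<bar>h\<bar>"
    proof (rule eventually_at_filter[THEN iffD2], intro always_eventually allI impI)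
      fix h :: real assume h: "h \<noteq> 0"
      have "\<bar>F (p + h)\<bar> / \<bar>h\<bar> \<le> C * h\<^sup>2 / \<bar>h\<bar>" using assms[of "p + h"] by (intro divide_right_mono) auto
      also have "C * h\<^sup>2 / \<bar>h\<bar> = C * \<bar>h\<bar>" using h by (simp add: power2_eq_square abs_if)
      finally show "norm ((F (p + h) - F p) / h) \<le> C * \<bar>h\<bar>" by (simp add: F0)
    qed
    have "((\<lambda>h. C * \<bar>h\<bar>) \<longlongrightarrow> C * \<bar>0\<bar>) (at 0)" by (intro tendsto_intros)
    then show "((\<lambda>h. C * \<bar>h\<bar>) \<longlongrightarrow> 0) (at 0)" by simp
  qed
  then show ?thesis by (simp add: DERIV_def)
qed

text \<open>One term of the exponential series. It serves both for the flatness of the bumps and for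
  trading decay against derivatives.\<close>

lemma power_le_fact_exp:
  assumes "(x :: real) \<ge> 0" shows "x ^ m \<le> fact m * exp x"
proof -
  have "(\<Sum>n\<in>{m}. x ^ n /\<^sub>R fact n) \<le> (\<Sum>n. x ^ n /\<^sub>R fact n)"
    using assms by (intro sum_le_suminf summable_exp_generic) auto
  also have "\<dots> = exp x" by (simp add: exp_def)
  finally have "x ^ m / fact m \<le> exp x" by (simp add: divide_inverse mult.commute)
  then show ?thesis by (simp add: field_simps)
qed

text \<open>Near the endpoints the exponential beats every power of
  \<open>s = (x - a) * (b - x)\<close>, so the pole is harmless and a factor \<open>s^2\<close>
  remains, where \<open>s\<close> is at most \<open>b - a\<close> times the distance to either
  endpoint.\<close>

lemma bump_quadratic_bound:
  assumes \<delta>: "\<delta> > 0" and p: "p \<in> {a, b}"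
  obtains C where "\<And>x. \<bar>bump a b \<delta> P n x\<bar> \<le> C * (x - p)\<^sup>2"
proof -
  have "compact (poly P ` {a..b})" by (intro compact_continuous_image continuous_intros) auto
  then have "\<exists>B. \<forall>x\<in>{a..b}. \<bar>poly P x\<bar> \<le> B"
    using compact_imp_bounded[of "poly P ` {a..b}"] by (simp add: bounded_iff)
  then obtain B where B: "\<And>x. x \<in> {a..b} \<Longrightarrow> \<bar>poly P x\<bar> \<le> B" by blast
  \<comment> \<open>Of these powers of \<open>s\<close>, \<open>n\<close> cancel the pole and two
    are left for the quadratic bound.\<close>
  define m where "m = n + 2"
  define K where "K = fact m / \<delta> ^ m"
  have K: "K > 0" using \<delta> by (simp add: K_def)
  show thesis
  proof (rule that)
    fix x
    show "\<bar>bump a b \<delta> P n x\<bar> \<le> \<bar>B\<bar> * K * (b - a)\<^sup>2 * (x - p)\<^sup>2"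
    proof (cases "a < x \<and> x < b")
      case True
      define s where "s = (x - a) * (b - x)"
      have s: "s > 0" using True by (simp add: s_def)
      have "(\<delta> / s) ^ m * exp (- \<delta> / s) \<le> fact m * exp (\<delta> / s) * exp (- \<delta> / s)"
        using \<delta> s by (intro mult_right_mono power_le_fact_exp) auto
      also have "\<dots> = fact m" by (simp add: mult.assoc flip: exp_add)
      finally have "exp (- \<delta> / s) \<le> K * s ^ m"
        using \<delta> s by (simp add: K_def power_divide field_simps)
      then have "exp (- \<delta> / s) / s ^ n \<le> K * s ^ m / s ^ n" using s by (intro divide_right_mono) auto
      also have "\<dots> = K * s\<^sup>2" using s by (simp add: m_def power_add power2_eq_square)
      finally have 1: "exp (- \<delta> / s) / s ^ n \<le> K * s\<^sup>2" .
      have "\<bar>bump a b \<delta> P n x\<bar> = \<bar>poly P x\<bar> * (exp (- \<delta> / s) / s ^ n)"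
        using True s by (simp add: bump_def s_def[symmetric] abs_mult)
      also have "\<dots> \<le> \<bar>B\<bar> * (K * s\<^sup>2)"
        using 1 B[of x] True s by (intro mult_mono) auto
      also have "s\<^sup>2 \<le> ((b - a) * \<bar>x - p\<bar>)\<^sup>2"
      proof (rule power_mono)
        have "(x - a) * (b - x) \<le> (x - a) * (b - a)" "(b - x) * (x - a) \<le> (b - x) * (b - a)"
          using True by (auto intro!: mult_left_mono)
        then show "s \<le> (b - a) * \<bar>x - p\<bar>" using p True by (auto simp: s_def mult.commute)
      qed (use s in simp)
      finally show ?thesis using K by (simp add: mult_left_mono power_mult_distrib mult.assoc)
    next
      case False
      then show ?thesis using K by (auto simp: bump_def)
    qed
  qed
qed

text \<open>The derivative of the exponent is \<delta> times \<open>S' / S^2\<close>, which raises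
  the order of the pole by 2, and the quotient rule is brought to that denominator. At the endpoints
  the quadratic bound gives derivative 0, in agreement with the value of the new bump there.\<close>

lemma bump_has_real_derivative:
  assumes \<delta>: "\<delta> > 0" and ab: "a < b"
  defines "S \<equiv> [:- a, 1:] * [:b, - 1:]"
  shows "(bump a b \<delta> P n has_real_derivative
    bump a b \<delta> (pderiv P * S\<^sup>2 - of_nat n * P * pderiv S * S + smult \<delta> (P * pderiv S)) (n + 2) x) (at x)"
proof -
  consider "a < x \<and> x < b" | "x < a \<or> b < x" | "x \<in> {a, b}" by force
  then show ?thesis
  proof cases
    case 1
    have S: "poly S y = (y - a) * (b - y)" for y by (simp add: S_def algebra_simps)
    define q where "q y = poly P y / (poly S y) ^ n * exp (- \<delta> / poly S y)" for y
    have s: "poly S x > 0" using 1 by (simp add: S)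
    have "(q has_real_derivative ((poly (pderiv P) x * poly S x ^ n - poly P x * (real n * poly S x ^ (n - 1) * poly (pderiv S) x)) / (poly S x ^ n * poly S x ^ n)
       * exp (- \<delta> / poly S x) + poly P x / (poly S x) ^ n * (exp (- \<delta> / poly S x) * (\<delta> * poly (pderiv S) x / (poly S x * poly S x))))) (at x)"
      unfolding q_def using s by (auto intro!: derivative_eq_intros simp: field_simps)
    also have "(poly (pderiv P) x * poly S x ^ n - poly P x * (real n * poly S x ^ (n - 1) * poly (pderiv S) x)) / (poly S x ^ n * poly S x ^ n)
       * exp (- \<delta> / poly S x) + poly P x / (poly S x) ^ n * (exp (- \<delta> / poly S x) * (\<delta> * poly (pderiv S) x / (poly S x * poly S x)))
       = bump a b \<delta> (pderiv P * S\<^sup>2 - of_nat n * P * pderiv S * S + smult \<delta> (P * pderiv S)) (n + 2) x"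
    proof -
      have n1: "real n * poly S x ^ (n - 1) * poly S x = real n * poly S x ^ n"
        by (cases n) auto
      have "poly S x * (poly (pderiv P) x * poly S x ^ n - poly P x * (real n * poly S x ^ (n - 1) * poly (pderiv S) x))
        = poly S x * poly (pderiv P) x * poly S x ^ n - poly P x * poly (pderiv S) x * (real n * poly S x ^ (n - 1) * poly S x)"
        by (simp only: right_diff_distrib mult_ac)
      also have "\<dots> = (poly (pderiv P) x * poly S x - poly P x * real n * poly (pderiv S) x) * poly S x ^ n"
        unfolding n1 by (simp only: right_diff_distrib left_diff_distrib mult_ac)
      finally have "poly S x * (poly (pderiv P) x * poly S x ^ n - poly P x * (real n * poly S x ^ (n - 1) * poly (pderiv S) x))
        = (poly (pderiv P) x * poly S x - poly P x * real n * poly (pderiv S) x) * poly S x ^ n" .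
      then have "(poly (pderiv P) x * poly S x ^ n - poly P x * (real n * poly S x ^ (n - 1) * poly (pderiv S) x)) / (poly S x ^ n * poly S x ^ n)
        = (poly (pderiv P) x * poly S x - poly P x * real n * poly (pderiv S) x) / (poly S x ^ n * poly S x)"
        using s by (simp add: frac_eq_eq) (simp add: mult_ac)
      moreover have "(p' * \<sigma> - p * N * \<sigma>') / (A * \<sigma>) * e + p / A * (e * (\<delta> * \<sigma>' / (\<sigma> * \<sigma>)))
          = (p' * \<sigma>\<^sup>2 - N * p * \<sigma>' * \<sigma> + \<delta> * (p * \<sigma>')) / (A * \<sigma>\<^sup>2) * e"
        if "\<sigma> \<noteq> 0" "A \<noteq> 0" for p' p N \<sigma>' \<sigma> A e :: real
        using that by (simp add: field_simps power2_eq_square)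
      moreover have "bump a b \<delta> Q (n + 2) x = poly Q x / (poly S x ^ n * (poly S x)\<^sup>2) * exp (- \<delta> / poly S x)" for Q
        using 1 by (simp add: bump_def S power_add power2_eq_square)
      ultimately show ?thesis using s by simp
    qed
    finally have "(q has_real_derivative bump a b \<delta> (pderiv P * S\<^sup>2 - of_nat n * P * pderiv S * S + smult \<delta> (P * pderiv S)) (n + 2) x) (at x)" .
    then show ?thesis
      by (rule has_field_derivative_transform_within_open[where S = "{a<..<b}"]) (use 1 in \<open>auto simp: q_def bump_def S\<close>)
  next
    case 2
    have "((\<lambda>y. 0) has_real_derivative 0) (at x)" by simp
    then have "(bump a b \<delta> P n has_real_derivative 0) (at x)"
    proof (rule has_field_derivative_transform_within_open[where S = "{..<a} \<union> {b<..}"])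
      show "open ({..<a} \<union> {b<..})" by (intro open_Un) auto
    qed (use 2 ab in \<open>auto simp: bump_def\<close>)
    then show ?thesis using 2 by (auto simp: bump_def)
  next
    case 3
    obtain C where "\<And>y. \<bar>bump a b \<delta> P n y\<bar> \<le> C * (y - x)\<^sup>2"
      using bump_quadratic_bound[OF \<delta> 3] by blast
    then have "(bump a b \<delta> P n has_real_derivative 0) (at x)" by (rule has_real_derivative_0_of_quadratic_bound)
    then show ?thesis using 3 by (auto simp: bump_def)
  qed
qed

lemma test_function_bump:
  assumes \<delta>: "\<delta> > 0" and ab: "a < b" shows "test_function (bump a b \<delta> P n)"
  unfolding test_function_def
proof (intro conjI allI)
  have "\<exists>Q m. (deriv ^^ k) (bump a b \<delta> P n) = bump a b \<delta> Q m" for k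
  proof (induction k)
    case (Suc k)
    then obtain Q m where "(deriv ^^ k) (bump a b \<delta> P n) = bump a b \<delta> Q m" by blast
    then have "(deriv ^^ Suc k) (bump a b \<delta> P n) = deriv (bump a b \<delta> Q m)" by simp
    then show ?case using DERIV_imp_deriv[OF bump_has_real_derivative[OF \<delta> ab]] by (metis ext)
  qed auto
  then show "(deriv ^^ k) (bump a b \<delta> P n) differentiable (at x)" for k x
    using bump_has_real_derivative[OF \<delta> ab] by (metis real_differentiable_def)
  have "closure {x. bump a b \<delta> P n x \<noteq> 0} \<subseteq> {a..b}"
    by (rule closure_minimal) (auto simp: bump_def split: if_splits)
  then show "compact (closure {x. bump a b \<delta> P n x \<noteq> 0})"
    by (metis closed_closure compact_Icc compact_Int_closed inf.absorb_iff2)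
qed

lemma bump_bounds:
  assumes "\<delta> > 0" shows "0 \<le> bump a b \<delta> 1 0 x" "bump a b \<delta> 1 0 x \<le> indicator {a<..<b} x"
  using assms by (auto simp: bump_def)

text \<open>The fundamental lemma of the calculus of variations. Bumps increase \<open>H\<close>
  from vanishing against test functions to vanishing integrals over open intervals; these intervals
  generate the Borel sets and are stable under intersection.\<close>

lemma AE_eq_0_of_test_functions:
  fixes H :: "real \<Rightarrow> real"
  assumes [measurable]: "H \<in> borel_measurable borel" and H2: "sq_norm (\<lambda>x. of_real (H x)) < \<infinity>"
    and zero: "\<And>\<rho>. test_function \<rho> \<Longrightarrow> (\<integral>x. \<rho> x * H x \<partial>lborel) = 0"
  shows "AE x in lborel. H x = 0"
proof -
  have int: "integrable lborel (\<lambda>x. indicator {a<..<b} x * H x)" for a b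
  proof (rule Bochner_Integration.integrable_bound)
    have "complex_integrable lborel (\<lambda>x. indicator {a..b} x *\<^sub>R of_real (H x))"
      by (rule integrable_of_sq_norm_indicator[OF _ H2]) measurable
    then show "complex_integrable lborel (\<lambda>x. indicator {a..b} x *\<^sub>R of_real (H x))" .
    show "AE x in lborel. norm (indicator {a<..<b} x * H x) \<le> norm (indicator {a..b} x *\<^sub>R complex_of_real (H x))"
      by (intro AE_I2) (auto split: split_indicator)
  qed measurable
  have I0: "(\<integral>x. indicator {a<..<b} x * H x \<partial>lborel) = 0" if ab: "a < b" for a b
  proof (rule LIMSEQ_unique)
    define \<delta> where "\<delta> n = 1 / real (Suc n)" for n
    have \<delta>: "\<delta> n > 0" for n by (simp add: \<delta>_def)
    have "\<delta> \<longlonglongrightarrow> 0"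
      using LIMSEQ_inverse_real_of_nat by (simp add: inverse_eq_divide \<delta>_def[abs_def])
    then have "(\<lambda>n. exp (- \<delta> n / s)) \<longlonglongrightarrow> exp (- 0 / s)" if "s > 0" for s using that by (intro tendsto_intros) auto
    then have lim: "(\<lambda>n. bump a b (\<delta> n) 1 0 x) \<longlonglongrightarrow> indicator {a<..<b} x" for x
      by (cases "a < x \<and> x < b") (auto simp: bump_def)
    note tf = test_function_bump[OF \<delta> ab]
    note [measurable] = test_function_measurable[OF tf]
    have "(\<lambda>n. \<integral>x. bump a b (\<delta> n) 1 0 x * H x \<partial>lborel) \<longlonglongrightarrow> (\<integral>x. indicator {a<..<b} x * H x \<partial>lborel)"
    proof (rule integral_dominated_convergence)
      show "integrable lborel (\<lambda>x. norm (indicator {a<..<b} x * H x))" by (intro integrable_norm int)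
      show "AE x in lborel. (\<lambda>n. bump a b (\<delta> n) 1 0 x * H x) \<longlonglongrightarrow> indicator {a<..<b} x * H x"
        by (intro AE_I2 tendsto_mult lim tendsto_const)
      show "AE x in lborel. norm (bump a b (\<delta> n) 1 0 x * H x) \<le> norm (indicator {a<..<b} x * H x)" for n
        using bump_bounds[OF \<delta>, of a b n] by (intro AE_I2) (auto simp: abs_mult intro!: mult_right_mono)
    qed measurable
    then show "(\<lambda>n. \<integral>x. bump a b (\<delta> n) 1 0 x * H x \<partial>lborel) \<longlonglongrightarrow> (\<integral>x. indicator {a<..<b} x * H x \<partial>lborel)" .
    show "(\<lambda>n. \<integral>x. bump a b (\<delta> n) 1 0 x * H x \<partial>lborel) \<longlonglongrightarrow> 0" by (simp add: zero[OF tf])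
  qed
  have I0': "(\<integral>x. indicator {a<..<b} x * H x \<partial>lborel) = 0" for a b
    using I0[of a b] by (cases "a < b") auto
  \<comment> \<open>The measures with densities the positive and the negative part of
    \<open>H\<close>. Once they agree the densities agree almost everywhere, and both parts can only
    be equal where \<open>H\<close> is 0.\<close>
  define P where "P = density lborel (\<lambda>x. ennreal (max 0 (H x)))"
  define Q where "Q = density lborel (\<lambda>x. ennreal (max 0 (- H x)))"
  have em: "emeasure (density lborel (\<lambda>x. ennreal (max 0 (c * H x)))) {a<..<b} = ennreal (\<integral>x. max 0 (c * (indicator {a<..<b} x * H x)) \<partial>lborel)" for a b c
  proof -
    have "emeasure (density lborel (\<lambda>x. ennreal (max 0 (c * H x)))) {a<..<b} = (\<integral>\<^sup>+x. ennreal (max 0 (c * (indicator {a<..<b} x * H x))) \<partial>lborel)"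
      by (subst emeasure_density) (auto intro!: nn_integral_cong split: split_indicator)
    also have "\<dots> = ennreal (\<integral>x. max 0 (c * (indicator {a<..<b} x * H x)) \<partial>lborel)"
      by (intro nn_integral_eq_integral integrable_max integrable_zero integrable_mult_right int) auto
    finally show ?thesis .
  qed
  have eq: "emeasure P {a<..<b} = emeasure Q {a<..<b}" for a b
  proof -
    have "(\<integral>x. max 0 (1 * (indicator {a<..<b} x * H x)) \<partial>lborel) - (\<integral>x. max 0 (- 1 * (indicator {a<..<b} x * H x)) \<partial>lborel)
      = (\<integral>x. max 0 (1 * (indicator {a<..<b} x * H x)) - max 0 (- 1 * (indicator {a<..<b} x * H x)) \<partial>lborel)"
      by (intro Bochner_Integration.integral_diff[symmetric] integrable_max integrable_zero integrable_mult_right int)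
    also have "\<dots> = (\<integral>x. indicator {a<..<b} x * H x \<partial>lborel)"
      by (intro Bochner_Integration.integral_cong) auto
    finally show ?thesis using em[of 1 a b] em[of "-1" a b] I0'[of a b] by (simp add: P_def Q_def)
  qed
  have "P = Q"
  proof (rule measure_eqI_generator_eq)
    let ?E = "range (\<lambda>(a, b). box a b :: real set)"
    show "Int_stable ?E" by (auto simp: Int_stable_def box_Int_box)
    show "?E \<subseteq> Pow UNIV" by simp
    show "emeasure P X = emeasure Q X" if "X \<in> ?E" for X using that eq by auto
    show "sets P = sigma_sets UNIV ?E" "sets Q = sigma_sets UNIV ?E" by (simp_all add: P_def Q_def borel_eq_box)
    show "range (\<lambda>n. box (- real n) (real n)) \<subseteq> ?E" by auto
    show "(\<Union>n. box (- real n) (real n)) = UNIV"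
    proof (intro set_eqI iffI UNIV_I)
      fix x :: real
      obtain n :: nat where "\<bar>x\<bar> < real n" using reals_Archimedean2 by blast
      then show "x \<in> (\<Union>n. box (- real n) (real n))" by (auto simp: abs_less_iff intro!: exI[of _ n])
    qed
    show "emeasure P (box (- real n) (real n)) \<noteq> \<infinity>" for n
      using em[of 1 "- real n" "real n"] by (simp add: P_def)
  qed
  then have "AE x in lborel. ennreal (max 0 (H x)) = ennreal (max 0 (- H x))"
    unfolding P_def Q_def by (subst (asm) sigma_finite_measure.density_unique_iff[OF sigma_finite_lborel]) auto
  then show ?thesis
    by eventually_elim (auto simp: max_def split: if_splits)
qed

section \<open>Mollification, and the transform of a function with a weak derivative\<close>

lemma funpow_deriv_reflect:
  assumes \<rho>: "test_function \<rho>"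
  shows "(deriv ^^ k) (\<lambda>y. \<rho> (x - y)) = (\<lambda>y. (-1) ^ k * (deriv ^^ k) \<rho> (x - y))"
proof (induction k)
  case (Suc k)
  have "((\<lambda>y. (-1) ^ k * (deriv ^^ k) \<rho> (x - y)) has_real_derivative (-1) ^ Suc k * (deriv ^^ Suc k) \<rho> (x - y)) (at y)" for y
  proof -
    have "((deriv ^^ k) \<rho> has_real_derivative (deriv ^^ Suc k) \<rho> (x - y)) (at (x - y))"
      using test_function_DERIV[OF test_function_funpow_deriv[OF \<rho>, of k], of "x - y"] by simp
    moreover have "((\<lambda>y. x - y) has_real_derivative - 1) (at y)"
      by (auto intro!: derivative_eq_intros)
    ultimately have "((\<lambda>y. (deriv ^^ k) \<rho> (x - y)) has_real_derivative (deriv ^^ Suc k) \<rho> (x - y) * (- 1)) (at y)"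
      by (rule DERIV_chain2)
    from DERIV_cmult[OF this, of "(-1) ^ k"] show ?thesis by simp
  qed
  then have "deriv (\<lambda>y. (-1) ^ k * (deriv ^^ k) \<rho> (x - y)) y = (-1) ^ Suc k * (deriv ^^ Suc k) \<rho> (x - y)" for y
    by (rule DERIV_imp_deriv)
  then have "deriv (\<lambda>y. (-1) ^ k * (deriv ^^ k) \<rho> (x - y)) = (\<lambda>y. (-1) ^ Suc k * (deriv ^^ Suc k) \<rho> (x - y))" by (rule ext)
  moreover have "(deriv ^^ Suc k) (\<lambda>y. \<rho> (x - y)) = deriv ((deriv ^^ k) (\<lambda>y. \<rho> (x - y)))" by simp
  ultimately show ?case unfolding Suc by simp
qed simp

lemma test_function_reflect:
  assumes \<rho>: "test_function \<rho>" shows "test_function (\<lambda>y. \<rho> (x - y))"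
  unfolding test_function_def
proof (intro conjI allI)
  fix k y
  have "(deriv ^^ k) \<rho> differentiable (at (x - y))" using \<rho> unfolding test_function_def by blast
  then have "(\<lambda>y. (deriv ^^ k) \<rho> (x - y)) differentiable (at y)"
    by (intro differentiable_compose[of "(deriv ^^ k) \<rho>" "\<lambda>y. x - y"]) (auto intro!: derivative_intros)
  then show "(deriv ^^ k) (\<lambda>y. \<rho> (x - y)) differentiable (at y)"
    unfolding funpow_deriv_reflect[OF \<rho>] by (intro differentiable_mult differentiable_const)
next
  obtain R where R: "\<And>x. R \<le> \<bar>x\<bar> \<Longrightarrow> \<rho> x = 0" using test_function_support[OF \<rho>] by blast
  have "{y. \<rho> (x - y) \<noteq> 0} \<subseteq> {x - R..x + R}"
  proof
    fix y assume "y \<in> {y. \<rho> (x - y) \<noteq> 0}"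
    then have "\<not> R \<le> \<bar>x - y\<bar>" using R by blast
    then show "y \<in> {x - R..x + R}" by auto
  qed
  then have "closure {y. \<rho> (x - y) \<noteq> 0} \<subseteq> {x - R..x + R}" by (rule closure_minimal) simp
  then show "compact (closure {y. \<rho> (x - y) \<noteq> 0})"
    by (metis closed_closure compact_Icc compact_Int_closed inf.absorb_iff2)
qed

lemma
  fixes f \<psi> :: "real \<Rightarrow> complex"
  assumes f: "integrable lborel f" and \<psi>: "integrable lborel \<psi>"
  shows integrable_convolution: "integrable lborel (\<lambda>x. \<integral>y. f y * \<psi> (x - y) \<partial>lborel)"
    and fourier_convolution: "fourier (\<lambda>x. \<integral>y. f y * \<psi> (x - y) \<partial>lborel) \<xi> = fourier f \<xi> * fourier \<psi> \<xi>"
proof -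
  have [measurable]: "f \<in> borel_measurable borel" "\<psi> \<in> borel_measurable borel" using f \<psi> by auto
  have shift: "integrable lborel (\<lambda>x. \<psi> (x - y))" for y
    using lborel_integrable_real_affine[OF \<psi>, of 1 "- y"] by simp
  have shift_norm: "(\<integral>x. cmod (\<psi> (x - y)) \<partial>lborel) = (\<integral>x. cmod (\<psi> x) \<partial>lborel)" for y
    using lborel_integral_real_affine[of 1 "\<lambda>x. cmod (\<psi> x)" "- y"] by simp
  have int: "integrable (lborel \<Otimes>\<^sub>M lborel) (\<lambda>(y, x). f y * \<psi> (x - y))"
  proof (rule lborel_pair.Fubini_integrable)
    show "integrable lborel (\<lambda>y. \<integral>x. norm (case (y, x) of (y, x) \<Rightarrow> f y * \<psi> (x - y)) \<partial>lborel)"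
      using f by (simp add: norm_mult shift_norm)
    show "AE y in lborel. integrable lborel (\<lambda>x. case (y, x) of (y, x) \<Rightarrow> f y * \<psi> (x - y))"
      using shift by simp
  qed measurable
  show "integrable lborel (\<lambda>x. \<integral>y. f y * \<psi> (x - y) \<partial>lborel)"
    by (rule lborel_pair.integrable_snd[OF int])
  define E where "E x = exp (- \<i> * of_real \<xi> * of_real x)" for x
  have E_add: "E (y + x) = E y * E x" for x y
    unfolding E_def exp_add[symmetric] by (simp add: algebra_simps)
  have [measurable]: "E \<in> borel_measurable borel" unfolding E_def by measurable
  have int': "integrable (lborel \<Otimes>\<^sub>M lborel) (\<lambda>(y, x). E x * (f y * \<psi> (x - y)))"
  proof (rule Bochner_Integration.integrable_bound[OF int])
    show "AE p in lborel \<Otimes>\<^sub>M lborel. norm (case p of (y, x) \<Rightarrow> E x * (f y * \<psi> (x - y))) \<le> norm (case p of (y, x) \<Rightarrow> f y * \<psi> (x - y))"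
      by (intro AE_I2) (auto simp: norm_mult E_def)
  qed measurable
  have "fourier (\<lambda>x. \<integral>y. f y * \<psi> (x - y) \<partial>lborel) \<xi> = (\<integral>x. (\<integral>y. E x * (f y * \<psi> (x - y)) \<partial>lborel) \<partial>lborel)"
    unfolding fourier_def E_def[symmetric] integral_mult_right_zero ..
  also have "\<dots> = (\<integral>y. (\<integral>x. E x * (f y * \<psi> (x - y)) \<partial>lborel) \<partial>lborel)"
    by (rule lborel_pair.Fubini_integral[OF int'])
  also have "\<dots> = (\<integral>y. (E y * f y) * fourier \<psi> \<xi> \<partial>lborel)"
  proof (rule Bochner_Integration.integral_cong[OF refl])
    fix y
    have "(\<integral>x. E x * (f y * \<psi> (x - y)) \<partial>lborel) = (\<integral>x. (E y * f y) * (E x * \<psi> x) \<partial>lborel)"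
      using lborel_integral_real_affine[of 1 "\<lambda>x. E x * (f y * \<psi> (x - y))" y] by (simp add: E_add mult_ac)
    then show "(\<integral>x. E x * (f y * \<psi> (x - y)) \<partial>lborel) = (E y * f y) * fourier \<psi> \<xi>"
      by (simp only: fourier_def E_def[symmetric] integral_mult_right_zero)
  qed
  also have "\<dots> = fourier f \<xi> * fourier \<psi> \<xi>"
    unfolding fourier_def[of f] E_def[symmetric] by (rule integral_mult_left_zero)
  finally show "fourier (\<lambda>x. \<integral>y. f y * \<psi> (x - y) \<partial>lborel) \<xi> = fourier f \<xi> * fourier \<psi> \<xi>" .
qed

text \<open>Cauchy-Schwarz with \<phi> split into two square roots, followed by Fubini. Each of the
  two steps contributes one factor of the mass of \<phi>.\<close>

lemma young_sq_norm:
  fixes G :: "real \<Rightarrow> complex" and \<phi> :: "real \<Rightarrow> real"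
  assumes [measurable]: "G \<in> borel_measurable borel" and \<phi>: "integrable lborel \<phi>" and pos: "\<And>x. \<phi> x \<ge> 0"
  shows "sq_norm (\<lambda>x. \<integral>y. G y * of_real (\<phi> (x - y)) \<partial>lborel) \<le> ennreal ((\<integral>x. \<phi> x \<partial>lborel)\<^sup>2) * sq_norm G"
proof -
  have [measurable]: "\<phi> \<in> borel_measurable borel" using \<phi> by auto
  define I where "I = (\<integral>x. \<phi> x \<partial>lborel)"
  have I0: "I \<ge> 0" unfolding I_def using pos by (intro integral_nonneg_AE) auto
  have I: "(\<integral>\<^sup>+x. ennreal (\<phi> x) \<partial>lborel) = ennreal I"
    unfolding I_def using \<phi> pos by (intro nn_integral_eq_integral) auto
  have I1: "(\<integral>\<^sup>+y. ennreal (\<phi> (x - y)) \<partial>lborel) = ennreal I" for x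
    using nn_integral_real_affine[of "\<lambda>y. ennreal (\<phi> y)" "-1" x] I by simp
  have I2: "(\<integral>\<^sup>+x. ennreal (\<phi> (x - y)) \<partial>lborel) = ennreal I" for y
    using nn_integral_real_affine[of "\<lambda>y. ennreal (\<phi> y)" 1 "-y"] I by simp
  have "sq_norm (\<lambda>x. \<integral>y. G y * of_real (\<phi> (x - y)) \<partial>lborel)
    \<le> (\<integral>\<^sup>+x. (\<integral>\<^sup>+y. ennreal ((cmod (G y))\<^sup>2) * ennreal (\<phi> (x - y)) \<partial>lborel) * ennreal I \<partial>lborel)"
    unfolding sq_norm_def
  proof (intro nn_integral_mono)
    fix x
    have "ennreal ((cmod (\<integral>y. G y * of_real (\<phi> (x - y)) \<partial>lborel))\<^sup>2) = (ennreal (cmod (\<integral>y. G y * of_real (\<phi> (x - y)) \<partial>lborel)))\<^sup>2"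
      by (simp add: ennreal_power)
    also have "\<dots> \<le> (\<integral>\<^sup>+y. ennreal (cmod (G y * of_real (\<phi> (x - y)))) \<partial>lborel)\<^sup>2"
      by (intro power_mono ennreal_norm_integral_le) auto
    also have "(\<lambda>y. ennreal (cmod (G y * of_real (\<phi> (x - y))))) = (\<lambda>y. ennreal (cmod (G y) * sqrt (\<phi> (x - y))) * ennreal (sqrt (\<phi> (x - y))))"
      using pos by (simp add: fun_eq_iff norm_mult flip: ennreal_mult)
    also have "(\<integral>\<^sup>+y. ennreal (cmod (G y) * sqrt (\<phi> (x - y))) * ennreal (sqrt (\<phi> (x - y))) \<partial>lborel)\<^sup>2
       \<le> (\<integral>\<^sup>+y. (ennreal (cmod (G y) * sqrt (\<phi> (x - y))))\<^sup>2 \<partial>lborel) * (\<integral>\<^sup>+y. (ennreal (sqrt (\<phi> (x - y))))\<^sup>2 \<partial>lborel)"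
      by (rule Cauchy_Schwarz_nn_integral) measurable
    also have "\<dots> = (\<integral>\<^sup>+y. ennreal ((cmod (G y))\<^sup>2) * ennreal (\<phi> (x - y)) \<partial>lborel) * ennreal I"
      using pos I1[of x] by (simp add: ennreal_power power_mult_distrib ennreal_mult)
    finally show "ennreal ((cmod (\<integral>y. G y * of_real (\<phi> (x - y)) \<partial>lborel))\<^sup>2)
      \<le> (\<integral>\<^sup>+y. ennreal ((cmod (G y))\<^sup>2) * ennreal (\<phi> (x - y)) \<partial>lborel) * ennreal I" .
  qed
  also have "\<dots> = (\<integral>\<^sup>+x. (\<integral>\<^sup>+y. ennreal ((cmod (G y))\<^sup>2) * ennreal (\<phi> (x - y)) \<partial>lborel) \<partial>lborel) * ennreal I"
    by (rule nn_integral_multc) measurable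
  also have "(\<integral>\<^sup>+x. (\<integral>\<^sup>+y. ennreal ((cmod (G y))\<^sup>2) * ennreal (\<phi> (x - y)) \<partial>lborel) \<partial>lborel)
    = (\<integral>\<^sup>+y. (\<integral>\<^sup>+x. ennreal ((cmod (G y))\<^sup>2) * ennreal (\<phi> (x - y)) \<partial>lborel) \<partial>lborel)"
    by (rule lborel_pair.Fubini') measurable
  also have "\<dots> = sq_norm G * ennreal I"
    unfolding sq_norm_def by (simp add: nn_integral_cmult I2 nn_integral_multc)
  also have "sq_norm G * ennreal I * ennreal I = ennreal (I\<^sup>2) * sq_norm G"
    using I0 by (simp add: power2_eq_square ennreal_mult mult_ac)
  finally show ?thesis unfolding I_def .
qed

lemma integral_bump_pos:
  assumes \<delta>: "\<delta> > 0" and ab: "a < b" shows "0 < (\<integral>x. bump a b \<delta> 1 0 x \<partial>lborel)"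
proof -
  have int: "integrable lborel (bump a b \<delta> 1 0)" by (rule test_function_integrable[OF test_function_bump[OF \<delta> ab]])
  have nonneg: "AE x in lborel. 0 \<le> bump a b \<delta> 1 0 x" using bump_bounds[OF \<delta>] by auto
  have "(\<integral>x. bump a b \<delta> 1 0 x \<partial>lborel) \<noteq> 0"
  proof
    assume "(\<integral>x. bump a b \<delta> 1 0 x \<partial>lborel) = 0"
    then have "AE x in lborel. bump a b \<delta> 1 0 x = 0"
      using integral_nonneg_eq_0_iff_AE[OF int nonneg] by simp
    then have "AE x in lborel. x \<notin> {a<..<b}"
      by eventually_elim (auto simp: bump_def)
    then have "{a<..<b} \<in> null_sets lborel" by (subst AE_iff_null_sets) auto
    then show False using ab by (auto simp: null_sets_def)
  qed
  moreover have "0 \<le> (\<integral>x. bump a b \<delta> 1 0 x \<partial>lborel)" by (rule integral_nonneg_AE[OF nonneg])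
  ultimately show ?thesis by simp
qed

text \<open>On the support the kernel differs from 1 by at most
  \<open>\<bar>\<xi>\<bar> * d\<close>, so the transform of a bump divided by its mass tends to 1 as
  the support shrinks.\<close>

lemma fourier_bump_approx:
  assumes \<delta>: "\<delta> > 0" and d: "d > 0"
  shows "cmod (fourier (\<lambda>x. of_real (bump (- d) d \<delta> 1 0 x)) \<xi> - of_real (\<integral>x. bump (- d) d \<delta> 1 0 x \<partial>lborel))
    \<le> \<bar>\<xi>\<bar> * d * (\<integral>x. bump (- d) d \<delta> 1 0 x \<partial>lborel)"
proof -
  define \<phi> where "\<phi> = bump (- d) d \<delta> 1 0"
  have int: "integrable lborel \<phi>" unfolding \<phi>_def using d by (intro test_function_integrable test_function_bump[OF \<delta>]) simp
  have int_c: "integrable lborel (\<lambda>x. of_real (\<phi> x) :: complex)" using int by simp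
  have "fourier (\<lambda>x. of_real (\<phi> x)) \<xi> - of_real (\<integral>x. \<phi> x \<partial>lborel) = (\<integral>x. exp (- \<i> * of_real \<xi> * of_real x) * of_real (\<phi> x) - of_real (\<phi> x) \<partial>lborel)"
    unfolding fourier_def integral_complex_of_real[symmetric]
    by (intro Bochner_Integration.integral_diff[symmetric] integrable_fourier_kernel_mult int_c)
  also have "cmod \<dots> \<le> (\<integral>x. \<bar>\<xi>\<bar> * d * \<phi> x \<partial>lborel)"
  proof (rule Bochner_Integration.integral_norm_bound_integral)
    show "integrable lborel (\<lambda>x. exp (- \<i> * of_real \<xi> * of_real x) * of_real (\<phi> x) - of_real (\<phi> x))"
      by (intro Bochner_Integration.integrable_diff integrable_fourier_kernel_mult int_c)
    show "integrable lborel (\<lambda>x. \<bar>\<xi>\<bar> * d * \<phi> x)" using int by simp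
    fix x
    show "norm (exp (- \<i> * of_real \<xi> * of_real x) * of_real (\<phi> x) - of_real (\<phi> x)) \<le> \<bar>\<xi>\<bar> * d * \<phi> x"
    proof (cases "\<bar>x\<bar> < d")
      case True
      have "cmod (exp (- \<i> * of_real \<xi> * of_real x) - 1) \<le> \<bar>\<xi> * x\<bar>"
        using iexp_approx1[of "- (\<xi> * x)" 0] by (simp add: mult.assoc)
      also have "\<dots> \<le> \<bar>\<xi>\<bar> * d" using True by (simp add: abs_mult mult_left_mono)
      finally have "cmod (exp (- \<i> * of_real \<xi> * of_real x) - 1) * \<phi> x \<le> \<bar>\<xi>\<bar> * d * \<phi> x"
        unfolding \<phi>_def by (intro mult_right_mono bump_bounds \<delta>)
      moreover have "exp (- \<i> * of_real \<xi> * of_real x) * of_real (\<phi> x) - of_real (\<phi> x) = (exp (- \<i> * of_real \<xi> * of_real x) - 1) * of_real (\<phi> x)"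
        by (simp add: algebra_simps)
      moreover have "\<phi> x \<ge> 0" unfolding \<phi>_def by (rule bump_bounds[OF \<delta>])
      ultimately show ?thesis by (simp only: norm_mult norm_of_real abs_of_nonneg)
    next
      case False
      then have "\<phi> x = 0" by (auto simp: \<phi>_def bump_def)
      then show ?thesis by simp
    qed
  qed
  also have "\<dots> = \<bar>\<xi>\<bar> * d * (\<integral>x. \<phi> x \<partial>lborel)" by simp
  finally show ?thesis unfolding \<phi>_def .
qed

text \<open>The transform of \<open>G\<close> is never formed, as \<open>G\<close> need not be
  integrable. Instead the m-th derivative of the mollified \<open>f\<close> equals the mollified
  \<open>G\<close>; its transform contains \<open>(\<i> \<xi>)^m\<close>, the Bessel inequality and
  Young's inequality bound it, and Fatou's lemma removes the mollifier.\<close>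

theorem sq_norm_fourier_le_weak_deriv:
  fixes f G :: "real \<Rightarrow> real"
  assumes f: "integrable lborel f" and [measurable]: "G \<in> borel_measurable borel"
    and weak: "\<And>\<rho>. test_function \<rho> \<Longrightarrow> (\<integral>x. (deriv ^^ m) \<rho> x * f x \<partial>lborel) = (-1) ^ m * (\<integral>x. \<rho> x * G x \<partial>lborel)"
  shows "sq_norm (\<lambda>\<xi>. (\<i> * of_real \<xi>) ^ m * fourier (\<lambda>x. of_real (f x)) \<xi>) \<le> ennreal (2 * pi) * sq_norm (\<lambda>x. of_real (G x))"
proof -
  define fh where "fh = fourier (\<lambda>x. of_real (f x))"
  have fc: "integrable lborel (\<lambda>x. of_real (f x) :: complex)" using f by simp
  have [measurable]: "f \<in> borel_measurable borel" using f by auto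
  have [measurable]: "fh \<in> borel_measurable borel"
    unfolding fh_def by (rule borel_measurable_fourier[where h = "\<lambda>x. x"]) measurable
  define d where "d n = 1 / real (Suc n)" for n
  have d: "d n > 0" for n by (simp add: d_def)
  \<comment> \<open>Only the support shrinks, and the shape parameter stays 1. The masses
    \<open>I n\<close> are thus not normalised, which is why the estimate is divided by them
    below.\<close>
  define \<phi> where "\<phi> n = bump (- d n) (d n) 1 1 0" for n
  have tf: "test_function (\<phi> n)" for n unfolding \<phi>_def using d[of n] by (intro test_function_bump) auto
  define I where "I n = (\<integral>x. \<phi> n x \<partial>lborel)" for n
  have I: "I n > 0" for n unfolding I_def \<phi>_def using d[of n] by (intro integral_bump_pos) auto
  define ph where "ph n = fourier (\<lambda>x. of_real (\<phi> n x))" for n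
  have tfm [measurable]: "\<phi> n \<in> borel_measurable borel" for n by (rule test_function_measurable[OF tf])
  have phm [measurable]: "ph n \<in> borel_measurable borel" for n
    unfolding ph_def by (rule borel_measurable_fourier[where h = "\<lambda>x. x"]) measurable
  have "sq_norm (\<lambda>\<xi>. (\<i> * of_real \<xi>) ^ m * fh \<xi> * ph n \<xi>) \<le> ennreal (2 * pi) * (ennreal ((I n)\<^sup>2) * sq_norm (\<lambda>x. of_real (G x)))" for n
  proof -
    define \<psi> :: "real \<Rightarrow> complex" where "\<psi> x = of_real ((deriv ^^ m) (\<phi> n) x)" for x
    have \<psi>: "integrable lborel \<psi>"
      unfolding \<psi>_def using test_function_integrable[OF test_function_funpow_deriv[OF tf]] by simp
    \<comment> \<open>The weak derivative is tested with \<open>\<phi> n (x - y)\<close> as a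
      function of \<open>y\<close>; the sign from the reflection cancels the sign in the definition
      of the weak derivative.\<close>
    have conv: "(\<integral>y. of_real (f y) * \<psi> (x - y) \<partial>lborel) = (\<integral>y. of_real (G y) * of_real (\<phi> n (x - y)) \<partial>lborel)" for x
    proof -
      have "(-1) ^ m * (\<integral>y. (deriv ^^ m) (\<phi> n) (x - y) * f y \<partial>lborel) = (-1) ^ m * (\<integral>y. \<phi> n (x - y) * G y \<partial>lborel)"
        using weak[OF test_function_reflect[OF tf, of n x]] unfolding funpow_deriv_reflect[OF tf] by (simp add: mult.assoc)
      then have "(\<integral>y. (deriv ^^ m) (\<phi> n) (x - y) * f y \<partial>lborel) = (\<integral>y. \<phi> n (x - y) * G y \<partial>lborel)" by simp
      moreover have "(\<integral>y. of_real (f y) * \<psi> (x - y) \<partial>lborel) = complex_of_real (\<integral>y. (deriv ^^ m) (\<phi> n) (x - y) * f y \<partial>lborel)"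
        unfolding \<psi>_def of_real_mult[symmetric] integral_complex_of_real by (simp only: mult.commute)
      moreover have "(\<integral>y. of_real (G y) * of_real (\<phi> n (x - y)) \<partial>lborel) = complex_of_real (\<integral>y. \<phi> n (x - y) * G y \<partial>lborel)"
        unfolding of_real_mult[symmetric] integral_complex_of_real by (simp only: mult.commute)
      ultimately show ?thesis by (simp only:)
    qed
    have "(\<lambda>\<xi>. (\<i> * of_real \<xi>) ^ m * fh \<xi> * ph n \<xi>) = fourier (\<lambda>x. \<integral>y. of_real (f y) * \<psi> (x - y) \<partial>lborel)"
    proof
      fix \<xi>
      have "fourier \<psi> \<xi> = (\<i> * of_real \<xi>) ^ m * ph n \<xi>"
        unfolding \<psi>_def ph_def by (rule fourier_funpow_deriv_test_function[OF tf])
      then show "(\<i> * of_real \<xi>) ^ m * fh \<xi> * ph n \<xi> = fourier (\<lambda>x. \<integral>y. of_real (f y) * \<psi> (x - y) \<partial>lborel) \<xi>"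
        unfolding fourier_convolution[OF fc \<psi>] fh_def by simp
    qed
    then have "sq_norm (\<lambda>\<xi>. (\<i> * of_real \<xi>) ^ m * fh \<xi> * ph n \<xi>) \<le> ennreal (2 * pi) * sq_norm (\<lambda>x. \<integral>y. of_real (f y) * \<psi> (x - y) \<partial>lborel)"
      using fourier_bessel[OF integrable_convolution[OF fc \<psi>]] by simp
    also have "\<dots> \<le> ennreal (2 * pi) * (ennreal ((I n)\<^sup>2) * sq_norm (\<lambda>x. of_real (G x)))"
      unfolding conv I_def using bump_bounds(1)[of 1]
      by (intro mult_left_mono young_sq_norm test_function_integrable tf) (auto simp: \<phi>_def)
    finally show ?thesis .
  qed
  then have le: "sq_norm (\<lambda>\<xi>. of_real (1 / I n) * ((\<i> * of_real \<xi>) ^ m * fh \<xi> * ph n \<xi>)) \<le> ennreal (2 * pi) * sq_norm (\<lambda>x. of_real (G x))" for n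
  proof -
    have "sq_norm (\<lambda>\<xi>. of_real (1 / I n) * ((\<i> * of_real \<xi>) ^ m * fh \<xi> * ph n \<xi>))
      = ennreal ((1 / I n)\<^sup>2) * sq_norm (\<lambda>\<xi>. (\<i> * of_real \<xi>) ^ m * fh \<xi> * ph n \<xi>)"
      by (subst sq_norm_cmult) (measurable, simp add: power_divide norm_divide)
    also have "\<dots> \<le> ennreal ((1 / I n)\<^sup>2) * (ennreal (2 * pi) * (ennreal ((I n)\<^sup>2) * sq_norm (\<lambda>x. of_real (G x))))"
      by (intro mult_left_mono \<open>\<And>n. sq_norm (\<lambda>\<xi>. (\<i> * of_real \<xi>) ^ m * fh \<xi> * ph n \<xi>) \<le> _\<close>) simp
    also have "\<dots> = (ennreal ((1 / I n)\<^sup>2) * ennreal ((I n)\<^sup>2)) * (ennreal (2 * pi) * sq_norm (\<lambda>x. of_real (G x)))"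
      by (simp add: mult_ac)
    also have "ennreal ((1 / I n)\<^sup>2) * ennreal ((I n)\<^sup>2) = 1"
      using I[of n] by (simp add: power_divide flip: ennreal_mult)
    finally show ?thesis by simp
  qed
  have d0: "d \<longlonglongrightarrow> 0"
    using LIMSEQ_inverse_real_of_nat by (simp add: inverse_eq_divide d_def[abs_def])
  have lim: "(\<lambda>n. ph n \<xi> / of_real (I n)) \<longlonglongrightarrow> 1" for \<xi>
  proof -
    have "(\<lambda>n. ph n \<xi> / of_real (I n) - 1) \<longlonglongrightarrow> 0"
    proof (rule Lim_null_comparison)
      show "\<forall>\<^sub>F n in sequentially. norm (ph n \<xi> / of_real (I n) - 1) \<le> \<bar>\<xi>\<bar> * d n"
      proof (intro always_eventually allI)
        fix n
        have "cmod (ph n \<xi> - of_real (I n)) \<le> \<bar>\<xi>\<bar> * d n * I n"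
          unfolding ph_def I_def \<phi>_def by (rule fourier_bump_approx) (use d in auto)
        then have "cmod ((ph n \<xi> - of_real (I n)) / of_real (I n)) \<le> \<bar>\<xi>\<bar> * d n"
          using I[of n] by (simp add: norm_divide divide_le_eq)
        then show "norm (ph n \<xi> / of_real (I n) - 1) \<le> \<bar>\<xi>\<bar> * d n"
          using I[of n] by (simp add: diff_divide_distrib)
      qed
      show "(\<lambda>n. \<bar>\<xi>\<bar> * d n) \<longlonglongrightarrow> 0" using tendsto_mult[OF tendsto_const d0, of "\<bar>\<xi>\<bar>"] by simp
    qed
    then show ?thesis by (simp add: LIM_zero_iff)
  qed
  show ?thesis
    unfolding sq_norm_def[of "\<lambda>\<xi>. (\<i> * of_real \<xi>) ^ m * _ \<xi>"] fh_def[symmetric]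
  proof (rule nn_integral_le_of_tendsto)
    show "(\<lambda>\<xi>. ennreal ((cmod (of_real (1 / I n) * ((\<i> * of_real \<xi>) ^ m * fh \<xi> * ph n \<xi>)))\<^sup>2)) \<in> borel_measurable lborel" for n
      by measurable
    have "(\<lambda>n. (\<i> * of_real \<xi>) ^ m * fh \<xi> * (ph n \<xi> / of_real (I n))) \<longlonglongrightarrow> (\<i> * of_real \<xi>) ^ m * fh \<xi> * 1" for \<xi>
      by (intro tendsto_mult tendsto_const lim)
    then have "(\<lambda>n. of_real (1 / I n) * ((\<i> * of_real \<xi>) ^ m * fh \<xi> * ph n \<xi>)) \<longlonglongrightarrow> (\<i> * of_real \<xi>) ^ m * fh \<xi>" for \<xi>
      by (simp add: field_simps)
    then show "AE \<xi> in lborel. (\<lambda>n. ennreal ((cmod (of_real (1 / I n) * ((\<i> * of_real \<xi>) ^ m * fh \<xi> * ph n \<xi>)))\<^sup>2)) \<longlonglongrightarrow> ennreal ((cmod ((\<i> * of_real \<xi>) ^ m * fh \<xi>))\<^sup>2)"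
      by (intro AE_I2 tendsto_ennrealI tendsto_power tendsto_norm)
    show "\<forall>\<^sub>F n in sequentially. (\<integral>\<^sup>+\<xi>. ennreal ((cmod (of_real (1 / I n) * ((\<i> * of_real \<xi>) ^ m * fh \<xi> * ph n \<xi>)))\<^sup>2) \<partial>lborel) \<le> ennreal (2 * pi) * sq_norm (\<lambda>x. of_real (G x))"
      using le unfolding sq_norm_def by simp
  qed
qed

section \<open>Vector-valued functions and the choice of representatives\<close>

lemma borel_measurable_vec_nth [measurable]: "(\<lambda>x :: real ^ 'n. x $ i) \<in> borel_measurable borel"
  by (intro borel_measurable_continuous_onI continuous_intros)

lemma borel_measurable_vec_lambda:
  fixes h :: "'n::finite \<Rightarrow> 'a \<Rightarrow> real"
  assumes [measurable]: "\<And>i. h i \<in> borel_measurable M"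
  shows "(\<lambda>x. \<chi> i. h i x) \<in> borel_measurable M"
proof -
  have "(\<lambda>x. \<chi> i. h i x) = (\<lambda>x. \<Sum>i\<in>UNIV. h i x *\<^sub>R (axis i 1 :: real ^ 'n))"
    by (simp add: fun_eq_iff vec_eq_iff axis_def if_distrib sum.If_cases cong: if_cong)
  then show ?thesis by simp
qed

lemma nn_integral_norm_vec_squared:
  fixes f :: "real \<Rightarrow> real ^ 'n"
  assumes [measurable]: "f \<in> borel_measurable borel"
  shows "(\<integral>\<^sup>+x. ennreal ((norm (f x))\<^sup>2) \<partial>lborel) = (\<Sum>i\<in>UNIV. sq_norm (\<lambda>x. of_real (f x $ i)))"
proof -
  have "(\<integral>\<^sup>+x. ennreal ((norm (f x))\<^sup>2) \<partial>lborel) = (\<integral>\<^sup>+x. (\<Sum>i\<in>UNIV. ennreal ((f x $ i)\<^sup>2)) \<partial>lborel)"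
    by (simp add: norm_vec_def L2_set_def sum_nonneg)
  also have "\<dots> = (\<Sum>i\<in>UNIV. sq_norm (\<lambda>x. of_real (f x $ i)))"
    unfolding sq_norm_def by (subst nn_integral_sum) (simp_all)
  finally show ?thesis .
qed

lemma L2_vec_iff:
  fixes f :: "real \<Rightarrow> real ^ 'n"
  shows "f \<in> L2 \<longleftrightarrow> f \<in> borel_measurable borel \<and> (\<forall>i. sq_norm (\<lambda>x. of_real (f x $ i)) < \<infinity>)"
proof (cases "f \<in> borel_measurable borel")
  case True
  then show ?thesis
    using nn_integral_norm_vec_squared[OF True] by (simp add: L2_def integrable_iff_bounded)
qed (simp add: L2_def)

lemma L2_norm_squared:
  fixes f :: "real \<Rightarrow> real ^ 'n"
  assumes "f \<in> L2"
  shows "ennreal ((L2_norm f)\<^sup>2) = (\<Sum>i\<in>UNIV. sq_norm (\<lambda>x. of_real (f x $ i)))"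
proof -
  have int: "integrable lborel (\<lambda>x. (norm (f x))\<^sup>2)" and m: "f \<in> borel_measurable borel" using assms by (auto simp: L2_def)
  have "(L2_norm f)\<^sup>2 = (\<integral>x. (norm (f x))\<^sup>2 \<partial>lborel)"
    unfolding L2_norm_def by (intro real_sqrt_pow2 integral_nonneg_AE) auto
  then have "ennreal ((L2_norm f)\<^sup>2) = (\<integral>\<^sup>+x. ennreal ((norm (f x))\<^sup>2) \<partial>lborel)"
    using nn_integral_eq_integral[OF int] by simp
  then show ?thesis using nn_integral_norm_vec_squared[OF m] by simp
qed

text \<open>Taking components commutes with the integral of an integrable function; integrability
  follows from Cauchy-Schwarz for the test function and the norm of \<open>f\<close>.\<close>

lemma integral_test_function_vec_nth:
  fixes f :: "real \<Rightarrow> real ^ 'n"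
  assumes f: "f \<in> L2" and \<rho>: "test_function \<rho>"
  shows "(\<integral>x. \<rho> x *\<^sub>R f x \<partial>lborel) $ i = (\<integral>x. \<rho> x * f x $ i \<partial>lborel)"
proof -
  have [measurable]: "f \<in> borel_measurable borel" "\<rho> \<in> borel_measurable borel"
    using f test_function_measurable[OF \<rho>] by (auto simp: L2_def)
  have "sq_norm (\<lambda>x. of_real (norm (f x))) < \<infinity>"
    using f by (simp add: sq_norm_def L2_def integrable_iff_bounded)
  then have "complex_integrable lborel (\<lambda>x. of_real (\<rho> x) * of_real (norm (f x)))"
    by (intro integrable_mult_of_sq_norm test_function_sq_norm[OF \<rho>]) auto
  then have "integrable lborel (\<lambda>x. \<rho> x *\<^sub>R f x)"
    by (rule Bochner_Integration.integrable_bound) (auto simp: norm_mult)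
  from integral_bounded_linear[OF bounded_linear_vec_nth[of i] this] show ?thesis by simp
qed

lemma has_L2_weak_deriv_vec_nth:
  fixes f :: "real \<Rightarrow> real ^ 'n"
  assumes "has_L2_weak_deriv k f g" and \<rho>: "test_function \<rho>"
  shows "(\<integral>x. (deriv ^^ k) \<rho> x * f x $ i \<partial>lborel) = (-1) ^ k * (\<integral>x. \<rho> x * g x $ i \<partial>lborel)"
proof -
  have fg: "f \<in> L2" "g \<in> L2"
    and eq: "(\<integral>x. (deriv ^^ k) \<rho> x *\<^sub>R f x \<partial>lborel) = (-1) ^ k *\<^sub>R (\<integral>x. \<rho> x *\<^sub>R g x \<partial>lborel)"
    using assms by (auto simp: has_L2_weak_deriv_def)
  from arg_cong[OF eq, of "\<lambda>v. v $ i"] show ?thesis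
    by (simp add: integral_test_function_vec_nth fg \<rho> test_function_funpow_deriv)
qed

lemma sq_norm_diff_finite:
  assumes [measurable]: "f \<in> borel_measurable borel" "g \<in> borel_measurable borel"
    and fin: "sq_norm f < \<infinity>" "sq_norm g < \<infinity>"
  shows "sq_norm (\<lambda>x. f x - g x) < \<infinity>"
proof -
  have "sq_norm (\<lambda>x. f x - g x) \<le> (\<integral>\<^sup>+x. ennreal (2 * (cmod (f x))\<^sup>2) + ennreal (2 * (cmod (g x))\<^sup>2) \<partial>lborel)"
    unfolding sq_norm_def
  proof (intro nn_integral_mono)
    fix x
    have "(cmod (f x - g x))\<^sup>2 \<le> (cmod (f x) + cmod (g x))\<^sup>2"
      by (intro power_mono norm_triangle_ineq4) auto
    also have "\<dots> \<le> 2 * (cmod (f x))\<^sup>2 + 2 * (cmod (g x))\<^sup>2"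
      using sum_squares_bound[of "cmod (f x)" "cmod (g x)"] by (simp add: power2_sum)
    finally show "ennreal ((cmod (f x - g x))\<^sup>2) \<le> ennreal (2 * (cmod (f x))\<^sup>2) + ennreal (2 * (cmod (g x))\<^sup>2)"
      by (simp add: ennreal_leI flip: ennreal_plus)
  qed
  also have "\<dots> = ennreal 2 * sq_norm f + ennreal 2 * sq_norm g"
    unfolding sq_norm_def by (subst nn_integral_add) (simp_all add: ennreal_mult nn_integral_cmult)
  also have "\<dots> < \<infinity>" using fin by (simp add: ennreal_mult_less_top)
  finally show ?thesis .
qed

text \<open>Each component of the difference is square-integrable and orthogonal to all test
  functions.\<close>

theorem has_L2_weak_deriv_unique:
  fixes f :: "real \<Rightarrow> real ^ 'n"
  assumes g: "has_L2_weak_deriv k f g" and h: "has_L2_weak_deriv k f h"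
  shows "AE x in lborel. g x = h x"
proof -
  have gL: "g \<in> L2" and hL: "h \<in> L2" using g h by (auto simp: has_L2_weak_deriv_def)
  have [measurable]: "g \<in> borel_measurable borel" "h \<in> borel_measurable borel" using gL hL by (auto simp: L2_def)
  have "AE x in lborel. g x $ i - h x $ i = 0" for i
  proof (rule AE_eq_0_of_test_functions)
    show "sq_norm (\<lambda>x. of_real (g x $ i - h x $ i)) < \<infinity>"
      using sq_norm_diff_finite[of "\<lambda>x. of_real (g x $ i)" "\<lambda>x. of_real (h x $ i)"] gL hL
      by (simp add: L2_vec_iff)
    fix \<rho> assume \<rho>: "test_function \<rho>"
    have int: "integrable lborel (\<lambda>x. \<rho> x * f x $ i)" if "f \<in> L2" for f :: "real \<Rightarrow> real ^ 'n"
    proof -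
      have [measurable]: "f \<in> borel_measurable borel" "\<rho> \<in> borel_measurable borel"
        using that test_function_measurable[OF \<rho>] by (auto simp: L2_def)
      have "complex_integrable lborel (\<lambda>x. of_real (\<rho> x) * of_real (f x $ i))"
        using that by (intro integrable_mult_of_sq_norm test_function_sq_norm[OF \<rho>]) (auto simp: L2_vec_iff)
      then show ?thesis by (rule Bochner_Integration.integrable_bound) (auto simp: norm_mult abs_mult)
    qed
    have "(-1) ^ k * (\<integral>x. \<rho> x * g x $ i \<partial>lborel) = (-1) ^ k * (\<integral>x. \<rho> x * h x $ i \<partial>lborel)"
      using has_L2_weak_deriv_vec_nth[OF g \<rho>] has_L2_weak_deriv_vec_nth[OF h \<rho>] by metis
    then show "(\<integral>x. \<rho> x * (g x $ i - h x $ i) \<partial>lborel) = 0"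
      using int[OF gL] int[OF hL] by (simp add: right_diff_distrib)
  qed measurable
  then have "AE x in lborel. \<forall>i. g x $ i - h x $ i = 0" by (simp add: eventually_all_finite)
  then show ?thesis by eventually_elim (simp add: vec_eq_iff)
qed

text \<open>The representative is fixed by Hilbert's choice and otherwise unknown; uniqueness allows
  its norm to be computed from any explicitly constructed derivative.\<close>

lemma L2_norm_weak_deriv:
  fixes f :: "real \<Rightarrow> real ^ 'n"
  assumes "has_L2_weak_deriv k f g" shows "L2_norm (weak_deriv k f) = L2_norm g"
proof -
  have w: "has_L2_weak_deriv k f (weak_deriv k f)"
    unfolding weak_deriv_def by (rule someI[of "has_L2_weak_deriv k f", OF assms])
  have [measurable]: "weak_deriv k f \<in> borel_measurable borel" "g \<in> borel_measurable borel"
    using w assms by (auto simp: has_L2_weak_deriv_def L2_def)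
  have "(\<integral>x. (norm (weak_deriv k f x))\<^sup>2 \<partial>lborel) = (\<integral>x. (norm (g x))\<^sup>2 \<partial>lborel)"
    using has_L2_weak_deriv_unique[OF w assms] by (intro integral_cong_AE) (auto elim!: eventually_mono)
  then show ?thesis by (simp add: L2_norm_def)
qed

text \<open>The scalar construction is carried out in each component and the results are assembled
  into a vector; membership of \<open>f\<close> in \<open>L2\<close> is also recovered from the
  components.\<close>

theorem has_L2_weak_deriv_of_fourier:
  fixes f :: "real \<Rightarrow> real ^ 'n"
  assumes f: "\<And>i. has_L2_fourier (\<lambda>x. of_real (f x $ i)) (g i)"
    and fin: "\<And>i. sq_norm (\<lambda>\<xi>. (\<i> * of_real \<xi>) ^ k * g i \<xi>) < \<infinity>"
  obtains H where "has_L2_weak_deriv k f H"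
    "ennreal ((L2_norm H)\<^sup>2) \<le> (\<Sum>i\<in>UNIV. ennreal (1 / (2 * pi)) * sq_norm (\<lambda>\<xi>. (\<i> * of_real \<xi>) ^ k * g i \<xi>))"
proof -
  define P where "P i H \<longleftrightarrow> H \<in> borel_measurable borel \<and>
    sq_norm (\<lambda>x. of_real (H x)) \<le> ennreal (1 / (2 * pi)) * sq_norm (\<lambda>\<xi>. (\<i> * of_real \<xi>) ^ k * g i \<xi>) \<and>
    (\<forall>\<rho>. test_function \<rho> \<longrightarrow> (\<integral>x. (deriv ^^ k) \<rho> x * f x $ i \<partial>lborel) = (-1) ^ k * (\<integral>x. \<rho> x * H x \<partial>lborel))"
    for i and H :: "real \<Rightarrow> real"
  have "\<exists>H. P i H" for i
    unfolding P_def by (rule weak_deriv_from_fourier[OF f[of i] fin[of i]]) blast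
  then obtain H where H: "\<And>i. P i (H i)" by metis
  have Hm [measurable]: "H i \<in> borel_measurable borel"
    and H2: "sq_norm (\<lambda>x. of_real (H i x)) \<le> ennreal (1 / (2 * pi)) * sq_norm (\<lambda>\<xi>. (\<i> * of_real \<xi>) ^ k * g i \<xi>)" for i
    using H[of i] by (auto simp: P_def)
  have Hw: "(\<integral>x. (deriv ^^ k) \<rho> x * f x $ i \<partial>lborel) = (-1) ^ k * (\<integral>x. \<rho> x * H i x \<partial>lborel)"
    if "test_function \<rho>" for i \<rho>
    using H[of i] that by (simp add: P_def)
  define h where "h x = (\<chi> i. H i x)" for x
  have hm: "h \<in> borel_measurable borel" unfolding h_def by (rule borel_measurable_vec_lambda) (rule Hm)
  have "sq_norm (\<lambda>x. of_real (H i x)) < \<infinity>" for i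
    using H2[of i] fin[of i] by (auto intro: le_less_trans simp: ennreal_mult_less_top)
  then have hL: "h \<in> L2" using hm by (simp add: L2_vec_iff h_def)
  have fi: "(\<lambda>x. of_real (f x $ i) :: complex) \<in> L2" for i using f[of i] by (simp add: has_L2_fourier_def)
  have "(\<lambda>x. f x $ i) \<in> borel_measurable borel" for i
    using measurable_compose[OF borel_measurable_of_L2[OF fi[of i]], of Re borel] by simp
  then have "(\<lambda>x. \<chi> i. f x $ i) \<in> borel_measurable borel" by (rule borel_measurable_vec_lambda)
  then have fL: "f \<in> L2" using sq_norm_of_L2[OF fi] by (simp add: L2_vec_iff)
  show thesis
  proof (rule that)
    show "has_L2_weak_deriv k f h"
      unfolding has_L2_weak_deriv_def
    proof (intro conjI allI impI fL hL)
      fix \<rho> assume \<rho>: "test_function \<rho>"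
      show "(\<integral>x. (deriv ^^ k) \<rho> x *\<^sub>R f x \<partial>lborel) = (-1) ^ k *\<^sub>R (\<integral>x. \<rho> x *\<^sub>R h x \<partial>lborel)"
        using Hw[OF \<rho>]
        by (simp add: vec_eq_iff integral_test_function_vec_nth fL hL \<rho> test_function_funpow_deriv) (simp add: h_def)
    qed
    show "ennreal ((L2_norm h)\<^sup>2) \<le> (\<Sum>i\<in>UNIV. ennreal (1 / (2 * pi)) * sq_norm (\<lambda>\<xi>. (\<i> * of_real \<xi>) ^ k * g i \<xi>))"
      unfolding L2_norm_squared[OF hL] by (intro sum_mono) (use H2 in \<open>simp add: h_def\<close>)
  qed
qed

section \<open>Decay of the solution\<close>

text \<open>The scaling \<open>\<xi> = \<tau>^(-1/6) * s\<close> extracts the power of \<tau>, and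
  \<open>J\<close> is the remaining integral at \<tau> = 1, finite by comparison with a Gaussian
  moment.\<close>

lemma nn_integral_sextic_moment:
  assumes c: "c > 0"
  obtains J :: real where "J \<ge> 0"
    "\<And>\<tau>. \<tau> > 0 \<Longrightarrow> (\<integral>\<^sup>+\<xi>. ennreal (\<xi> ^ (2 * j) * exp (- c * \<xi> ^ 6 * \<tau>)) \<partial>lborel) \<le> ennreal (J * \<tau> powr (- (2 * real j + 1) / 6))"
proof -
  \<comment> \<open>If \<open>s^2\<close> exceeds both 1 and \<open>1 / (2 * c)\<close>, then
    \<open>c * s^6\<close> is at least \<open>s^2 / 2\<close>; otherwise \<open>s^2 / 2\<close> is
    at most \<open>R / 2\<close>.\<close>
  define R where "R = max 1 (1 / (2 * c))"
  have R: "R \<ge> 1" "1 / (2 * c) \<le> R" by (auto simp: R_def)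
  have le: "exp (- c * s ^ 6) \<le> exp (R / 2) * exp (- s\<^sup>2 / 2)" for s :: real
  proof -
    have "s\<^sup>2 / 2 - c * s ^ 6 \<le> R / 2"
    proof (cases "s\<^sup>2 \<le> R")
      case True
      have "c * s ^ 6 \<ge> 0" using c by simp
      then show ?thesis using True by linarith
    next
      case False
      then have s2: "s\<^sup>2 \<ge> 1" "s\<^sup>2 \<ge> 1 / (2 * c)" using R by linarith+
      have "1 \<le> 2 * c * s\<^sup>2" using s2(2) c by (simp add: field_simps)
      also have "s\<^sup>2 \<le> s\<^sup>2 * s\<^sup>2" using mult_left_mono[OF s2(1), of "s\<^sup>2"] by simp
      then have "2 * c * s\<^sup>2 \<le> 2 * c * (s\<^sup>2 * s\<^sup>2)" by (rule mult_left_mono) (use c in simp)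
      finally have "s\<^sup>2 * 1 \<le> s\<^sup>2 * (2 * c * (s\<^sup>2 * s\<^sup>2))" by (intro mult_left_mono) auto
      also have "\<dots> = 2 * (c * s ^ 6)" by (simp add: eval_nat_numeral)
      finally show ?thesis using R by simp
    qed
    then show ?thesis by (simp flip: exp_add)
  qed
  define h where "h s = s ^ (2 * j) * exp (- c * s ^ 6)" for s :: real
  have h0: "h s \<ge> 0" for s by (simp add: h_def)
  have "integrable lborel h"
  proof (rule Bochner_Integration.integrable_bound)
    show "integrable lborel (\<lambda>s. (exp (R / 2) * sqrt (2 * pi)) * (std_normal_density s * s ^ (2 * j)))"
      by (intro integrable_mult_right integrable_std_normal_moment)
    have "h s \<le> (exp (R / 2) * sqrt (2 * pi)) * (std_normal_density s * s ^ (2 * j))" for s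
    proof -
      have "h s \<le> s ^ (2 * j) * (exp (R / 2) * exp (- s\<^sup>2 / 2))" unfolding h_def by (intro mult_left_mono le) simp
      then show ?thesis by (simp add: std_normal_density_def mult_ac)
    qed
    then show "AE s in lborel. norm (h s) \<le> norm ((exp (R / 2) * sqrt (2 * pi)) * (std_normal_density s * s ^ (2 * j)))"
      using h0 by (intro AE_I2) (metis abs_of_nonneg abs_ge_self order.trans real_norm_def)
    show "h \<in> borel_measurable lborel" unfolding h_def by measurable
  qed
  then have J: "(\<integral>\<^sup>+s. ennreal (h s) \<partial>lborel) = ennreal (\<integral>s. h s \<partial>lborel)"
    using h0 by (intro nn_integral_eq_integral) auto
  show thesis
  proof (rule that)
    show "(\<integral>s. h s \<partial>lborel) \<ge> 0" using h0 by (intro integral_nonneg_AE) auto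
    fix \<tau> :: real assume \<tau>: "\<tau> > 0"
    define \<kappa> where "\<kappa> = \<tau> powr (- 1 / 6)"
    have \<kappa>: "\<kappa> > 0" using \<tau> by (simp add: \<kappa>_def)
    have \<kappa>_pow: "\<kappa> ^ n = \<tau> powr (- real n / 6)" for n
      using \<tau> by (simp add: \<kappa>_def powr_power mult.commute)
    have \<kappa>6: "\<kappa> ^ 6 * \<tau> = 1" using \<tau> by (simp add: \<kappa>_pow powr_minus)
    have "(\<integral>\<^sup>+\<xi>. ennreal (\<xi> ^ (2 * j) * exp (- c * \<xi> ^ 6 * \<tau>)) \<partial>lborel)
      = ennreal \<bar>\<kappa>\<bar> * (\<integral>\<^sup>+s. ennreal ((0 + \<kappa> * s) ^ (2 * j) * exp (- c * (0 + \<kappa> * s) ^ 6 * \<tau>)) \<partial>lborel)"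
      using \<kappa> by (intro nn_integral_real_affine) auto
    also have "(\<lambda>s. (0 + \<kappa> * s) ^ (2 * j) * exp (- c * (0 + \<kappa> * s) ^ 6 * \<tau>)) = (\<lambda>s. \<kappa> ^ (2 * j) * h s)"
    proof
      fix s
      have "c * (\<kappa> * s) ^ 6 * \<tau> = c * s ^ 6 * (\<kappa> ^ 6 * \<tau>)" by (simp add: power_mult_distrib)
      then have "- c * (0 + \<kappa> * s) ^ 6 * \<tau> = - c * s ^ 6" unfolding \<kappa>6 by simp
      then show "(0 + \<kappa> * s) ^ (2 * j) * exp (- c * (0 + \<kappa> * s) ^ 6 * \<tau>) = \<kappa> ^ (2 * j) * h s"
        by (simp add: h_def power_mult_distrib)
    qed
    also have "(\<integral>\<^sup>+s. ennreal (\<kappa> ^ (2 * j) * h s) \<partial>lborel) = ennreal (\<kappa> ^ (2 * j)) * ennreal (\<integral>s. h s \<partial>lborel)"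
      using \<kappa> h0 J by (simp add: ennreal_mult nn_integral_cmult h_def)
    also have "ennreal \<bar>\<kappa>\<bar> * \<dots> = ennreal (\<kappa> ^ (2 * j + 1) * (\<integral>s. h s \<partial>lborel))"
      using \<kappa> h0 by (simp add: mult.assoc flip: ennreal_mult)
    also have "\<kappa> ^ (2 * j + 1) = \<tau> powr (- (2 * real j + 1) / 6)" by (simp only: \<kappa>_pow) (simp add: algebra_simps)
    finally show "(\<integral>\<^sup>+\<xi>. ennreal (\<xi> ^ (2 * j) * exp (- c * \<xi> ^ 6 * \<tau>)) \<partial>lborel)
      \<le> ennreal ((\<integral>s. h s \<partial>lborel) * \<tau> powr (- (2 * real j + 1) / 6))"
      by (simp add: mult.commute)
  qed
qed

text \<open>Split at \<open>\<bar>\<xi>\<bar> = 1\<close>. Below, \<open>(1 + \<xi>^2)^4\<close> is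
  at most 16, which keeps the sextic exponential. Above, the rate is at least
  \<open>1 / (16 \<xi>^2)\<close>, and \<open>exp (- z) \<le> fact l / z^l\<close> turns this into a
  power of time at the price of \<open>\<xi>^(2 l)\<close>.\<close>

lemma exp_decay_rate_le:
  assumes c: "c > 0"
  obtains K where "K > 0"
    "\<And>\<xi> t. t \<ge> 0 \<Longrightarrow> exp (- c * decay_rate \<xi> * t) \<le> K * (exp (- (c / 16) * \<xi> ^ 6 * (1 + t)) + \<xi> ^ (2 * l) / (1 + t) ^ l)"
proof -
  define b where "b = c / 16"
  have b: "b > 0" using c by (simp add: b_def)
  \<comment> \<open>The factor \<open>exp b\<close> pays for replacing \<open>t\<close> by
    \<open>1 + t\<close> in the exponents; the two summands serve the low and the high
    frequencies.\<close>
  define K where "K = exp b * (1 + fact l / b ^ l)"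
  have K: "exp b \<le> K" "exp b * (fact l / b ^ l) \<le> K" using b by (auto simp: K_def distrib_left)
  have K0: "K > 0" using K(1) exp_gt_zero[of b] by linarith
  show thesis
  proof (rule that[OF K0])
    fix \<xi> t :: real assume t: "t \<ge> 0"
    have p: "1 + \<xi>\<^sup>2 > 0" by (simp add: add_pos_nonneg)
    show "exp (- c * decay_rate \<xi> * t) \<le> K * (exp (- (c / 16) * \<xi> ^ 6 * (1 + t)) + \<xi> ^ (2 * l) / (1 + t) ^ l)"
    proof (cases "\<bar>\<xi>\<bar> \<le> 1")
      case True
      then have x2: "\<xi>\<^sup>2 \<le> 1" by (simp add: abs_square_le_1)
      have x6: "\<xi> ^ 6 \<le> 1"
      proof -
        have "(\<xi>\<^sup>2) ^ 3 \<le> 1" using x2 by (rule power_le_one[rotated]) simp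
        then show ?thesis by (simp flip: power_mult)
      qed
      have "(1 + \<xi>\<^sup>2) ^ 4 \<le> 2 ^ 4" using x2 by (intro power_mono) auto
      then have "\<xi> ^ 6 / 16 \<le> decay_rate \<xi>"
        unfolding decay_rate_def using p by (intro divide_left_mono) auto
      then have "c * (\<xi> ^ 6 / 16) * t \<le> c * decay_rate \<xi> * t" using c t by (intro mult_right_mono mult_left_mono) auto
      moreover have "b * \<xi> ^ 6 \<le> b" using x6 b by (simp add: mult_left_le)
      ultimately have "- c * decay_rate \<xi> * t \<le> b + - b * \<xi> ^ 6 * (1 + t)"
        by (simp add: b_def algebra_simps)
      then have "exp (- c * decay_rate \<xi> * t) \<le> exp b * exp (- b * \<xi> ^ 6 * (1 + t))"
        by (simp flip: exp_add)
      also have "\<dots> \<le> K * exp (- b * \<xi> ^ 6 * (1 + t))" using K by (intro mult_right_mono) auto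
      also have "\<dots> \<le> K * (exp (- b * \<xi> ^ 6 * (1 + t)) + \<xi> ^ (2 * l) / (1 + t) ^ l)"
        using K0 t by (intro mult_left_mono) auto
      finally show ?thesis by (simp add: b_def)
    next
      case False
      then have x2: "\<xi>\<^sup>2 \<ge> 1" using abs_square_le_1[of \<xi>] by linarith
      have x0: "\<xi> \<noteq> 0" using False by auto
      have "(1 + \<xi>\<^sup>2) ^ 4 \<le> (2 * \<xi>\<^sup>2) ^ 4" using x2 by (intro power_mono) auto
      moreover have "0 < (2 * \<xi>\<^sup>2) ^ 4 * (1 + \<xi>\<^sup>2) ^ 4" using p x0 by (intro mult_pos_pos) simp_all
      ultimately have "\<xi> ^ 6 / (2 * \<xi>\<^sup>2) ^ 4 \<le> decay_rate \<xi>"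
        unfolding decay_rate_def by (intro divide_left_mono) simp_all
      moreover have "\<xi> ^ 6 / (2 * \<xi>\<^sup>2) ^ 4 = 1 / (16 * \<xi>\<^sup>2)"
        using x0 by (simp add: power_mult_distrib field_simps flip: power_mult power_add)
      ultimately have "c * (1 / (16 * \<xi>\<^sup>2)) * t \<le> c * decay_rate \<xi> * t"
        using c t by (intro mult_right_mono mult_left_mono) auto
      moreover have "b / \<xi>\<^sup>2 \<le> b" using x2 b by (simp add: divide_le_eq mult_le_cancel_left1)
      moreover define z where "z = b * (1 + t) / \<xi>\<^sup>2"
      ultimately have "- c * decay_rate \<xi> * t \<le> b + - z"
        by (simp add: b_def z_def algebra_simps add_divide_distrib)
      then have "exp (- c * decay_rate \<xi> * t) \<le> exp b * exp (- z)"
        by (simp flip: exp_add)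
      also have "exp (- z) \<le> fact l / z ^ l"
      proof -
        have z: "z > 0" using b t x0 by (simp add: z_def)
        have "z ^ l * exp (- z) \<le> fact l * exp z * exp (- z)" using z by (intro mult_right_mono power_le_fact_exp) auto
        then show ?thesis using z by (simp add: mult.assoc field_simps flip: exp_add)
      qed
      also have "fact l / z ^ l = fact l / b ^ l * (\<xi> ^ (2 * l) / (1 + t) ^ l)"
        by (simp add: z_def power_divide power_mult_distrib power_mult)
      also have "exp b * (fact l / b ^ l * (\<xi> ^ (2 * l) / (1 + t) ^ l)) = exp b * (fact l / b ^ l) * (\<xi> ^ (2 * l) / (1 + t) ^ l)"
        by simp
      also have "\<dots> \<le> K * (\<xi> ^ (2 * l) / (1 + t) ^ l)" using K t by (intro mult_right_mono) auto
      also have "\<dots> \<le> K * (exp (- b * \<xi> ^ 6 * (1 + t)) + \<xi> ^ (2 * l) / (1 + t) ^ l)"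
        using K0 by (intro mult_left_mono) auto
      finally show ?thesis by (simp add: b_def mult_left_mono)
    qed
  qed
qed

lemma sq_norm_ixi_power:
  "sq_norm (\<lambda>\<xi>. (\<i> * of_real \<xi>) ^ k * g \<xi>) = (\<integral>\<^sup>+\<xi>. ennreal (\<xi> ^ (2 * k) * (cmod (g \<xi>))\<^sup>2) \<partial>lborel)"
proof -
  have "(\<bar>\<xi>\<bar> ^ k)\<^sup>2 = \<bar>\<xi>\<bar> ^ (2 * k)" for \<xi> :: real by (simp only: power_mult[symmetric] mult.commute[of k 2])
  then have "(\<bar>\<xi>\<bar> ^ k)\<^sup>2 = \<xi> ^ (2 * k)" for \<xi> :: real by (simp add: power_mult)
  then show ?thesis unfolding sq_norm_def by (simp add: norm_mult norm_power power_mult_distrib)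
qed

text \<open>Membership in \<open>sobolev j\<close> belongs to the conclusion, since otherwise
  \<open>weak_deriv j (U t)\<close> could be an arbitrary function and the estimate would say
  nothing.\<close>

theorem theorem4p2:
  fixes k1 k2 k3 k4 k5 \<gamma> :: real
    and N l j :: nat
    and U0 :: "real \<Rightarrow> real ^ 8"
    and U :: "real \<Rightarrow> real \<Rightarrow> real ^ 8"
  assumes "k1 > 0" "k2 > 0" "k3 > 0" "k4 > 0" "k5 > 0" "\<gamma> > 0"
    and "k2 \<noteq> k3"
    and "N \<ge> 1" "l \<ge> 1" "l \<le> N"
    and "U0 \<in> sobolev N" "integrable lborel U0"
    and "timoshenko_solution k1 k2 k3 k4 k5 \<gamma> U0 U"
    and "j \<le> N - l"
  shows "\<exists>c0>0. \<forall>t\<ge>0.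
           U t \<in> sobolev j \<and>
           L2_norm (weak_deriv j (U t))
             \<le> c0 * (1 + t) powr (- 1 / 12 - real j / 6) * L1_norm U0
               + c0 * (1 + t) powr (- real l / 2) * L2_norm (weak_deriv (j + l) U0)"
proof -
  obtain Uhat :: "real \<Rightarrow> real \<Rightarrow> complex ^ 8" where
    sys: "\<And>\<xi>. solves_transformed_system k1 k2 k3 k4 k5 \<gamma> \<xi> (Uhat \<xi>)"
    and init: "\<And>\<xi> i. Uhat \<xi> 0 $ i = fourier (\<lambda>x. of_real (U0 x $ i)) \<xi>"
    and four: "\<And>t i. t \<ge> 0 \<Longrightarrow> has_L2_fourier (\<lambda>x. of_real (U t x $ i)) (\<lambda>\<xi>. Uhat \<xi> t $ i)"
    using assms(13) unfolding timoshenko_solution_def by blast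
  obtain C c where C: "C > 0" and c: "c > 0" and decay: "\<And>\<xi> t i. t \<ge> 0 \<Longrightarrow>
       (cmod (Uhat \<xi> t $ i))\<^sup>2 \<le> C * exp (- c * decay_rate \<xi> * t) * (\<Sum>i\<in>UNIV. (cmod (Uhat \<xi> 0 $ i))\<^sup>2)"
    by (rule transformed_system_decay[OF assms(1-7)]) (use sys in blast)
  obtain K where K: "K > 0" and exp_le: "\<And>\<xi> t. t \<ge> 0 \<Longrightarrow>
      exp (- c * decay_rate \<xi> * t) \<le> K * (exp (- (c / 16) * \<xi> ^ 6 * (1 + t)) + \<xi> ^ (2 * l) / (1 + t) ^ l)"
    using exp_decay_rate_le[OF c] by blast
  have "c / 16 > 0" using c by simp
  then obtain J where J: "J \<ge> 0" and moment: "\<And>\<tau>. \<tau> > 0 \<Longrightarrow>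
      (\<integral>\<^sup>+\<xi>. ennreal (\<xi> ^ (2 * j) * exp (- (c / 16) * \<xi> ^ 6 * \<tau>)) \<partial>lborel) \<le> ennreal (J * \<tau> powr (- (2 * real j + 1) / 6))"
    using nn_integral_sextic_moment[of "c / 16" j] by blast
  define m where "m = j + l"
  define A where "A = L1_norm U0"
  define G where "G = weak_deriv m U0"
  define B where "B = L2_norm G"
  have A0: "A \<ge> 0" unfolding A_def L1_norm_def by (intro integral_nonneg_AE) auto
  have B0: "B \<ge> 0" unfolding B_def L2_norm_def by (intro real_sqrt_ge_zero integral_nonneg_AE) auto
  have "m \<le> N" using assms(10,14) by (simp add: m_def)
  then have "\<exists>g. has_L2_weak_deriv m U0 g" using assms(11) by (simp add: sobolev_def)
  then have G: "has_L2_weak_deriv m U0 G" unfolding G_def weak_deriv_def by (rule someI_ex)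
  then have GL: "G \<in> L2" by (simp add: has_L2_weak_deriv_def)
  have U0i: "integrable lborel (\<lambda>x. U0 x $ i)" for i
    by (rule integrable_bounded_linear[OF bounded_linear_vec_nth assms(12)])
  have Gm: "(\<lambda>x. G x $ i) \<in> borel_measurable borel" for i
    using GL by (auto simp: L2_def intro: measurable_compose[OF _ borel_measurable_vec_nth])
  define S0 where "S0 \<xi> = (\<Sum>i\<in>UNIV. (cmod (Uhat \<xi> 0 $ i))\<^sup>2)" for \<xi>
  have S00: "S0 \<xi> \<ge> 0" for \<xi> unfolding S0_def by (intro sum_nonneg) auto
  have Uhat0_m [measurable]: "(\<lambda>\<xi>. Uhat \<xi> 0 $ i) \<in> borel_measurable borel" for i
  proof -
    have "(\<lambda>x. U0 x $ i) \<in> borel_measurable borel" using U0i[of i] by auto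
    then have "(\<lambda>x. of_real (U0 x $ i) :: complex) \<in> borel_measurable borel" by measurable
    then show ?thesis unfolding init by (rule borel_measurable_fourier) measurable
  qed
  have S0_m [measurable]: "S0 \<in> borel_measurable borel" unfolding S0_def[abs_def] by measurable
  \<comment> \<open>For the low frequencies the data enter only through the supremum of their
    transform; each of the eight components is at most the \<open>L\<^sup>1\<close> norm.\<close>
  have S0_le: "S0 \<xi> \<le> 8 * A\<^sup>2" for \<xi>
  proof -
    have "cmod (Uhat \<xi> 0 $ i) \<le> A" for i
    proof -
      have "cmod (Uhat \<xi> 0 $ i) \<le> (\<integral>x. cmod (of_real (U0 x $ i)) \<partial>lborel)" unfolding init by (rule norm_fourier_le)
      also have "\<dots> = (\<integral>x. \<bar>U0 x $ i\<bar> \<partial>lborel)" by simp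
      also have "\<dots> \<le> A" unfolding A_def L1_norm_def
        by (intro integral_mono integrable_abs U0i integrable_norm assms(12) component_le_norm_cart)
      finally show ?thesis .
    qed
    then have "S0 \<xi> \<le> (\<Sum>i\<in>(UNIV :: 8 set). A\<^sup>2)" unfolding S0_def by (intro sum_mono power_mono) auto
    then show ?thesis by simp
  qed
  \<comment> \<open>For the high frequencies the factors \<open>\<xi>^(2 j)\<close> and
    \<open>\<xi>^(2 l)\<close> combine to the order \<open>m = j + l\<close> of the weak derivative
    of the data.\<close>
  have high: "(\<integral>\<^sup>+\<xi>. ennreal (\<xi> ^ (2 * m) * S0 \<xi>) \<partial>lborel) \<le> ennreal (2 * pi * B\<^sup>2)"
  proof -
    have "(\<integral>\<^sup>+\<xi>. ennreal (\<xi> ^ (2 * m) * S0 \<xi>) \<partial>lborel) = (\<integral>\<^sup>+\<xi>. (\<Sum>i\<in>UNIV. ennreal (\<xi> ^ (2 * m) * (cmod (Uhat \<xi> 0 $ i))\<^sup>2)) \<partial>lborel)"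
      by (simp add: S0_def sum_distrib_left)
    also have "\<dots> = (\<Sum>i\<in>UNIV. sq_norm (\<lambda>\<xi>. (\<i> * of_real \<xi>) ^ m * Uhat \<xi> 0 $ i))"
      unfolding sq_norm_ixi_power by (intro nn_integral_sum) measurable
    also have "\<dots> \<le> (\<Sum>i\<in>UNIV. ennreal (2 * pi) * sq_norm (\<lambda>x. of_real (G x $ i)))"
      unfolding init using has_L2_weak_deriv_vec_nth[OF G]
      by (intro sum_mono sq_norm_fourier_le_weak_deriv U0i Gm)
    also have "\<dots> = ennreal (2 * pi) * ennreal (B\<^sup>2)"
      unfolding B_def L2_norm_squared[OF GL] by (simp only: sum_distrib_left)
    finally show ?thesis by (simp add: ennreal_mult)
  qed
  define Q where "Q t = C * K * (8 * A\<^sup>2 * (J * (1 + t) powr (- (2 * real j + 1) / 6)) + 2 * pi * B\<^sup>2 * (1 + t) powr (- real l))" for t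
  have energy: "sq_norm (\<lambda>\<xi>. (\<i> * of_real \<xi>) ^ j * Uhat \<xi> t $ i) \<le> ennreal (Q t)" if t: "t \<ge> 0" for t i
  proof -
    have pw: "(1 + t) powr (- real l) = 1 / (1 + t) ^ l"
      using t by (simp add: powr_minus powr_realpow divide_inverse)
    have "\<xi> ^ (2 * j) * (cmod (Uhat \<xi> t $ i))\<^sup>2
       \<le> C * K * (8 * A\<^sup>2) * (\<xi> ^ (2 * j) * exp (- (c / 16) * \<xi> ^ 6 * (1 + t))) + C * K * (1 / (1 + t) ^ l) * (\<xi> ^ (2 * m) * S0 \<xi>)" for \<xi>
    proof -
      have "\<xi> ^ (2 * j) * (cmod (Uhat \<xi> t $ i))\<^sup>2 \<le> \<xi> ^ (2 * j) * (C * exp (- c * decay_rate \<xi> * t) * S0 \<xi>)"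
        using decay[OF t, of \<xi> i] unfolding S0_def by (intro mult_left_mono) auto
      also have "\<dots> \<le> \<xi> ^ (2 * j) * (C * (K * (exp (- (c / 16) * \<xi> ^ 6 * (1 + t)) + \<xi> ^ (2 * l) / (1 + t) ^ l)) * S0 \<xi>)"
        using C S00 by (intro mult_left_mono mult_right_mono exp_le[OF t]) auto
      also have "\<dots> = C * K * S0 \<xi> * (\<xi> ^ (2 * j) * exp (- (c / 16) * \<xi> ^ 6 * (1 + t))) + C * K * (1 / (1 + t) ^ l) * (\<xi> ^ (2 * m) * S0 \<xi>)"
        by (simp add: m_def power_add algebra_simps)
      also have "C * K * S0 \<xi> * (\<xi> ^ (2 * j) * exp (- (c / 16) * \<xi> ^ 6 * (1 + t)))
         \<le> C * K * (8 * A\<^sup>2) * (\<xi> ^ (2 * j) * exp (- (c / 16) * \<xi> ^ 6 * (1 + t)))"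
        using C K S0_le by (intro mult_right_mono mult_left_mono) auto
      finally show ?thesis by simp
    qed
    then have "sq_norm (\<lambda>\<xi>. (\<i> * of_real \<xi>) ^ j * Uhat \<xi> t $ i)
      \<le> (\<integral>\<^sup>+\<xi>. ennreal (C * K * (8 * A\<^sup>2)) * ennreal (\<xi> ^ (2 * j) * exp (- (c / 16) * \<xi> ^ 6 * (1 + t))) + ennreal (C * K * (1 / (1 + t) ^ l)) * ennreal (\<xi> ^ (2 * m) * S0 \<xi>) \<partial>lborel)"
      unfolding sq_norm_ixi_power using C K t S00
      by (intro nn_integral_mono) (simp add: ennreal_leI flip: ennreal_mult ennreal_plus)
    also have "\<dots> = ennreal (C * K * (8 * A\<^sup>2)) * (\<integral>\<^sup>+\<xi>. ennreal (\<xi> ^ (2 * j) * exp (- (c / 16) * \<xi> ^ 6 * (1 + t))) \<partial>lborel)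
       + ennreal (C * K * (1 / (1 + t) ^ l)) * (\<integral>\<^sup>+\<xi>. ennreal (\<xi> ^ (2 * m) * S0 \<xi>) \<partial>lborel)"
      by (simp add: nn_integral_add nn_integral_cmult)
    also have "\<dots> \<le> ennreal (C * K * (8 * A\<^sup>2)) * ennreal (J * (1 + t) powr (- (2 * real j + 1) / 6))
       + ennreal (C * K * (1 / (1 + t) ^ l)) * ennreal (2 * pi * B\<^sup>2)"
      using t by (intro add_mono mult_left_mono moment high) auto
    also have "\<dots> = ennreal (Q t)"
    proof -
      have "0 \<le> C * K * (8 * A\<^sup>2)" "0 \<le> J * (1 + t) powr (- (2 * real j + 1) / 6)" "0 \<le> C * K * (1 / (1 + t) ^ l)" "0 \<le> 2 * pi * B\<^sup>2"
        using C K J t by auto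
      then have "ennreal (C * K * (8 * A\<^sup>2)) * ennreal (J * (1 + t) powr (- (2 * real j + 1) / 6)) + ennreal (C * K * (1 / (1 + t) ^ l)) * ennreal (2 * pi * B\<^sup>2)
        = ennreal (C * K * (8 * A\<^sup>2) * (J * (1 + t) powr (- (2 * real j + 1) / 6)) + C * K * (1 / (1 + t) ^ l) * (2 * pi * B\<^sup>2))"
        by (simp only: ennreal_mult[symmetric] ennreal_plus[symmetric] mult_nonneg_nonneg)
      then show ?thesis unfolding Q_def pw by (simp add: algebra_simps)
    qed
    finally show ?thesis .
  qed
  \<comment> \<open>Membership in \<open>sobolev j\<close> needs all orders up to \<open>j\<close>.
    The intermediate ones follow from orders 0 and \<open>j\<close> by
    \<open>\<xi>^(2 k) \<le> 1 + \<xi>^(2 j)\<close>; order 0 is the square-integrability contained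
    in the notion of solution.\<close>
  have fin: "sq_norm (\<lambda>\<xi>. (\<i> * of_real \<xi>) ^ k * Uhat \<xi> t $ i) < \<infinity>" if t: "t \<ge> 0" and k: "k \<le> j" for t k i
  proof -
    have L: "(\<lambda>\<xi>. Uhat \<xi> t $ i) \<in> L2" using four[OF t, of i] by (simp add: has_L2_fourier_def)
    note [measurable] = borel_measurable_of_L2[OF L]
    have "\<xi> ^ (2 * k) \<le> 1 + \<xi> ^ (2 * j)" for \<xi> :: real
    proof (cases "\<xi>\<^sup>2 \<le> 1")
      case True
      then have "(\<xi>\<^sup>2) ^ k \<le> 1" by (rule power_le_one[rotated]) simp
      moreover have "0 \<le> (\<xi>\<^sup>2) ^ j" by simp
      ultimately show ?thesis unfolding power_mult by linarith
    next
      case False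
      then have "(\<xi>\<^sup>2) ^ k \<le> (\<xi>\<^sup>2) ^ j" using k by (intro power_increasing) auto
      then show ?thesis unfolding power_mult by linarith
    qed
    then have "\<xi> ^ (2 * k) * (cmod (Uhat \<xi> t $ i))\<^sup>2 \<le> (cmod (Uhat \<xi> t $ i))\<^sup>2 + \<xi> ^ (2 * j) * (cmod (Uhat \<xi> t $ i))\<^sup>2" for \<xi>
      using mult_right_mono[of "\<xi> ^ (2 * k)" "1 + \<xi> ^ (2 * j)" "(cmod (Uhat \<xi> t $ i))\<^sup>2"] by (simp add: distrib_right)
    then have "sq_norm (\<lambda>\<xi>. (\<i> * of_real \<xi>) ^ k * Uhat \<xi> t $ i)
      \<le> (\<integral>\<^sup>+\<xi>. ennreal ((cmod (Uhat \<xi> t $ i))\<^sup>2) + ennreal (\<xi> ^ (2 * j) * (cmod (Uhat \<xi> t $ i))\<^sup>2) \<partial>lborel)"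
      unfolding sq_norm_ixi_power by (intro nn_integral_mono) (simp add: ennreal_leI flip: ennreal_plus)
    also have "\<dots> = sq_norm (\<lambda>\<xi>. Uhat \<xi> t $ i) + sq_norm (\<lambda>\<xi>. (\<i> * of_real \<xi>) ^ j * Uhat \<xi> t $ i)"
      unfolding sq_norm_ixi_power unfolding sq_norm_def by (intro nn_integral_add) measurable
    also have "\<dots> < \<infinity>" using sq_norm_of_L2[OF L] energy[OF t, of i] by (auto intro: le_less_trans)
    finally show ?thesis .
  qed
  \<comment> \<open>The square roots of the two coefficients in \<open>2 * Q t\<close>, plus 1 for
    strict positivity. Only \<open>C\<close>, \<open>K\<close> and \<open>J\<close> enter, so the
    constant does not depend on the initial data.\<close>
  define c0 where "c0 = 1 + sqrt (16 * C * K * J) + sqrt (4 * pi * C * K)"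
  have s0: "sqrt (16 * C * K * J) \<ge> 0" "sqrt (4 * pi * C * K) \<ge> 0" using C K J by auto
  have c0: "c0 > 0" "sqrt (16 * C * K * J) \<le> c0" "sqrt (4 * pi * C * K) \<le> c0" using s0 unfolding c0_def by linarith+
  show ?thesis
  proof (intro exI[of _ c0] conjI allI impI c0(1))
    fix t :: real assume t: "t \<ge> 0"
    show "U t \<in> sobolev j"
      unfolding sobolev_def using has_L2_weak_deriv_of_fourier[OF four[OF t] fin[OF t]] by blast
    obtain H where H: "has_L2_weak_deriv j (U t) H" and
      Hle: "ennreal ((L2_norm H)\<^sup>2) \<le> (\<Sum>i\<in>UNIV. ennreal (1 / (2 * pi)) * sq_norm (\<lambda>\<xi>. (\<i> * of_real \<xi>) ^ j * Uhat \<xi> t $ i))"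
      using has_L2_weak_deriv_of_fourier[OF four[OF t] fin[OF t order.refl]] by blast
    define a where "a = (1 + t) powr (- 1 / 12 - real j / 6)"
    define d where "d = (1 + t) powr (- real l / 2)"
    have ad: "a \<ge> 0" "d \<ge> 0" by (auto simp: a_def d_def)
    have sq: "((1 + t) powr x)\<^sup>2 = (1 + t) powr y" if "y = 2 * x" for x y
      using t that by (simp add: power2_eq_square flip: powr_add)
    \<comment> \<open>The squared norm decays with twice the exponents of the theorem:
      \<open>(2 j + 1) / 6\<close> is twice \<open>1/12 + j/6\<close>.\<close>
    have a2: "(1 + t) powr (- (2 * real j + 1) / 6) = a\<^sup>2" and d2: "(1 + t) powr (- real l) = d\<^sup>2"
      unfolding a_def d_def by (rule sq[symmetric], simp add: add_divide_distrib)+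
    have Q: "Q t = C * K * (8 * A\<^sup>2 * (J * a\<^sup>2) + 2 * pi * B\<^sup>2 * d\<^sup>2)" unfolding Q_def a2 d2 ..
    have Q0: "Q t \<ge> 0" unfolding Q using C K J by auto
    note Hle
    also have "(\<Sum>i\<in>(UNIV :: 8 set). ennreal (1 / (2 * pi)) * sq_norm (\<lambda>\<xi>. (\<i> * of_real \<xi>) ^ j * Uhat \<xi> t $ i))
       \<le> (\<Sum>i\<in>(UNIV :: 8 set). ennreal (1 / (2 * pi)) * ennreal (Q t))"
      by (intro sum_mono mult_left_mono energy t) auto
    also have "\<dots> = ennreal (\<Sum>i\<in>(UNIV :: 8 set). 1 / (2 * pi) * Q t)"
      using Q0 by (simp only: ennreal_mult[symmetric] zero_le_divide_1_iff sum_ennreal mult_nonneg_nonneg pi_ge_zero zero_le_numeral)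
    also have "\<dots> = ennreal (8 * (1 / (2 * pi) * Q t))" by simp
    finally have "(L2_norm H)\<^sup>2 \<le> 8 * (1 / (2 * pi) * Q t)" using Q0 by simp
    \<comment> \<open>Eight components with the Parseval factor \<open>1 / (2 * pi)\<close> give
      \<open>4 / pi\<close>, rounded up to 2.\<close>
    also have "\<dots> \<le> 2 * Q t"
      using Q0 pi_gt3 mult_right_mono[of 2 pi "Q t"] by (simp add: divide_le_eq mult.commute)
    also have "\<dots> = 16 * C * K * J * (a * A)\<^sup>2 + 4 * pi * C * K * (d * B)\<^sup>2"
      unfolding Q by (simp add: power_mult_distrib algebra_simps)
    finally have "L2_norm H \<le> sqrt (16 * C * K * J * (a * A)\<^sup>2 + 4 * pi * C * K * (d * B)\<^sup>2)"
      by (rule real_le_rsqrt)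
    also have "\<dots> \<le> sqrt (16 * C * K * J * (a * A)\<^sup>2) + sqrt (4 * pi * C * K * (d * B)\<^sup>2)"
      using C K J by (intro sqrt_add_le_add_sqrt) auto
    also have "\<dots> = sqrt (16 * C * K * J) * (a * A) + sqrt (4 * pi * C * K) * (d * B)"
      using ad A0 B0 by (simp add: real_sqrt_mult[of _ "_ ^ 2"])
    also have "\<dots> \<le> c0 * (a * A) + c0 * (d * B)"
      using ad A0 B0 c0 by (intro add_mono mult_right_mono) auto
    finally show "L2_norm (weak_deriv j (U t)) \<le> c0 * (1 + t) powr (- 1 / 12 - real j / 6) * L1_norm U0
         + c0 * (1 + t) powr (- real l / 2) * L2_norm (weak_deriv (j + l) U0)"
      unfolding L2_norm_weak_deriv[OF H] a_def d_def A_def B_def G_def m_def by (simp add: mult.assoc)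
  qed
qed

end
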